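(* Let $\mathcal{E}$ be a full right Hilbert $C^*$-module over a unital $C^*$-algebra $\mathcal{A}$ and let $H_1,H_2$ be Hilbert spaces. Assume $(\varphi_1,\Phi_1),(\varphi_2,\Phi_2)\in\mathcal{CPE}(\mathcal{E},H_1,H_2)$ and $(\varphi_1,\Phi_1)\ll(\varphi_2,\Phi_2)$. Then there exist a dilation pair $((\rho,K_1,W'),(\Psi,K_2,W))$ for $(\varphi_2,\Phi_2)$ such that $\Psi$ is non-degenerate and a unique positive contraction $T\oplus S\in\Psi(\mathcal{E})'$ such that $$\varphi_1(a)=W'^*S\rho(a)W',\qquad \Phi_1(e)=W^*T^{\frac12}\Psi(e)S^{\frac12}W'$$ for all $a\in\mathcal{A}$ and $e\in\mathcal{E}$.
   Context: $\mathbb{M}_n(\mathcal{E})$ is a right Hilbert $\mathbb{M}_n(\mathcal{A})$-module with $(x_{ij})\cdot(a_{ij})=(\sum_k x_{ik}a_{kj})$ and $\langle (x_{ij}),(y_{ij})\rangle=(\sum_k\langle x_{ki},y_{kj}\rangle)$; $\Phi_n,\varphi_n$ are entrywise amplifications. For a completely positive map $\varphi:\mathcal{A}\to\mathcal{B}(H_1)$, a linear map $\Phi:\mathcal{E}\to\mathcal{B}(H_1,H_2)$ is a completely semi-$\varphi$-map if $\Phi_n(x)^*\Phi_n(x)\le\varphi_n(\langle x,x\rangle)$ for all $n\in\mathbb{N}$, $x\in\mathbb{M}_n(\mathcal{E})$. $\mathcal{CPE}(\mathcal{E},H_1,H_2)$ is the set of all pairs $(\varphi,\Phi)$ with $\varphi:\mathcal{A}\to\mathcal{B}(H_1)$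 completely positive and $\Phi:\mathcal{E}\to\mathcal{B}(H_1,H_2)$ a completely semi-$\varphi$-map. $\mathbb{K}_1(\mathcal{E})=\mathbb{K}(\mathcal{E})+\mathbb{C}I_{\mathcal{E}}$, where $\mathbb{K}(\mathcal{E})$ is the algebra of compact operators on $\mathcal{E}$; $\mathcal{L}_1(\mathcal{E})=\left\{\begin{bmatrix}u&x\\ y^*&a\end{bmatrix}: a\in\mathcal{A},\,u\in\mathbb{K}_1(\mathcal{E}),\,x,y\in\mathcal{E}\right\}$ is the unitized linking $C^*$-algebra; $S_{\mathcal{A}}(\mathcal{E})=\left\{\begin{bmatrix}\lambda I_{\mathcal{E}}&x\\ y^*&a\end{bmatrix}: a\in\mathcal{A},\,\lambda\in\mathbb{C},\,x,y\in\mathcal{E}\right\}$ is an operator subsystem of it. $\begin{bmatrix}id&\Phi\\ \Phi^*&\varphi\end{bmatrix}$ denotes the map $\begin{bmatrix}\lambda I_{\mathcal{E}}&x\\ y^*&a\end{bmatrix}\mapsto\begin{bmatrix}\lambda\, id_{H_2}&\Phi(x)\\ \Phi(y)^*&\varphi(a)\end{bmatrix}$ from $S_{\mathcal{A}}(\mathcal{E})$ to $\mathcal{B}(H_2\oplus H_1)$. For pairs in $\mathcal{CPE}(\mathcal{E},H_1,H_2)$, $(\varphi_1,\Phi_1)\ll(\varphi_2,\Phi_2)$ means $\begin{bmatrix}id&\Phi_1\\ \Phi_1^*&\varphi_1\end{bmatrix}\le_{cp}\begin{bmatrix}id&\Phi_2\\ \Phi_2^*&\varphi_2\end{bmatrix}$,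 where $\theta_1\le_{cp}\theta_2$ means that $\theta_2-\theta_1$ is completely positive (on $S_{\mathcal{A}}(\mathcal{E})$). A dilation pair for $(\varphi,\Phi)$ is a pair of triples $((\rho,K_1,V),(\Psi,K_2,W))$ consisting of Hilbert spaces $K_1,K_2$, a unital $*$-representation $\rho:\mathcal{A}\to\mathcal{B}(K_1)$, a $\rho$-map $\Psi:\mathcal{E}\to\mathcal{B}(K_1,K_2)$ (linear with $\Psi(x)^*\Psi(y)=\rho(\langle x,y\rangle)$ for all $x,y\in\mathcal{E}$), and bounded operators $V:H_1\to K_1$, $W:H_2\to K_2$ such that $\Phi(x)=W^*\Psi(x)V$ and $\varphi(a)=V^*\rho(a)V$ for all $a\in\mathcal{A}$, $x\in\mathcal{E}$. $\Psi$ is non-degenerate if the closed linear span of $\Psi(\mathcal{E})K_1$ is $K_2$. For operators $T\in\mathcal{B}(K_2)$, $S\in\mathcal{B}(K_1)$, $T\oplus S=\begin{bmatrix}T&0\\ 0&S\end{bmatrix}\in\mathcal{B}(K_2\oplus K_1)$. The commutant $\Psi(\mathcal{E})'$ is the set of all operators $P\oplus Q\in\mathcal{B}(K_2\oplus K_1)$ such that $P\Psi(x)=\Psi(x)Q$ and $Q\Psi(x)^*=\Psi(x)^*P$ for all $x\in\mathcal{E}$. $\mathcal{E}$ is full if the closed linear span of $\langle\mathcal{E},\mathcal{E}\rangle$ is $\mathcal{A}$. *)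

theory Defs
  imports "HOL-Analysis.Analysis" "HOL-Library.Function_Algebras"
begin

section \<open>Complex vector spaces and unital C*-algebras\<close>

class scaleC =
  fixes scaleC :: "complex \<Rightarrow> 'a \<Rightarrow> 'a"  (infixr \<open>*\<^sub>C\<close> 75)

class complex_vector = scaleC + ab_group_add +
  assumes scaleC_add_right: "c *\<^sub>C (x + y) = c *\<^sub>C x + c *\<^sub>C y"
    and scaleC_add_left: "(c + d) *\<^sub>C x = c *\<^sub>C x + d *\<^sub>C x"
    and scaleC_scaleC: "c *\<^sub>C d *\<^sub>C x = (c * d) *\<^sub>C x"
    and scaleC_one: "1 *\<^sub>C x = x"

lemma vector_space_scaleC: "vector_space (scaleC :: complex \<Rightarrow> 'a \<Rightarrow> 'a::complex_vector)"
  by unfold_locales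
    (simp_all add: scaleC_add_right scaleC_add_left scaleC_scaleC scaleC_one)

instantiation complex :: complex_vector
begin
definition scaleC_complex :: "complex \<Rightarrow> complex \<Rightarrow> complex"
  where "scaleC_complex c x = c * x"
instance
  by standard (simp_all add: scaleC_complex_def algebra_simps)
end

instantiation "fun" :: (type, complex_vector) complex_vector
begin
definition scaleC_fun :: "complex \<Rightarrow> ('a \<Rightarrow> 'b) \<Rightarrow> 'a \<Rightarrow> 'b"
  where "scaleC_fun c f = (\<lambda>x. c *\<^sub>C f x)"
instance
  by standard
    (simp_all add: scaleC_fun_def fun_eq_iff scaleC_add_right scaleC_add_left
      scaleC_scaleC scaleC_one)
end

instantiation prod :: (complex_vector, complex_vector) complex_vector
begin
definition scaleC_prod :: "complex \<Rightarrow> 'a \<times> 'b \<Rightarrow> 'a \<times> 'b"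
  where "scaleC_prod c p = (c *\<^sub>C fst p, c *\<^sub>C snd p)"
instance
  by standard
    (simp_all add: scaleC_prod_def prod_eq_iff scaleC_add_right scaleC_add_left
      scaleC_scaleC scaleC_one)
end

class complex_banach = complex_vector + banach +
  assumes scaleR_scaleC: "r *\<^sub>R x = complex_of_real r *\<^sub>C x"
    and norm_scaleC: "norm (c *\<^sub>C x) = cmod c * norm x"

class cstar_algebra_1 = complex_banach + real_normed_algebra_1 +
  fixes star :: "'a \<Rightarrow> 'a"
  assumes mult_scaleC_left: "(c *\<^sub>C a) * b = c *\<^sub>C (a * b)"
    and mult_scaleC_right: "a * (c *\<^sub>C b) = c *\<^sub>C (a * b)"
    and star_add: "star (a + b) = star a + star b"
    and star_scaleC: "star (c *\<^sub>C a) = cnj c *\<^sub>C star a"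
    and star_mult: "star (a * b) = star b * star a"
    and star_star: "star (star a) = a"
    and cstar_identity: "norm (star a * a) = (norm a)\<^sup>2"

text \<open>\<open>n \<times> n\<close> matrices over any type are functions \<^typ>\<open>nat \<Rightarrow> nat \<Rightarrow> 'b\<close>, of which only the
  entries with indices below \<open>n\<close> matter. Positive elements of a C*-algebra are those of the form
  \<open>b\<^sup>* b\<close>.\<close>

definition pos_mat :: "nat \<Rightarrow> (nat \<Rightarrow> nat \<Rightarrow> 'a::cstar_algebra_1) \<Rightarrow> bool" where
  "pos_mat n a \<longleftrightarrow> (\<exists>b. \<forall>i<n. \<forall>j<n. a i j = (\<Sum>k<n. star (b k i) * b k j))"


section \<open>Hilbert C*-modules and the unitized linking algebra\<close>

text \<open>The norm of the module type is required to be the one induced by the inner product, so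
  that completeness is part of the sort \<^class>\<open>complex_banach\<close>.\<close>

locale hilbert_module =
  fixes act :: "'e::complex_banach \<Rightarrow> 'a::cstar_algebra_1 \<Rightarrow> 'e"
    and ip :: "'e \<Rightarrow> 'e \<Rightarrow> 'a"
  assumes act_add_left: "act (x + y) a = act x a + act y a"
    and act_add_right: "act x (a + b) = act x a + act x b"
    and act_mult: "act x (a * b) = act (act x a) b"
    and act_one: "act x 1 = x"
    and act_scaleC_left: "act (c *\<^sub>C x) a = c *\<^sub>C act x a"
    and act_scaleC_right: "act x (c *\<^sub>C a) = c *\<^sub>C act x a"
    and ip_add_right: "ip x (y + z) = ip x y + ip x z"
    and ip_scaleC_right: "ip x (c *\<^sub>C y) = c *\<^sub>C ip x y"
    and ip_act_right: "ip x (act y a) = ip x y * a"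
    and star_ip: "star (ip x y) = ip y x"
    and ip_positive: "\<exists>b. ip x x = star b * b"
    and ip_definite: "ip x x = 0 \<Longrightarrow> x = 0"
    and norm_ip: "norm x = sqrt (norm (ip x x))"

definition full_module :: "('e \<Rightarrow> 'e \<Rightarrow> 'a::cstar_algebra_1) \<Rightarrow> bool" where
  "full_module ip \<longleftrightarrow> closure (module.span scaleC {ip x y | x y. True}) = UNIV"

definition rank_one ::
  "('e::complex_banach \<Rightarrow> 'a::cstar_algebra_1 \<Rightarrow> 'e) \<Rightarrow> ('e \<Rightarrow> 'e \<Rightarrow> 'a) \<Rightarrow> 'e \<Rightarrow> 'e \<Rightarrow> ('e \<Rightarrow>\<^sub>L 'e)"
  where "rank_one act ip x y = Blinfun (\<lambda>z. act x (ip y z))"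

text \<open>The real span suffices: \<open>c \<theta>\<^sub>x\<^sub>,\<^sub>y = \<theta>\<^sub>c\<^sub>x\<^sub>,\<^sub>y\<close>, so it is already the complex one.\<close>

definition compact_ops ::
  "('e::complex_banach \<Rightarrow> 'a::cstar_algebra_1 \<Rightarrow> 'e) \<Rightarrow> ('e \<Rightarrow> 'e \<Rightarrow> 'a) \<Rightarrow> ('e \<Rightarrow>\<^sub>L 'e) set"
  where "compact_ops act ip = closure (span {rank_one act ip x y | x y. True})"

definition scalar_op :: "complex \<Rightarrow> ('e::complex_banach \<Rightarrow>\<^sub>L 'e)" where
  "scalar_op c = Blinfun (\<lambda>z. c *\<^sub>C z)"

definition compact_ops1 ::
  "('e::complex_banach \<Rightarrow> 'a::cstar_algebra_1 \<Rightarrow> 'e) \<Rightarrow> ('e \<Rightarrow> 'e \<Rightarrow> 'a) \<Rightarrow> ('e \<Rightarrow>\<^sub>L 'e) set"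
  where "compact_ops1 act ip = {k + scalar_op c | k c. k \<in> compact_ops act ip}"

definition mod_adj ::
  "('e::complex_banach \<Rightarrow> 'e \<Rightarrow> 'a::cstar_algebra_1) \<Rightarrow> ('e \<Rightarrow>\<^sub>L 'e) \<Rightarrow> ('e \<Rightarrow>\<^sub>L 'e)" where
  "mod_adj ip u = (THE v. \<forall>x y. ip (blinfun_apply u x) y = ip x (blinfun_apply v y))"

text \<open>The quadruple \<open>(u, x, y, a)\<close> encodes the matrix with rows \<open>(u, x)\<close> and \<open>(y\<^sup>*, a)\<close>, where
  \<open>y\<^sup>*\<close> is the map \<open>z \<mapsto> \<langle>y, z\<rangle>\<close>. Addition is componentwise, but scalars act on the third component
  through their conjugates. In the product,
  \<open>x y'\<^sup>* = \<theta>\<^sub>x\<^sub>,\<^sub>y\<^sub>'\<close>, \<open>y\<^sup>* u' = (u'\<^sup>* y)\<^sup>*\<close> and \<open>a y'\<^sup>* = (y' a\<^sup>*)\<^sup>*\<close>.\<close>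

type_synonym ('e, 'a) linking = "('e \<Rightarrow>\<^sub>L 'e) \<times> 'e \<times> 'e \<times> 'a"

definition linking_algebra ::
  "('e::complex_banach \<Rightarrow> 'a::cstar_algebra_1 \<Rightarrow> 'e) \<Rightarrow> ('e \<Rightarrow> 'e \<Rightarrow> 'a) \<Rightarrow> ('e, 'a) linking set"
  where "linking_algebra act ip = {(u, x, y, a). u \<in> compact_ops1 act ip}"

fun linking_mult ::
  "('e::complex_banach \<Rightarrow> 'a::cstar_algebra_1 \<Rightarrow> 'e) \<Rightarrow> ('e \<Rightarrow> 'e \<Rightarrow> 'a) \<Rightarrow>
    ('e, 'a) linking \<Rightarrow> ('e, 'a) linking \<Rightarrow> ('e, 'a) linking" where
  "linking_mult act ip (u, x, y, a) (u', x', y', a') =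
    (u o\<^sub>L u' + rank_one act ip x y',
     blinfun_apply u x' + act x a',
     blinfun_apply (mod_adj ip u') y + act y' (star a),
     ip y x' + a * a')"

fun linking_star ::
  "('e::complex_banach \<Rightarrow> 'e \<Rightarrow> 'a::cstar_algebra_1) \<Rightarrow> ('e, 'a) linking \<Rightarrow> ('e, 'a) linking" where
  "linking_star ip (u, x, y, a) = (mod_adj ip u, y, x, star a)"

definition linking_pos_mat ::
  "('e::complex_banach \<Rightarrow> 'a::cstar_algebra_1 \<Rightarrow> 'e) \<Rightarrow> ('e \<Rightarrow> 'e \<Rightarrow> 'a) \<Rightarrow>
    nat \<Rightarrow> (nat \<Rightarrow> nat \<Rightarrow> ('e, 'a) linking) \<Rightarrow> bool" where
  "linking_pos_mat act ip n X \<longleftrightarrow>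
    (\<exists>Y. (\<forall>i<n. \<forall>j<n. Y i j \<in> linking_algebra act ip) \<and>
      (\<forall>i<n. \<forall>j<n. X i j = (\<Sum>k<n. linking_mult act ip (linking_star ip (Y k i)) (Y k j))))"

definition op_system :: "('e::complex_banach, 'a::cstar_algebra_1) linking set" where
  "op_system = {(scalar_op c, x, y, a) | c x y a. True}"


section \<open>Hilbert spaces and bounded operators\<close>

text \<open>HOL cannot quantify existentially over types, so a Hilbert space is a linear subspace of
  some complex vector space type together with an inner product on it, linear in the second
  argument.\<close>

record 'v hspace =
  hset :: "'v set"
  hip :: "'v \<Rightarrow> 'v \<Rightarrow> complex"

definition hnorm :: "'v hspace \<Rightarrow> 'v \<Rightarrow> real" where
  "hnorm H x = sqrt (Re (hip H x x))"

definition hilbert_space :: "'v::complex_vector hspace \<Rightarrow> bool" where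
  "hilbert_space H \<longleftrightarrow>
    module.subspace scaleC (hset H) \<and>
    (\<forall>x\<in>hset H. \<forall>y\<in>hset H. \<forall>z\<in>hset H. hip H x (y + z) = hip H x y + hip H x z) \<and>
    (\<forall>x\<in>hset H. \<forall>y\<in>hset H. \<forall>c. hip H x (c *\<^sub>C y) = c * hip H x y) \<and>
    (\<forall>x\<in>hset H. \<forall>y\<in>hset H. hip H y x = cnj (hip H x y)) \<and>
    (\<forall>x\<in>hset H. hip H x x \<in> \<real>\<^sub>\<ge>\<^sub>0 \<and> (hip H x x = 0 \<longrightarrow> x = 0)) \<and>
    (\<forall>X. (\<forall>n. X n \<in> hset H) \<and>
         (\<forall>e>0. \<exists>N. \<forall>m\<ge>N. \<forall>n\<ge>N. hnorm H (X m - X n) < e) \<longrightarrow>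
         (\<exists>x\<in>hset H. (\<lambda>n. hnorm H (X n - x)) \<longlonglongrightarrow> 0))"

definition hclosed_span :: "'v::complex_vector hspace \<Rightarrow> 'v set \<Rightarrow> 'v set" where
  "hclosed_span H M = {x \<in> hset H. \<forall>e>0. \<exists>y\<in>module.span scaleC M. hnorm H (x - y) < e}"

text \<open>Operators are set to \<open>0\<close> outside the carrier of their domain. Thus equality of operators is
  equality of functions, and composition, addition and scalar multiplication of operators are those
  of functions.\<close>

definition on_hset :: "'v hspace \<Rightarrow> ('v \<Rightarrow> 'w::zero) \<Rightarrow> 'v \<Rightarrow> 'w" where
  "on_hset H f = (\<lambda>x. if x \<in> hset H then f x else 0)"

definition bop :: "'v::complex_vector hspace \<Rightarrow> 'w::complex_vector hspace \<Rightarrow> ('v \<Rightarrow> 'w) set" where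
  "bop H K = {f.
    (\<forall>x. x \<notin> hset H \<longrightarrow> f x = 0) \<and>
    (\<forall>x\<in>hset H. f x \<in> hset K) \<and>
    (\<forall>x\<in>hset H. \<forall>y\<in>hset H. f (x + y) = f x + f y) \<and>
    (\<forall>x\<in>hset H. \<forall>c. f (c *\<^sub>C x) = c *\<^sub>C f x) \<and>
    (\<exists>B. \<forall>x\<in>hset H. hnorm K (f x) \<le> B * hnorm H x)}"

definition id_op :: "'v::zero hspace \<Rightarrow> 'v \<Rightarrow> 'v" where
  "id_op H = on_hset H (\<lambda>x. x)"

definition hadj :: "'v hspace \<Rightarrow> 'w hspace \<Rightarrow> ('v \<Rightarrow> 'w) \<Rightarrow> 'w \<Rightarrow> 'v::zero" where
  "hadj H K f = on_hset K (\<lambda>y. THE x. x \<in> hset H \<and> (\<forall>z\<in>hset H. hip H z x = hip K (f z) y))"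

definition positive_op :: "'v::complex_vector hspace \<Rightarrow> ('v \<Rightarrow> 'v) \<Rightarrow> bool" where
  "positive_op H f \<longleftrightarrow> f \<in> bop H H \<and> (\<forall>x\<in>hset H. hip H x (f x) \<in> \<real>\<^sub>\<ge>\<^sub>0)"

definition op_le :: "'v::complex_vector hspace \<Rightarrow> ('v \<Rightarrow> 'v) \<Rightarrow> ('v \<Rightarrow> 'v) \<Rightarrow> bool" where
  "op_le H f g \<longleftrightarrow> positive_op H (g - f)"

definition contraction_op :: "'v::complex_vector hspace \<Rightarrow> ('v \<Rightarrow> 'v) \<Rightarrow> bool" where
  "contraction_op H f \<longleftrightarrow> f \<in> bop H H \<and> (\<forall>x\<in>hset H. hnorm H (f x) \<le> hnorm H x)"

definition op_sqrt :: "'v::complex_vector hspace \<Rightarrow> ('v \<Rightarrow> 'v) \<Rightarrow> 'v \<Rightarrow> 'v" where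
  "op_sqrt H f = (THE g. positive_op H g \<and> g \<circ> g = f)"

definition hsum :: "'v hspace \<Rightarrow> 'w hspace \<Rightarrow> ('v \<times> 'w) hspace" where
  "hsum H K = \<lparr>hset = hset H \<times> hset K,
    hip = (\<lambda>p q. hip H (fst p) (fst q) + hip K (snd p) (snd q))\<rparr>"

definition block_op :: "'v hspace \<Rightarrow> 'w hspace \<Rightarrow>
    ('v \<Rightarrow> 'v::ab_group_add) \<Rightarrow> ('w \<Rightarrow> 'v) \<Rightarrow> ('v \<Rightarrow> 'w) \<Rightarrow> ('w \<Rightarrow> 'w::ab_group_add) \<Rightarrow>
    'v \<times> 'w \<Rightarrow> 'v \<times> 'w" where
  "block_op H K f11 f12 f21 f22 =
    on_hset (hsum H K) (\<lambda>(x, y). (f11 x + f12 y, f21 x + f22 y))"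

definition diag_op :: "'v hspace \<Rightarrow> 'w hspace \<Rightarrow>
    ('v \<Rightarrow> 'v::ab_group_add) \<Rightarrow> ('w \<Rightarrow> 'w::ab_group_add) \<Rightarrow> 'v \<times> 'w \<Rightarrow> 'v \<times> 'w" where
  "diag_op H K f g = block_op H K f 0 0 g"

text \<open>\<open>H\<^sup>n\<close>, and the operator \<open>H\<^sup>n \<rightarrow> K\<^sup>n\<close> given by a matrix of operators \<open>H \<rightarrow> K\<close>.\<close>

definition hpow :: "nat \<Rightarrow> 'v::zero hspace \<Rightarrow> (nat \<Rightarrow> 'v) hspace" where
  "hpow n H = \<lparr>hset = {h. (\<forall>i<n. h i \<in> hset H) \<and> (\<forall>i\<ge>n. h i = 0)},
    hip = (\<lambda>h k. \<Sum>i<n. hip H (h i) (k i))\<rparr>"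

definition mat_op ::
  "nat \<Rightarrow> 'v::zero hspace \<Rightarrow> (nat \<Rightarrow> nat \<Rightarrow> 'v \<Rightarrow> 'w::ab_group_add) \<Rightarrow> (nat \<Rightarrow> 'v) \<Rightarrow> nat \<Rightarrow> 'w" where
  "mat_op n H F = on_hset (hpow n H) (\<lambda>h i. if i < n then \<Sum>j<n. F i j (h j) else 0)"


section \<open>Completely positive maps and completely semi-\<open>\<phi>\<close>-maps\<close>

definition cp_map ::
  "'h1::complex_vector hspace \<Rightarrow> ('a::cstar_algebra_1 \<Rightarrow> 'h1 \<Rightarrow> 'h1) \<Rightarrow> bool" where
  "cp_map H1 \<phi> \<longleftrightarrow>
    range \<phi> \<subseteq> bop H1 H1 \<and>
    Vector_Spaces.linear scaleC scaleC \<phi> \<and>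
    (\<forall>n a. pos_mat n a \<longrightarrow> positive_op (hpow n H1) (mat_op n H1 (\<lambda>i j. \<phi> (a i j))))"

definition mod_mat_ip ::
  "('e \<Rightarrow> 'e \<Rightarrow> 'a::cstar_algebra_1) \<Rightarrow> nat \<Rightarrow> (nat \<Rightarrow> nat \<Rightarrow> 'e) \<Rightarrow> (nat \<Rightarrow> nat \<Rightarrow> 'e) \<Rightarrow>
    nat \<Rightarrow> nat \<Rightarrow> 'a" where
  "mod_mat_ip ip n x y = (\<lambda>i j. \<Sum>k<n. ip (x k i) (y k j))"

definition completely_semi_map ::
  "('e::complex_banach \<Rightarrow> 'e \<Rightarrow> 'a::cstar_algebra_1) \<Rightarrow>
    'h1::complex_vector hspace \<Rightarrow> 'h2::complex_vector hspace \<Rightarrow>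
    ('a \<Rightarrow> 'h1 \<Rightarrow> 'h1) \<Rightarrow> ('e \<Rightarrow> 'h1 \<Rightarrow> 'h2) \<Rightarrow> bool" where
  "completely_semi_map ip H1 H2 \<phi> \<Phi> \<longleftrightarrow>
    range \<Phi> \<subseteq> bop H1 H2 \<and>
    Vector_Spaces.linear scaleC scaleC \<Phi> \<and>
    (\<forall>n x. let \<Phi>x = mat_op n H1 (\<lambda>i j. \<Phi> (x i j)) in
      op_le (hpow n H1)
        (hadj (hpow n H1) (hpow n H2) \<Phi>x \<circ> \<Phi>x)
        (mat_op n H1 (\<lambda>i j. \<phi> (mod_mat_ip ip n x x i j))))"

definition CPE ::
  "('e::complex_banach \<Rightarrow> 'e \<Rightarrow> 'a::cstar_algebra_1) \<Rightarrow>
    'h1::complex_vector hspace \<Rightarrow> 'h2::complex_vector hspace \<Rightarrow>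
    (('a \<Rightarrow> 'h1 \<Rightarrow> 'h1) \<times> ('e \<Rightarrow> 'h1 \<Rightarrow> 'h2)) set" where
  "CPE ip H1 H2 = {(\<phi>, \<Phi>). cp_map H1 \<phi> \<and> completely_semi_map ip H1 H2 \<phi> \<Phi>}"

text \<open>The scalar \<open>c\<close> is determined by \<open>c I\<close> because a full module over a nonzero
  algebra is nonzero.\<close>

fun system_map ::
  "'h1::complex_vector hspace \<Rightarrow> 'h2::complex_vector hspace \<Rightarrow>
    ('a \<Rightarrow> 'h1 \<Rightarrow> 'h1) \<times> ('e \<Rightarrow> 'h1 \<Rightarrow> 'h2) \<Rightarrow>
    ('e::complex_banach, 'a::cstar_algebra_1) linking \<Rightarrow> 'h2 \<times> 'h1 \<Rightarrow> 'h2 \<times> 'h1" where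
  "system_map H1 H2 (\<phi>, \<Phi>) (u, x, y, a) =
    block_op H2 H1
      ((THE c. u = scalar_op c) *\<^sub>C id_op H2) (\<Phi> x)
      (hadj H1 H2 (\<Phi> y)) (\<phi> a)"

text \<open>Complete positivity of a linear map on the operator system, whose matrix cones are inherited
  from the linking algebra. Linearity is not part of the definition; it holds for
  the differences of \<^const>\<open>system_map\<close>s to which it is applied.\<close>

definition system_cp ::
  "('e::complex_banach \<Rightarrow> 'a::cstar_algebra_1 \<Rightarrow> 'e) \<Rightarrow> ('e \<Rightarrow> 'e \<Rightarrow> 'a) \<Rightarrow>
    'h::complex_vector hspace \<Rightarrow> (('e, 'a) linking \<Rightarrow> 'h \<Rightarrow> 'h) \<Rightarrow> bool" where
  "system_cp act ip H \<theta> \<longleftrightarrow>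
    (\<forall>n X. (\<forall>i<n. \<forall>j<n. X i j \<in> op_system) \<and> linking_pos_mat act ip n X \<longrightarrow>
      positive_op (hpow n H) (mat_op n H (\<lambda>i j. \<theta> (X i j))))"

definition dominated ::
  "('e::complex_banach \<Rightarrow> 'a::cstar_algebra_1 \<Rightarrow> 'e) \<Rightarrow> ('e \<Rightarrow> 'e \<Rightarrow> 'a) \<Rightarrow>
    'h1::complex_vector hspace \<Rightarrow> 'h2::complex_vector hspace \<Rightarrow>
    ('a \<Rightarrow> 'h1 \<Rightarrow> 'h1) \<times> ('e \<Rightarrow> 'h1 \<Rightarrow> 'h2) \<Rightarrow>
    ('a \<Rightarrow> 'h1 \<Rightarrow> 'h1) \<times> ('e \<Rightarrow> 'h1 \<Rightarrow> 'h2) \<Rightarrow> bool" where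
  "dominated act ip H1 H2 p q \<longleftrightarrow>
    system_cp act ip (hsum H2 H1) (\<lambda>X. system_map H1 H2 q X - system_map H1 H2 p X)"


section \<open>Dilation pairs and the commutant\<close>

definition unital_star_rep ::
  "'k::complex_vector hspace \<Rightarrow> ('a::cstar_algebra_1 \<Rightarrow> 'k \<Rightarrow> 'k) \<Rightarrow> bool" where
  "unital_star_rep K \<rho> \<longleftrightarrow>
    range \<rho> \<subseteq> bop K K \<and>
    Vector_Spaces.linear scaleC scaleC \<rho> \<and>
    (\<forall>a b. \<rho> (a * b) = \<rho> a \<circ> \<rho> b) \<and>
    (\<forall>a. \<rho> (star a) = hadj K K (\<rho> a)) \<and>
    \<rho> 1 = id_op K"

definition rep_map ::
  "('e::complex_banach \<Rightarrow> 'e \<Rightarrow> 'a::cstar_algebra_1) \<Rightarrow>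
    'k1::complex_vector hspace \<Rightarrow> 'k2::complex_vector hspace \<Rightarrow>
    ('a \<Rightarrow> 'k1 \<Rightarrow> 'k1) \<Rightarrow> ('e \<Rightarrow> 'k1 \<Rightarrow> 'k2) \<Rightarrow> bool" where
  "rep_map ip K1 K2 \<rho> \<Psi> \<longleftrightarrow>
    range \<Psi> \<subseteq> bop K1 K2 \<and>
    Vector_Spaces.linear scaleC scaleC \<Psi> \<and>
    (\<forall>x y. hadj K1 K2 (\<Psi> x) \<circ> \<Psi> y = \<rho> (ip x y))"

definition dilation_pair ::
  "('e::complex_banach \<Rightarrow> 'e \<Rightarrow> 'a::cstar_algebra_1) \<Rightarrow>
    'h1::complex_vector hspace \<Rightarrow> 'h2::complex_vector hspace \<Rightarrow>
    ('a \<Rightarrow> 'h1 \<Rightarrow> 'h1) \<times> ('e \<Rightarrow> 'h1 \<Rightarrow> 'h2) \<Rightarrow>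
    ('a \<Rightarrow> 'k1 \<Rightarrow> 'k1) \<times> 'k1::complex_vector hspace \<times> ('h1 \<Rightarrow> 'k1) \<Rightarrow>
    ('e \<Rightarrow> 'k1 \<Rightarrow> 'k2) \<times> 'k2::complex_vector hspace \<times> ('h2 \<Rightarrow> 'k2) \<Rightarrow> bool" where
  "dilation_pair ip H1 H2 = (\<lambda>(\<phi>, \<Phi>) (\<rho>, K1, V) (\<Psi>, K2, W).
    hilbert_space K1 \<and> hilbert_space K2 \<and>
    unital_star_rep K1 \<rho> \<and> rep_map ip K1 K2 \<rho> \<Psi> \<and>
    V \<in> bop H1 K1 \<and> W \<in> bop H2 K2 \<and>
    (\<forall>x. \<Phi> x = hadj H2 K2 W \<circ> \<Psi> x \<circ> V) \<and>
    (\<forall>a. \<phi> a = hadj H1 K1 V \<circ> \<rho> a \<circ> V))"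

definition nondegenerate ::
  "'k1::complex_vector hspace \<Rightarrow> 'k2::complex_vector hspace \<Rightarrow> ('e \<Rightarrow> 'k1 \<Rightarrow> 'k2) \<Rightarrow> bool" where
  "nondegenerate K1 K2 \<Psi> \<longleftrightarrow> hclosed_span K2 {\<Psi> x k | x k. k \<in> hset K1} = hset K2"

definition commutant ::
  "'k1::complex_vector hspace \<Rightarrow> 'k2::complex_vector hspace \<Rightarrow> ('e \<Rightarrow> 'k1 \<Rightarrow> 'k2) \<Rightarrow>
    ('k2 \<times> 'k1 \<Rightarrow> 'k2 \<times> 'k1) set" where
  "commutant K1 K2 \<Psi> = {diag_op K2 K1 P Q | P Q.
    P \<in> bop K2 K2 \<and> Q \<in> bop K1 K1 \<and>
    (\<forall>x. P \<circ> \<Psi> x = \<Psi> x \<circ> Q \<and> Q \<circ> hadj K1 K2 (\<Psi> x) = hadj K1 K2 (\<Psi> x) \<circ> P)}"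

text \<open>Carrier types of the two existentially quantified dilation spaces, chosen large enough: the
  minimal dilation spaces are spanned by vectors indexed by \<open>(a, h)\<close> and
  by \<open>(x, h)\<close>, respectively, and the additional index leaves room for countably many orthogonal
  copies.\<close>

type_synonym ('a, 'h1) dil_space1 = "nat \<times> 'a \<times> 'h1 \<Rightarrow> complex"
type_synonym ('e, 'h1) dil_space2 = "nat \<times> 'e \<times> 'h1 \<Rightarrow> complex"

end

theory Submission
  imports Defs
begin

text \<open>Testing domination on the positive matrices with rows \<open>(I, x)\<close> and \<open>(x\<^sup>*, \<langle>x, x\<rangle>)\<close> shows
  \<open>\<Phi>\<^sub>1 = \<Phi>\<^sub>2\<close>: the difference of the two maps has a vanishing first corner there, so its off-diagonal
  entries vanish as well. Call this map \<open>\<Phi>\<close>. On the lower corner the difference is positive, so both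
  \<open>\<phi>\<^sub>1\<close> and \<open>\<phi>\<^sub>2 - \<phi>\<^sub>1\<close> give positive definite kernels on \<open>A \<times> H\<^sub>1\<close> and on \<open>E \<times> H\<^sub>1\<close>.

  The minimal dilation of \<open>\<phi>\<^sub>2\<close> does not work in general (for scalars take \<open>\<phi>\<^sub>2 = 2 \<phi>\<^sub>1\<close> and \<open>\<Phi> \<noteq> 0\<close>).
  Instead, add the dilation spaces of \<open>\<phi>\<^sub>1\<close> and of \<open>\<phi>\<^sub>2 - \<phi>\<^sub>1\<close>, let \<open>P\<close> project onto the first summand, and
  let \<open>W\<close> take values in the first summand, which is possible because \<open>\<Phi>\<close> is a completely semi-\<open>\<phi>\<^sub>1\<close>-map.
  Then cut down to the subspaces generated by \<open>\<rho>(A) V H\<^sub>1\<close> and \<open>\<Psi>(E)\<^sup>* W H\<^sub>2\<close>. The compressions of \<open>P\<close>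
  solve the equations, and they are the only solution: on \<open>\<rho>(A) V H\<^sub>1\<close> the form of \<open>S\<close> is given by
  \<open>\<phi>\<^sub>1\<close>, and a Cauchy-Schwarz argument shows that \<open>S\<close> fixes \<open>\<Psi>(E)\<^sup>* W H\<^sub>2\<close> pointwise.\<close>

text \<open>In the scalar example the minimal dilation forces \<open>S\<close> to be half the
  identity, so \<open>T^(1/2) \<Psi> S^(1/2) = \<Psi> S\<close> would halve \<Phi>, although it must
  not change. So \<open>T\<close> has to fix what is seen through \<open>W\<close> while
  \<open>S\<close> scales what is seen through \<open>V\<close>; two summands reconcile these
  demands. On the whole sum the data do not control \<open>S\<close> away from the generated
  vectors, hence the cut. The generated subspace need not be invariant under \<open>P\<close>, hence
  compressions instead of restrictions; they still solve the equations because these only involve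
  pairings inside subspaces that reduce \<rho> and \<Psi>. Fullness is what turns commutation with
  inner products into commutation with all of \<open>\<rho>(A)\<close>.

  The carrier types of the dilation spaces are prescribed function types. The spaces are therefore
  reproducing kernel spaces on tagged indices, where completion takes place among functions and
  \<rho>, \<Psi>, \<open>P\<close> act by substitution in the index. Since \<open>op_sqrt\<close> is
  a definite description, positive contractions need both existence and uniqueness of positive
  roots; existence comes from the binomial series, summed in matrix coefficients.\<close>

interpretation cvec: vector_space "scaleC :: complex \<Rightarrow> 'a \<Rightarrow> 'a::complex_vector"
  by (rule vector_space_scaleC)

section \<open>Complex scalars and quadratic forms\<close>

lemma scaleC_zero_left [simp]: "0 *\<^sub>C (x::'a::complex_vector) = 0"
  and scaleC_zero_right [simp]: "c *\<^sub>C (0::'a::complex_vector) = 0"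
  and scaleC_one_left [simp]: "1 *\<^sub>C (x::'a::complex_vector) = x"
  and scaleC_minus1: "(- 1) *\<^sub>C (x::'a::complex_vector) = - x"
  by simp_all

lemma scaleC_fun_apply [simp]: "(c *\<^sub>C f) x = c *\<^sub>C f x"
  by (simp add: scaleC_fun_def)

lemma clinear_iff:
  "Vector_Spaces.linear scaleC scaleC (f :: 'a::complex_vector \<Rightarrow> 'b::complex_vector) \<longleftrightarrow>
    (\<forall>x y. f (x + y) = f x + f y) \<and> (\<forall>c x. f (c *\<^sub>C x) = c *\<^sub>C f x)"
  by (simp add: Vector_Spaces.linear_iff vector_space_scaleC)

text \<open>Discriminant argument with a complex parameter: \<open>t = - z / B\<close> minimises the
  form, and for \<open>B = 0\<close> the multiples \<open>- s * z\<close> would make it unbounded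
  below unless \<open>z = 0\<close>. All Cauchy-Schwarz inequalities below, for vectors, positive
  operators and kernels, are instances.\<close>

lemma quadratic_form_bound:
  fixes A B :: real and z :: complex
  assumes form: "\<And>t. A + 2 * Re (cnj t * z) + (cmod t)\<^sup>2 * B \<ge> 0" and B: "B \<ge> 0"
  shows "(cmod z)\<^sup>2 \<le> A * B"
proof (cases "B = 0")
  case True
  have *: "A \<ge> 2 * s * (cmod z)\<^sup>2" for s :: real
  proof -
    have "Re (cnj (- of_real s * z) * z) = - (s * (cmod z)\<^sup>2)"
      unfolding cmod_power2 by (simp add: power2_eq_square algebra_simps)
    with form[of "- of_real s * z"] True show ?thesis
      by simp
  qed
  have "cmod z = 0"
  proof (rule ccontr)
    assume "cmod z \<noteq> 0"
    then have "2 * ((\<bar>A\<bar> + 1) / (cmod z)\<^sup>2) * (cmod z)\<^sup>2 = 2 * (\<bar>A\<bar> + 1)"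
      by simp
    with *[of "(\<bar>A\<bar> + 1) / (cmod z)\<^sup>2"] have "2 * (\<bar>A\<bar> + 1) \<le> A"
      by metis
    then show False
      using abs_ge_self[of A] abs_ge_zero[of A] by argo
  qed
  with True show ?thesis
    by simp
next
  case False
  with B have B': "B > 0"
    by simp
  define t where "t = - z / of_real B"
  have 1: "Re (cnj t * z) = - ((cmod z)\<^sup>2 / B)"
    unfolding cmod_power2 by (simp add: t_def power2_eq_square add_divide_distrib)
  have 2: "(cmod t)\<^sup>2 * B = (cmod z)\<^sup>2 / B"
    using B' by (simp add: t_def norm_divide power2_eq_square)
  have "A - (cmod z)\<^sup>2 / B \<ge> 0"
    using form[of t] unfolding 1 2 by simp
  with B' show ?thesis
    by (simp add: field_simps)
qed

section \<open>Hilbert spaces\<close>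

lemma hilbert_spaceD:
  assumes "hilbert_space H"
  shows "module.subspace scaleC (hset H)"
    and "\<forall>x\<in>hset H. \<forall>y\<in>hset H. \<forall>z\<in>hset H. hip H x (y + z) = hip H x y + hip H x z"
    and "\<forall>x\<in>hset H. \<forall>y\<in>hset H. \<forall>c. hip H x (c *\<^sub>C y) = c * hip H x y"
    and "\<forall>x\<in>hset H. \<forall>y\<in>hset H. hip H y x = cnj (hip H x y)"
    and "\<forall>x\<in>hset H. hip H x x \<in> \<real>\<^sub>\<ge>\<^sub>0 \<and> (hip H x x = 0 \<longrightarrow> x = 0)"
    and "\<forall>X. (\<forall>n. X n \<in> hset H) \<and>
         (\<forall>e>0. \<exists>N. \<forall>m\<ge>N. \<forall>n\<ge>N. hnorm H (X m - X n) < e) \<longrightarrow>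
         (\<exists>x\<in>hset H. (\<lambda>n. hnorm H (X n - x)) \<longlonglongrightarrow> 0)"
  using assms unfolding hilbert_space_def by - (elim conjE, assumption)+

lemmas hs_subspace = hilbert_spaceD(1)

lemma hs_zero [simp]: "hilbert_space H \<Longrightarrow> 0 \<in> hset H"
  and hs_add [simp]: "hilbert_space H \<Longrightarrow> x \<in> hset H \<Longrightarrow> y \<in> hset H \<Longrightarrow> x + y \<in> hset H"
  and hs_scale [simp]: "hilbert_space H \<Longrightarrow> x \<in> hset H \<Longrightarrow> c *\<^sub>C x \<in> hset H"
  and hs_diff [simp]: "hilbert_space H \<Longrightarrow> x \<in> hset H \<Longrightarrow> y \<in> hset H \<Longrightarrow> x - y \<in> hset H"
  and hs_neg [simp]: "hilbert_space H \<Longrightarrow> x \<in> hset H \<Longrightarrow> - x \<in> hset H"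
  by (auto dest!: hs_subspace intro: cvec.subspace_0 cvec.subspace_add cvec.subspace_scale
      cvec.subspace_diff cvec.subspace_neg)

lemma hs_sum: "hilbert_space H \<Longrightarrow> (\<And>i. i \<in> I \<Longrightarrow> f i \<in> hset H) \<Longrightarrow> sum f I \<in> hset H"
  by (auto dest!: hs_subspace intro: cvec.subspace_sum)

lemma hip_add_right [simp]: "hilbert_space H \<Longrightarrow> x \<in> hset H \<Longrightarrow> y \<in> hset H \<Longrightarrow> z \<in> hset H \<Longrightarrow>
    hip H x (y + z) = hip H x y + hip H x z"
  and hip_scale_right [simp]: "hilbert_space H \<Longrightarrow> x \<in> hset H \<Longrightarrow> y \<in> hset H \<Longrightarrow>
    hip H x (c *\<^sub>C y) = c * hip H x y"
  and hip_cnj: "hilbert_space H \<Longrightarrow> x \<in> hset H \<Longrightarrow> y \<in> hset H \<Longrightarrow> hip H y x = cnj (hip H x y)"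
  by (rule hilbert_spaceD(2-4)[rule_format]; assumption)+

lemma hip_add_left [simp]: "hilbert_space H \<Longrightarrow> x \<in> hset H \<Longrightarrow> y \<in> hset H \<Longrightarrow> z \<in> hset H \<Longrightarrow>
    hip H (y + z) x = hip H y x + hip H z x"
  using hip_add_right[of H x y z] hip_cnj[of H x "y + z"] hip_cnj[of H x y] hip_cnj[of H x z] by simp

lemma hip_scale_left [simp]: "hilbert_space H \<Longrightarrow> x \<in> hset H \<Longrightarrow> y \<in> hset H \<Longrightarrow>
    hip H (c *\<^sub>C y) x = cnj c * hip H y x"
  using hip_scale_right[of H x y c] hip_cnj[of H x "c *\<^sub>C y"] hip_cnj[of H x y] by simp

lemma hip_neg_right [simp]: "hilbert_space H \<Longrightarrow> x \<in> hset H \<Longrightarrow> y \<in> hset H \<Longrightarrow>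
    hip H x (- y) = - hip H x y"
  using hip_scale_right[of H x y "- 1"] by (simp add: scaleC_minus1)

lemma hip_neg_left [simp]: "hilbert_space H \<Longrightarrow> x \<in> hset H \<Longrightarrow> y \<in> hset H \<Longrightarrow>
    hip H (- y) x = - hip H y x"
  using hip_scale_left[of H x y "- 1"] by (simp add: scaleC_minus1)

lemma hip_diff_right [simp]: "hilbert_space H \<Longrightarrow> x \<in> hset H \<Longrightarrow> y \<in> hset H \<Longrightarrow> z \<in> hset H \<Longrightarrow>
    hip H x (y - z) = hip H x y - hip H x z"
  using hip_add_right[of H x y "- z"] by simp

lemma hip_diff_left [simp]: "hilbert_space H \<Longrightarrow> x \<in> hset H \<Longrightarrow> y \<in> hset H \<Longrightarrow> z \<in> hset H \<Longrightarrow>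
    hip H (y - z) x = hip H y x - hip H z x"
  using hip_add_left[of H x y "- z"] by simp

lemma hip_zero_right [simp]: "hilbert_space H \<Longrightarrow> x \<in> hset H \<Longrightarrow> hip H x 0 = 0"
  using hip_scale_right[of H x x 0] by simp

lemma hip_zero_left [simp]: "hilbert_space H \<Longrightarrow> x \<in> hset H \<Longrightarrow> hip H 0 x = 0"
  using hip_scale_left[of H x x 0] by simp

lemma hip_sum_right: "hilbert_space H \<Longrightarrow> x \<in> hset H \<Longrightarrow> (\<And>i. i \<in> I \<Longrightarrow> f i \<in> hset H) \<Longrightarrow>
    hip H x (sum f I) = (\<Sum>i\<in>I. hip H x (f i))"
  by (induction I rule: infinite_finite_induct) (simp_all add: hs_sum)

lemma hip_sum_left: "hilbert_space H \<Longrightarrow> x \<in> hset H \<Longrightarrow> (\<And>i. i \<in> I \<Longrightarrow> f i \<in> hset H) \<Longrightarrow>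
    hip H (sum f I) x = (\<Sum>i\<in>I. hip H (f i) x)"
  by (induction I rule: infinite_finite_induct) (simp_all add: hs_sum)

lemma hip_self_nonneg: "hilbert_space H \<Longrightarrow> x \<in> hset H \<Longrightarrow> hip H x x \<in> \<real>\<^sub>\<ge>\<^sub>0"
  and hip_self_zero: "hilbert_space H \<Longrightarrow> x \<in> hset H \<Longrightarrow> hip H x x = 0 \<Longrightarrow> x = 0"
  using hilbert_spaceD(5)[of H] by auto

lemma hnorm_nonneg [simp]: "hilbert_space H \<Longrightarrow> x \<in> hset H \<Longrightarrow> hnorm H x \<ge> 0"
  using hip_self_nonneg[of H x] by (simp add: hnorm_def complex_nonneg_Reals_iff)

lemma hip_self: "hilbert_space H \<Longrightarrow> x \<in> hset H \<Longrightarrow> hip H x x = of_real ((hnorm H x)\<^sup>2)"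
  using hip_self_nonneg[of H x] by (simp add: hnorm_def complex_nonneg_Reals_iff complex_eq_iff)

lemma hnorm_power2: "hilbert_space H \<Longrightarrow> x \<in> hset H \<Longrightarrow> (hnorm H x)\<^sup>2 = Re (hip H x x)"
  by (simp add: hip_self)

lemma hnorm_eq_0 [simp]: "hilbert_space H \<Longrightarrow> x \<in> hset H \<Longrightarrow> hnorm H x = 0 \<longleftrightarrow> x = 0"
  using hip_self[of H x] hip_self_zero[of H x] by auto

lemma hnorm_zero [simp]: "hilbert_space H \<Longrightarrow> hnorm H 0 = 0"
  by simp

lemma hip_cauchy_schwarz:
  assumes H: "hilbert_space H" and x: "x \<in> hset H" and y: "y \<in> hset H"
  shows "cmod (hip H x y) \<le> hnorm H x * hnorm H y"
proof -
  have "(cmod (hip H y x))\<^sup>2 \<le> (hnorm H x)\<^sup>2 * (hnorm H y)\<^sup>2"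
  proof (rule quadratic_form_bound)
    fix t
    have "0 \<le> Re (hip H (x + t *\<^sub>C y) (x + t *\<^sub>C y))"
      using assms by (simp add: hip_self del: hip_add_right hip_add_left)
    also have "hip H (x + t *\<^sub>C y) (x + t *\<^sub>C y) =
        hip H x x + (t * hip H x y + cnj t * hip H y x) + (cnj t * t) * hip H y y"
      using assms by (simp add: algebra_simps)
    also have "hip H x y = cnj (hip H y x)"
      using assms by (simp add: hip_cnj[of H y x])
    finally show "0 \<le> (hnorm H x)\<^sup>2 + 2 * Re (cnj t * hip H y x) + (cmod t)\<^sup>2 * (hnorm H y)\<^sup>2"
      using H x y by (simp add: hip_self complex_norm_square[symmetric] mult.commute[of "cnj t" t])
  qed simp
  then have "(cmod (hip H x y))\<^sup>2 \<le> (hnorm H x * hnorm H y)\<^sup>2"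
    using assms by (simp add: hip_cnj[of H y x] power_mult_distrib)
  then show ?thesis
    by (rule power2_le_imp_le) (use assms in simp)
qed

lemma hnorm_triangle: "hilbert_space H \<Longrightarrow> x \<in> hset H \<Longrightarrow> y \<in> hset H \<Longrightarrow>
    hnorm H (x + y) \<le> hnorm H x + hnorm H y"
proof (rule power2_le_imp_le)
  assume *: "hilbert_space H" "x \<in> hset H" "y \<in> hset H"
  have "Re (hip H x y) \<le> hnorm H x * hnorm H y" "Re (hip H y x) \<le> hnorm H x * hnorm H y"
    using hip_cauchy_schwarz[of H x y] hip_cauchy_schwarz[of H y x] * complex_Re_le_cmod
    by (metis order_trans mult.commute)+
  with * show "(hnorm H (x + y))\<^sup>2 \<le> (hnorm H x + hnorm H y)\<^sup>2"
    by (simp add: hnorm_power2 power2_sum)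
qed simp

lemma hnorm_scale [simp]: "hilbert_space H \<Longrightarrow> x \<in> hset H \<Longrightarrow> hnorm H (c *\<^sub>C x) = cmod c * hnorm H x"
proof -
  assume *: "hilbert_space H" "x \<in> hset H"
  then have "hip H (c *\<^sub>C x) (c *\<^sub>C x) = (c * cnj c) * hip H x x"
    by simp
  also have "\<dots> = of_real ((cmod c * hnorm H x)\<^sup>2)"
    using * by (simp only: hip_self complex_norm_square[symmetric] power_mult_distrib of_real_mult)
  finally show ?thesis
    using * by (simp only: hnorm_def[of H "c *\<^sub>C x"]) simp
qed

lemma hnorm_neg [simp]: "hilbert_space H \<Longrightarrow> x \<in> hset H \<Longrightarrow> hnorm H (- x) = hnorm H x"
  using hnorm_scale[of H x "- 1"] by (simp add: scaleC_minus1 del: hnorm_scale)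

lemma hnorm_minus_commute: "hilbert_space H \<Longrightarrow> x \<in> hset H \<Longrightarrow> y \<in> hset H \<Longrightarrow>
    hnorm H (x - y) = hnorm H (y - x)"
  using hnorm_neg[of H "x - y"] by simp

lemma hip_eqI:
  assumes "hilbert_space H" "x \<in> hset H" "y \<in> hset H" "\<And>z. z \<in> hset H \<Longrightarrow> hip H z x = hip H z y"
  shows "x = y"
proof -
  have "hip H (x - y) (x - y) = 0"
    using assms by simp
  then show ?thesis
    using hip_self_zero[of H "x - y"] assms(1-3) by simp
qed

lemma hs_complete:
  assumes "hilbert_space H" "\<And>n. X n \<in> hset H"
    "\<And>e. e > 0 \<Longrightarrow> \<exists>N. \<forall>m\<ge>N. \<forall>n\<ge>N. hnorm H (X m - X n) < e"
  obtains x where "x \<in> hset H" "(\<lambda>n. hnorm H (X n - x)) \<longlonglongrightarrow> 0"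
  using hilbert_spaceD(6)[OF assms(1)] assms(2,3) by blast

lemma hs_complete_inverse:
  assumes H: "hilbert_space H" and X: "\<And>n. X n \<in> hset H"
    and *: "\<And>m n. hnorm H (X m - X n) \<le> inverse (real (Suc m)) + inverse (real (Suc n))"
  obtains x where "x \<in> hset H" "(\<lambda>n. hnorm H (X n - x)) \<longlonglongrightarrow> 0"
proof (rule hs_complete[OF H X])
  fix e :: real
  assume "e > 0"
  then obtain N where N: "inverse (real (Suc N)) < e / 2"
    using reals_Archimedean[of "e / 2"] by auto
  have "inverse (real (Suc n)) < e / 2" if "n \<ge> N" for n
    using N that by (smt (verit) inverse_le_iff_le of_nat_0_less_iff of_nat_le_iff Suc_le_mono zero_less_Suc)
  then show "\<exists>N. \<forall>m\<ge>N. \<forall>n\<ge>N. hnorm H (X m - X n) < e"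
    using * by (intro exI[of _ N]) (smt (verit) field_sum_of_halves)
qed (use that in blast)

lemma hip_tendsto_right:
  assumes H: "hilbert_space H" and X: "\<And>n. X n \<in> hset H" and x: "x \<in> hset H" and y: "y \<in> hset H"
    and lim: "(\<lambda>n. hnorm H (X n - x)) \<longlonglongrightarrow> 0"
  shows "(\<lambda>n. hip H y (X n)) \<longlonglongrightarrow> hip H y x"
proof (rule Lim_transform2[OF tendsto_const])
  show "(\<lambda>n. hip H y x - hip H y (X n)) \<longlonglongrightarrow> 0"
  proof (rule Lim_null_comparison)
    have "cmod (hip H y x - hip H y (X n)) \<le> hnorm H y * hnorm H (X n - x)" for n
      using hip_cauchy_schwarz[of H y "x - X n"] assms by (simp add: hnorm_minus_commute[of H _ x])
    then show "\<forall>\<^sub>F n in sequentially. norm (hip H y x - hip H y (X n)) \<le> hnorm H y * hnorm H (X n - x)"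
      by simp
    show "(\<lambda>n. hnorm H y * hnorm H (X n - x)) \<longlonglongrightarrow> 0"
      using tendsto_mult_left[OF lim, of "hnorm H y"] by simp
  qed
qed

text \<open>Almost maximal points of the bounded functional \<open>J\<close> are almost critical. With
  \<open>J c = 2 Re F(c) - \<parallel>c\<parallel>\<^sup>2\<close> this yields approximate Riesz vectors without completeness.\<close>

lemma approx_critical_point:
  fixes J q :: "'d \<Rightarrow> real" and R :: "'d \<Rightarrow> 'd \<Rightarrow> complex"
  assumes ne: "start \<in> D" and bd: "\<And>c. c \<in> D \<Longrightarrow> J c \<le> B" and q: "\<And>d. d \<in> D \<Longrightarrow> q d \<ge> 0"
    and step: "\<And>c d t. c \<in> D \<Longrightarrow> d \<in> D \<Longrightarrow>
      \<exists>c'\<in>D. J c' = J c + 2 * Re (cnj t * R c d) - (cmod t)\<^sup>2 * q d"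
    and e: "e > 0"
  obtains c where "c \<in> D" "\<And>d. d \<in> D \<Longrightarrow> cmod (R c d) \<le> e * sqrt (q d)"
proof -
  have bdd: "bdd_above (J ` D)"
    using bd by (rule bdd_aboveI2)
  have "Sup (J ` D) - e\<^sup>2 < Sup (J ` D)"
    using e by simp
  then obtain c where c: "c \<in> D" "Sup (J ` D) - e\<^sup>2 < J c"
    using ne by (subst (asm) less_cSup_iff) (use bdd in auto)
  show thesis
  proof (rule that[OF c(1)])
    fix d
    assume d: "d \<in> D"
    \<comment> \<open>No move away from \<open>c\<close> gains more than \<open>e\<^sup>2\<close>,
      so \<open>e\<^sup>2\<close> minus the gain is a nonnegative quadratic form in the parameter;
      inserting \<open>- t\<close> brings it into the shape of the discriminant bound.\<close>
    have "(cmod (R c d))\<^sup>2 \<le> e\<^sup>2 * q d"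
    proof (rule quadratic_form_bound)
      fix t
      obtain c' where "c' \<in> D" "J c' = J c + 2 * Re (cnj (- t) * R c d) - (cmod (- t))\<^sup>2 * q d"
        using step[OF c(1) d] by blast
      moreover from this(1) have "J c' \<le> Sup (J ` D)"
        using bdd by (intro cSup_upper imageI)
      ultimately show "0 \<le> e\<^sup>2 + 2 * Re (cnj t * R c d) + (cmod t)\<^sup>2 * q d"
        using c(2) by simp
    qed (use q d in blast)
    then have "(cmod (R c d))\<^sup>2 \<le> (e * sqrt (q d))\<^sup>2"
      using q[OF d] by (simp add: power_mult_distrib)
    then show "cmod (R c d) \<le> e * sqrt (q d)"
      by (rule power2_le_imp_le) (use e q[OF d] in simp)
  qed
qed

text \<open>\<open>D\<close> need not be closed, and the representing vector is shown to be a limit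
  of points of \<open>D\<close>. If \<open>F\<close> is the pairing with a given vector, then
  \<open>v\<close> is its projection onto the closure of \<open>D\<close>, so this serves both as
  representation theorem and as projection theorem.\<close>

lemma riesz_subspace:
  assumes H: "hilbert_space H" and D: "module.subspace scaleC D" "D \<subseteq> hset H"
    and F_add: "\<And>u v. u \<in> D \<Longrightarrow> v \<in> D \<Longrightarrow> F (u + v) = F u + F v"
    and F_scale: "\<And>c u. u \<in> D \<Longrightarrow> F (c *\<^sub>C u) = cnj c * F u"
    and F_bd: "\<And>u. u \<in> D \<Longrightarrow> cmod (F u) \<le> B * hnorm H u"
  shows "\<exists>v\<in>hset H. (\<forall>u\<in>D. F u = hip H u v) \<and> (\<forall>e>0. \<exists>d\<in>D. hnorm H (v - d) < e)"
proof -
  have DH [simp]: "u \<in> hset H" if "u \<in> D" for u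
    using D(2) that by blast
  define J where "J c = 2 * Re (F c) - (hnorm H c)\<^sup>2" for c
  have "\<exists>c\<in>D. \<forall>d\<in>D. cmod (F d - hip H d c) \<le> e * sqrt ((hnorm H d)\<^sup>2)" if e: "e > 0" for e
  proof (rule approx_critical_point[where J = J and q = "\<lambda>d. (hnorm H d)\<^sup>2"
        and R = "\<lambda>c d. F d - hip H d c" and e = e and D = D and B = "B\<^sup>2"])
    show "0 \<in> D"
      using D(1) by (rule cvec.subspace_0)
    show "J c \<le> B\<^sup>2" if "c \<in> D" for c
    proof -
      have "Re (F c) \<le> B * hnorm H c"
        using F_bd[OF that] complex_Re_le_cmod order_trans by blast
      moreover have "2 * (B * hnorm H c) \<le> B\<^sup>2 + (hnorm H c)\<^sup>2"
        using sum_squares_bound[of B "hnorm H c"] by (simp add: power2_eq_square)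
      ultimately show ?thesis
        unfolding J_def by linarith
    qed
    show "\<exists>c'\<in>D. J c' = J c + 2 * Re (cnj t * (F d - hip H d c)) - (cmod t)\<^sup>2 * (hnorm H d)\<^sup>2"
      if "c \<in> D" "d \<in> D" for c d t
    proof
      show *: "c + t *\<^sub>C d \<in> D"
        using that D(1) by (intro cvec.subspace_add cvec.subspace_scale)
      have F: "F (c + t *\<^sub>C d) = F c + cnj t * F d"
        using that D(1) by (simp add: F_add F_scale cvec.subspace_scale)
      have "hip H (c + t *\<^sub>C d) (c + t *\<^sub>C d) =
          hip H c c + (t * hip H c d + cnj t * hip H d c) + (cnj t * t) * hip H d d"
        using that H by (simp add: algebra_simps)
      also have "hip H c d = cnj (hip H d c)"
        using that H by (simp add: hip_cnj[of H d c])
      finally have "(hnorm H (c + t *\<^sub>C d))\<^sup>2 =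
          (hnorm H c)\<^sup>2 + 2 * Re (cnj t * hip H d c) + (cmod t)\<^sup>2 * (hnorm H d)\<^sup>2"
        using H that by (subst hnorm_power2)
          (simp_all add: hip_self complex_norm_square[symmetric] mult.commute[of "cnj t" t])
      then show "J (c + t *\<^sub>C d) =
          J c + 2 * Re (cnj t * (F d - hip H d c)) - (cmod t)\<^sup>2 * (hnorm H d)\<^sup>2"
        unfolding J_def F by (simp add: algebra_simps)
    qed
  qed (use e in auto)
  then have "\<forall>n. \<exists>c\<in>D. \<forall>d\<in>D. cmod (F d - hip H d c) \<le> inverse (real (Suc n)) * hnorm H d"
    using H by simp
  then obtain X where X: "\<And>n. X n \<in> D"
    "\<And>n d. d \<in> D \<Longrightarrow> cmod (F d - hip H d (X n)) \<le> inverse (real (Suc n)) * hnorm H d"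
    by metis
  \<comment> \<open>Two almost representing vectors of the same functional are compared by testing
    it on their difference \<open>d\<close>: the squared norm of \<open>d\<close> is at most the sum
    of the residuals times the norm of \<open>d\<close>.\<close>
  have "hnorm H (X m - X n) \<le> inverse (real (Suc m)) + inverse (real (Suc n))" for m n
  proof -
    define d where "d = X m - X n"
    have d: "d \<in> D"
      unfolding d_def using X(1) D(1) by (intro cvec.subspace_diff)
    have "(hnorm H d)\<^sup>2 = cmod (hip H d d)"
      using H d by (simp add: hip_self norm_power)
    also have "hip H d d = hip H d (X m - X n)"
      by (simp only: d_def)
    also have "\<dots> = (F d - hip H d (X n)) - (F d - hip H d (X m))"
      using H d X(1) by simp
    also have "cmod \<dots> \<le> cmod (F d - hip H d (X n)) + cmod (F d - hip H d (X m))"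
      by (rule norm_triangle_ineq4)
    also have "\<dots> \<le> inverse (real (Suc n)) * hnorm H d + inverse (real (Suc m)) * hnorm H d"
      using d by (intro add_mono X(2))
    finally have "hnorm H d * hnorm H d \<le> (inverse (real (Suc m)) + inverse (real (Suc n))) * hnorm H d"
      by (simp add: algebra_simps power2_eq_square)
    then show ?thesis
      using hnorm_nonneg[OF H DH[OF d]] unfolding d_def[symmetric]
      by (cases "hnorm H d = 0") (simp_all add: mult_le_cancel_right)
  qed
  then obtain v where v: "v \<in> hset H" "(\<lambda>n. hnorm H (X n - v)) \<longlonglongrightarrow> 0"
    using hs_complete_inverse[OF H, of X] X(1) by auto
  show ?thesis
  proof (rule bexI[of _ v], intro conjI ballI allI impI)
    fix u
    assume u: "u \<in> D"
    have "(\<lambda>n. F u - hip H u (X n)) \<longlonglongrightarrow> 0"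
    proof (rule Lim_null_comparison)
      show "\<forall>\<^sub>F n in sequentially. norm (F u - hip H u (X n)) \<le> inverse (real (Suc n)) * hnorm H u"
        using X(2)[OF u] by simp
      show "(\<lambda>n. inverse (real (Suc n)) * hnorm H u) \<longlonglongrightarrow> 0"
        using tendsto_mult_right[OF LIMSEQ_inverse_real_of_nat, of "hnorm H u"] by simp
    qed
    moreover have "(\<lambda>n. F u - hip H u (X n)) \<longlonglongrightarrow> F u - hip H u v"
      using H X(1) v u by (intro tendsto_diff tendsto_const hip_tendsto_right) auto
    ultimately show "F u = hip H u v"
      using LIMSEQ_unique by fastforce
  next
    fix e :: real
    assume "e > 0"
    with v(2) have "\<forall>\<^sub>F n in sequentially. hnorm H (X n - v) < e"
      by (rule order_tendstoD(2))
    then obtain n where "hnorm H (X n - v) < e"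
      using eventually_happens'[OF sequentially_bot] by blast
    then show "\<exists>d\<in>D. hnorm H (v - d) < e"
      using X(1) v H hnorm_minus_commute[of H "X n" v] by auto
  qed fact
qed

lemma riesz:
  assumes H: "hilbert_space H"
    and "\<And>u v. u \<in> hset H \<Longrightarrow> v \<in> hset H \<Longrightarrow> F (u + v) = F u + F v"
    and "\<And>c u. u \<in> hset H \<Longrightarrow> F (c *\<^sub>C u) = cnj c * F u"
    and "\<And>u. u \<in> hset H \<Longrightarrow> cmod (F u) \<le> B * hnorm H u"
  shows "\<exists>v\<in>hset H. \<forall>u\<in>hset H. F u = hip H u v"
proof -
  have "\<exists>v\<in>hset H. (\<forall>u\<in>hset H. F u = hip H u v) \<and> (\<forall>e>0. \<exists>d\<in>hset H. hnorm H (v - d) < e)"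
    using assms(2-4) by (rule riesz_subspace[OF H hs_subspace[OF H] order_refl])
  then show ?thesis
    by blast
qed

lemma span_subset_hset: "hilbert_space H \<Longrightarrow> M \<subseteq> hset H \<Longrightarrow> module.span scaleC M \<subseteq> hset H"
  by (simp add: cvec.span_minimal hs_subspace)

text \<open>Density from a trivial orthogonal complement: \<open>v\<close> is the projection of
  \<open>f\<close> onto the closed span, and \<open>f - v\<close> is orthogonal to
  \<open>M\<close>.\<close>

lemma hclosed_span_total:
  assumes H: "hilbert_space H" and M: "M \<subseteq> hset H"
    and total: "\<And>f. f \<in> hset H \<Longrightarrow> (\<And>m. m \<in> M \<Longrightarrow> hip H m f = 0) \<Longrightarrow> f = 0"
  shows "hclosed_span H M = hset H"
proof
  show "hset H \<subseteq> hclosed_span H M"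
  proof
    fix f
    assume f: "f \<in> hset H"
    note D = span_subset_hset[OF H M]
    have DH: "u \<in> hset H" if "u \<in> module.span scaleC M" for u
      using D that by (rule subsetD)
    have "\<exists>v\<in>hset H. (\<forall>u\<in>module.span scaleC M. hip H u f = hip H u v) \<and>
        (\<forall>e>0. \<exists>d\<in>module.span scaleC M. hnorm H (v - d) < e)"
    proof (rule riesz_subspace[OF H cvec.subspace_span D])
      show "hip H (u + v) f = hip H u f + hip H v f"
        if "u \<in> module.span scaleC M" "v \<in> module.span scaleC M" for u v
        using DH that f H by simp
      show "hip H (c *\<^sub>C u) f = cnj c * hip H u f" if "u \<in> module.span scaleC M" for c u
        using DH that f H by simp
      show "cmod (hip H u f) \<le> hnorm H f * hnorm H u" if "u \<in> module.span scaleC M" for u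
        using hip_cauchy_schwarz[OF H DH[OF that] f] by (simp add: mult.commute)
    qed
    then obtain v where v: "v \<in> hset H" "\<forall>u\<in>module.span scaleC M. hip H u f = hip H u v"
      "\<forall>e>0. \<exists>d\<in>module.span scaleC M. hnorm H (v - d) < e"
      by blast
    have "f - v = 0"
    proof (rule total)
      show "hip H m (f - v) = 0" if "m \<in> M" for m
        using v(2)[rule_format, OF cvec.span_base[OF that]] H M f v(1) that by auto
    qed (use H f v(1) in simp)
    with f v(3) show "f \<in> hclosed_span H M"
      by (auto simp: hclosed_span_def)
  qed
qed (auto simp: hclosed_span_def)

section \<open>The binomial series of the square root\<close>

text \<open>The Taylor coefficients of \<open>sqrt (1 - x)\<close> at 0.\<close>

definition sqrt_coeff :: "nat \<Rightarrow> real" where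
  "sqrt_coeff n = (1 / 2 gchoose n) * (- 1) ^ n"

text \<open>An alternating sum of generalized binomial coefficients collapses to a single one, and
  here all its factors \<open>m - 1/2 - i\<close> with \<open>i < m\<close> are positive. Absolute
  summability and the positivity of operator roots both rest on this sign.\<close>

lemma sqrt_coeff_partial_sum: "(\<Sum>k\<le>m. sqrt_coeff k) \<ge> 0"
  and sqrt_coeff_partial_sum_eq: "(\<Sum>k\<le>m. sqrt_coeff k) = (real m - 1 / 2 gchoose m)"
proof -
  show *: "(\<Sum>k\<le>m. sqrt_coeff k) = (real m - 1 / 2 gchoose m)" for m
  proof -
    have "(\<Sum>k\<le>m. sqrt_coeff k) = (- 1) ^ m * (- (1 / 2) gchoose m)"
      unfolding sqrt_coeff_def gbinomial_sum_lower_neg by simp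
    also have "\<dots> = (real m - 1 / 2 gchoose m)"
      by (subst gbinomial_minus) (simp add: algebra_simps flip: power_mult_distrib)
    finally show ?thesis .
  qed
  have "(real m - 1 / 2 gchoose m) \<ge> 0"
    unfolding gbinomial_prod_rev by (intro divide_nonneg_nonneg prod_nonneg) auto
  then show "(\<Sum>k\<le>m. sqrt_coeff k) \<ge> 0"
    unfolding * .
qed

lemma sqrt_coeff_0 [simp]: "sqrt_coeff 0 = 1"
  by (simp add: sqrt_coeff_def)

text \<open>The partial sums decrease: by absorption, passing from \<open>m\<close> to
  \<open>m + 1\<close> multiplies their closed form by \<open>(m + 1/2) / (m + 1)\<close>.\<close>

lemma sqrt_coeff_nonpos: "n > 0 \<Longrightarrow> sqrt_coeff n \<le> 0"
proof -
  assume "n > 0"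
  then obtain m where n: "n = Suc m"
    by (cases n) auto
  have "sqrt_coeff n = (\<Sum>k\<le>n. sqrt_coeff k) - (\<Sum>k\<le>m. sqrt_coeff k)"
    by (simp add: n)
  also have "\<dots> = (real m + 1 / 2 gchoose Suc m) - (real m - 1 / 2 gchoose m)"
    by (simp only: sqrt_coeff_partial_sum_eq n) (simp add: add.commute)
  also have "(real m + 1 / 2 gchoose Suc m) = (real m + 1 / 2) / real (Suc m) * (real m - 1 / 2 gchoose m)"
    using gbinomial_absorption'[of "Suc m" "real m + 1 / 2"] by simp
  also have "\<dots> - (real m - 1 / 2 gchoose m) = - (1 / 2 / real (Suc m)) * (real m - 1 / 2 gchoose m)"
    by (simp add: field_simps)
  also have "\<dots> \<le> 0"
    using sqrt_coeff_partial_sum[of m] by (simp add: sqrt_coeff_partial_sum_eq)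
  finally show ?thesis .
qed

text \<open>Only the coefficient 1 at index 0 is positive, so the sum of absolute values is 2 minus
  the signed partial sum, and the latter is nonnegative.\<close>

lemma summable_sqrt_coeff: "summable (\<lambda>n. \<bar>sqrt_coeff n\<bar>)"
proof (rule summableI_nonneg_bounded)
  fix n
  show "(\<Sum>i<n. \<bar>sqrt_coeff i\<bar>) \<le> 2"
  proof (cases n)
    case (Suc m)
    have "(\<Sum>i<n. \<bar>sqrt_coeff i\<bar>) = (\<Sum>i\<le>m. (if i = 0 then 2 else 0) - sqrt_coeff i)"
      unfolding Suc lessThan_Suc_atMost using sqrt_coeff_nonpos by (intro sum.cong) auto
    also have "\<dots> = 2 - (\<Sum>i\<le>m. sqrt_coeff i)"
      by (simp add: sum_subtractf)
    finally show ?thesis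
      using sqrt_coeff_partial_sum[of m] by simp
  qed simp
qed simp

lemma suminf_sqrt_coeff_nonneg: "suminf sqrt_coeff \<ge> 0"
proof (rule LIMSEQ_le_const)
  show "(\<lambda>m. \<Sum>k\<le>m. sqrt_coeff k) \<longlonglongrightarrow> suminf sqrt_coeff"
    using summable_sqrt_coeff by (intro summable_LIMSEQ') (auto intro: summable_norm_cancel)
qed (use sqrt_coeff_partial_sum in auto)

text \<open>Vandermonde's identity with \<open>1/2 + 1/2 = 1\<close> leaves the binomial
  coefficients of exponent 1.\<close>

lemma sqrt_coeff_convolution:
  "(\<Sum>i\<le>n. sqrt_coeff i * sqrt_coeff (n - i)) = (if n = 0 then 1 else if n = 1 then - 1 else 0)"
proof -
  have "(\<Sum>i\<le>n. sqrt_coeff i * sqrt_coeff (n - i)) =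
      (\<Sum>i\<in>{0..n}. (1 / 2 gchoose i) * (1 / 2 gchoose (n - i))) * (- 1) ^ n"
    unfolding sum_distrib_right atLeast0AtMost
    by (intro sum.cong) (simp_all add: sqrt_coeff_def flip: power_add)
  also have "\<dots> = (1 gchoose n) * (- 1) ^ n"
    by (subst gbinomial_Vandermonde) simp
  also have "(1 gchoose n) = real (1 choose n)"
    using binomial_gbinomial[of 1 n, where 'a = real] by simp
  finally show ?thesis
    by (auto simp: binomial_eq_0)
qed

text \<open>Read with \<open>b k = x\<^sup>k\<close>, this says that the series squares to \<open>1 - x\<close>.\<close>

lemma sqrt_coeff_double_sum:
  fixes b :: "nat \<Rightarrow> complex"
  assumes b: "\<And>k. cmod (b k) \<le> M"
  shows "(\<Sum>m. of_real (sqrt_coeff m) * (\<Sum>n. of_real (sqrt_coeff n) * b (n + m))) = b 0 - b 1"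
proof -
  define f where "f = (\<lambda>(m, n). of_real (sqrt_coeff m * sqrt_coeff n) * b (n + m))"
  have M: "M \<ge> 0"
    using b[of 0] norm_ge_zero[of "b 0"] by linarith
  have sc: "(\<lambda>n. \<bar>sqrt_coeff n\<bar>) summable_on UNIV"
    using norm_summable_imp_summable_on[of "\<lambda>n. \<bar>sqrt_coeff n\<bar>"] summable_sqrt_coeff by simp
  define g where "g = (\<lambda>(m, n). \<bar>sqrt_coeff m\<bar> * (\<bar>sqrt_coeff n\<bar> * M))"
  have "(\<lambda>p. norm (g p)) summable_on UNIV \<times> UNIV"
    unfolding Infinite_Sum.abs_summable_on_Sigma_iff using sc M
    by (auto simp: g_def abs_mult infsum_cmult_right' infsum_cmult_left'
        intro!: summable_on_cmult_left summable_on_cmult_right)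
  then have "(\<lambda>p. norm (f p)) summable_on UNIV \<times> UNIV"
    by (rule Infinite_Sum.abs_summable_on_comparison_test[where g = g])
      (use M in \<open>auto simp: f_def g_def norm_mult abs_mult mult.assoc b intro!: mult_left_mono\<close>)
  then have f: "f summable_on UNIV \<times> UNIV"
    by (rule abs_summable_summable)
  have abs: "summable (\<lambda>n. norm (of_real (sqrt_coeff n) * b (k n)))" for k :: "nat \<Rightarrow> nat"
    by (rule summable_comparison_test'[OF summable_mult2[OF summable_sqrt_coeff, of M]])
      (auto simp: norm_mult abs_mult b intro!: mult_left_mono)
  have inner: "infsum (\<lambda>n. f (m, n)) UNIV =
      of_real (sqrt_coeff m) * (\<Sum>n. of_real (sqrt_coeff n) * b (n + m))" for m
  proof -
    have "((\<lambda>n. of_real (sqrt_coeff n) * b (n + m)) has_sum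
        (\<Sum>n. of_real (sqrt_coeff n) * b (n + m))) UNIV"
      using abs by (intro norm_summable_imp_has_sum summable_sums)
        (auto intro: summable_norm_cancel)
    from has_sum_cmult_right[OF this, of "of_real (sqrt_coeff m)"] show ?thesis
      by (intro infsumI) (simp add: f_def mult.assoc)
  qed
  have inner_bound: "cmod (\<Sum>n. of_real (sqrt_coeff n) * b (n + m)) \<le> (\<Sum>n. \<bar>sqrt_coeff n\<bar>) * M" for m
  proof -
    have "cmod (\<Sum>n. of_real (sqrt_coeff n) * b (n + m)) \<le>
        (\<Sum>n. norm (of_real (sqrt_coeff n) * b (n + m)))"
      by (rule summable_norm) (rule abs)
    also have "\<dots> \<le> (\<Sum>n. \<bar>sqrt_coeff n\<bar> * M)"
      using summable_sqrt_coeff by (intro suminf_le abs summable_mult2)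
        (auto simp: norm_mult b intro!: mult_left_mono)
    finally show ?thesis
      using summable_sqrt_coeff by (simp add: suminf_mult2)
  qed
  \<comment> \<open>Regrouping along \<open>k = m + n\<close>: on an antidiagonal \<open>b\<close>
    is constant and the coefficients form the convolution, which vanishes beyond
    \<open>k = 1\<close>. Absolute summability of the double family justifies the
    rearrangement.\<close>
  have bij: "bij_betw (\<lambda>(k, i). (i, k - i)) (SIGMA k:UNIV. {..k}) (UNIV \<times> UNIV :: (nat \<times> nat) set)"
    by (rule bij_betw_byWitness[where f' = "\<lambda>(m, n). (m + n, m)"]) auto
  let ?g = "\<lambda>m. of_real (sqrt_coeff m) * (\<Sum>n. of_real (sqrt_coeff n) * b (n + m))"
  have g: "summable (\<lambda>m. norm (?g m))"
    by (rule summable_comparison_test'[OF summable_mult2[OF summable_sqrt_coeff, of "(\<Sum>n. \<bar>sqrt_coeff n\<bar>) * M"]])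
      (auto simp: norm_mult inner_bound intro!: mult_left_mono)
  have "suminf ?g = infsum ?g UNIV"
    using g by (intro infsumI[symmetric] norm_summable_imp_has_sum summable_sums)
      (auto intro: summable_norm_cancel)
  also have "\<dots> = infsum f (UNIV \<times> UNIV)"
    unfolding inner[symmetric] by (rule infsum_Sigma_banach[OF f])
  also have "\<dots> = infsum (\<lambda>(k, i). f (i, k - i)) (SIGMA k:UNIV. {..k})"
    using infsum_reindex_bij_betw[OF bij, of f, symmetric] by (simp add: case_prod_beta')
  also have "\<dots> = infsum (\<lambda>k. infsum (\<lambda>i. f (i, k - i)) {..k}) UNIV"
    using summable_on_reindex_bij_betw[OF bij, of f] f
    by (intro infsum_Sigma'_banach[symmetric]) (simp add: case_prod_beta')
  also have "(\<lambda>k. infsum (\<lambda>i. f (i, k - i)) {..k}) =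
      (\<lambda>k. (if k = 0 then b 0 else 0) + (if k = 1 then - b 1 else 0))"
  proof
    fix k
    have "infsum (\<lambda>i. f (i, k - i)) {..k} = of_real (\<Sum>i\<le>k. sqrt_coeff i * sqrt_coeff (k - i)) * b k"
      by (simp add: f_def sum_distrib_right)
    then show "infsum (\<lambda>i. f (i, k - i)) {..k} = (if k = 0 then b 0 else 0) + (if k = 1 then - b 1 else 0)"
      by (simp add: sqrt_coeff_convolution)
  qed
  also have "infsum (\<lambda>k::nat. (if k = 0 then b 0 else 0) + (if k = 1 then - b 1 else 0)) UNIV =
      infsum (\<lambda>k::nat. (if k = 0 then b 0 else 0) + (if k = 1 then - b 1 else 0)) {0, 1}"
    by (rule infsum_cong_neutral) auto
  also have "\<dots> = b 0 - b 1"
    by simp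
  finally show ?thesis .
qed

section \<open>Square roots in C*-algebras\<close>

lemma norm_star [simp]: "norm (star a) = norm (a :: 'a::cstar_algebra_1)"
proof -
  have *: "norm a \<le> norm (star a)" for a :: 'a
  proof (cases "norm a = 0")
    case False
    have "norm a * norm a \<le> norm (star a) * norm a"
      using norm_mult_ineq[of "star a" a] by (simp add: cstar_identity power2_eq_square)
    with False show ?thesis
      by simp
  qed simp
  from *[of a] *[of "star a"] show ?thesis
    by (simp add: star_star)
qed

lemma star_scaleR [simp]: "star (r *\<^sub>R a) = r *\<^sub>R star (a :: 'a::cstar_algebra_1)"
  by (simp add: scaleR_scaleC star_scaleC)

lemma bounded_linear_star: "bounded_linear (star :: 'a::cstar_algebra_1 \<Rightarrow> 'a)"
  by (rule bounded_linear_intro[where K = 1]) (simp_all add: star_add)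

lemma star_zero [simp]: "star (0 :: 'a::cstar_algebra_1) = 0"
  by (rule linear_0[OF bounded_linear.linear[OF bounded_linear_star]])

lemma star_one [simp]: "star (1 :: 'a::cstar_algebra_1) = 1"
  by (metis mult_1_left mult_1_right star_mult star_star)

lemma star_power: "star (a ^ n) = star (a :: 'a::cstar_algebra_1) ^ n"
  by (induction n) (simp_all add: star_mult power_commutes)

text \<open>The binomial series converges absolutely even when \<open>norm x = 1\<close>, since its
  coefficients are absolutely summable; the Cauchy product then collapses to \<open>1 - x\<close>.
  This takes the place of the continuous functional calculus.\<close>

lemma one_minus_eq_square:
  fixes x :: "'a::cstar_algebra_1"
  assumes x: "star x = x" "norm x \<le> 1"
  shows "\<exists>d. star d * d = 1 - x"
proof -
  define d where "d = (\<Sum>n. sqrt_coeff n *\<^sub>R x ^ n)"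
  have pow: "norm (x ^ n) \<le> 1" for n
    using norm_power_ineq[of x n] x(2) by (meson norm_ge_zero order_trans power_le_one)
  have s: "summable (\<lambda>n. norm (sqrt_coeff n *\<^sub>R x ^ n))"
    by (rule summable_comparison_test'[OF summable_sqrt_coeff]) (simp add: mult_left_le pow)
  have "star d = (\<Sum>n. star (sqrt_coeff n *\<^sub>R x ^ n))"
    unfolding d_def
    using bounded_linear.suminf[OF bounded_linear_star summable_norm_cancel[OF s]] by simp
  then have "star d = d"
    by (simp add: star_power x(1) d_def)
  have "d * d = (\<Sum>k. \<Sum>i\<le>k. (sqrt_coeff i *\<^sub>R x ^ i) * (sqrt_coeff (k - i) *\<^sub>R x ^ (k - i)))"
    unfolding d_def by (rule Cauchy_product[OF s s])
  also have "(\<lambda>k. \<Sum>i\<le>k. (sqrt_coeff i *\<^sub>R x ^ i) * (sqrt_coeff (k - i) *\<^sub>R x ^ (k - i))) =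
      (\<lambda>k. (\<Sum>i\<le>k. sqrt_coeff i * sqrt_coeff (k - i)) *\<^sub>R x ^ k)"
    by (auto simp: scaleR_sum_left intro!: sum.cong simp flip: power_add)
  also have "\<dots> = (\<lambda>k. if k \<in> {0, 1::nat} then (if k = 0 then 1 else - x) else 0)"
    by (auto simp: sqrt_coeff_convolution)
  also have "suminf \<dots> = (\<Sum>k\<in>{0, 1::nat}. (if k = 0 then 1 else - x))"
    by (subst suminf_finite[of "{0, 1}"]) auto
  finally have "d * d = (\<Sum>k\<in>{0, 1::nat}. (if k = 0 then 1 else - x))" .
  with \<open>star d = d\<close> have "star d * d = 1 - x"
    by simp
  then show ?thesis ..
qed

text \<open>The C*-inequality \<open>star a * a \<le> (norm a)\<^sup>2\<close>. Positivity means
  being of the form \<open>star d * d\<close>, so the inequality has to be delivered with its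
  witness, obtained from the normalised element by scaling.\<close>

lemma norm_sq_minus_eq_square:
  fixes a :: "'a::cstar_algebra_1"
  shows "\<exists>d. star d * d = (norm a)\<^sup>2 *\<^sub>R 1 - star a * a"
proof (cases "a = 0")
  case False
  define x where "x = inverse ((norm a)\<^sup>2) *\<^sub>R (star a * a)"
  have "star x = x" "norm x \<le> 1"
    using False by (simp_all add: x_def star_mult star_star cstar_identity)
  then obtain d where "star d * d = 1 - x"
    using one_minus_eq_square by blast
  moreover have "(norm a)\<^sup>2 *\<^sub>R x = star a * a"
    using False by (simp add: x_def)
  moreover have "star (norm a *\<^sub>R d) * (norm a *\<^sub>R d) = (norm a)\<^sup>2 *\<^sub>R (star d * d)"
    by (simp add: power2_eq_square)
  ultimately have "star (norm a *\<^sub>R d) * (norm a *\<^sub>R d) = (norm a)\<^sup>2 *\<^sub>R 1 - star a * a"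
    by (simp add: scaleR_diff_right)
  then show ?thesis ..
qed (auto intro: exI[of _ 0])

lemma square_le_mult_imp_le: "a * a \<le> b * a \<Longrightarrow> 0 \<le> a \<Longrightarrow> 0 \<le> b \<Longrightarrow> a \<le> (b::real)"
  by (cases "a = 0") (simp_all add: mult_le_cancel_right)

section \<open>Bounded operators and adjoints\<close>

lemma bop_outside: "f \<in> bop H K \<Longrightarrow> x \<notin> hset H \<Longrightarrow> f x = 0"
  and bop_mem: "f \<in> bop H K \<Longrightarrow> x \<in> hset H \<Longrightarrow> f x \<in> hset K"
  and bop_add: "f \<in> bop H K \<Longrightarrow> x \<in> hset H \<Longrightarrow> y \<in> hset H \<Longrightarrow> f (x + y) = f x + f y"
  and bop_scale: "f \<in> bop H K \<Longrightarrow> x \<in> hset H \<Longrightarrow> f (c *\<^sub>C x) = c *\<^sub>C f x"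
  by (simp_all add: bop_def)

lemma bop_zero: "hilbert_space H \<Longrightarrow> f \<in> bop H K \<Longrightarrow> f 0 = 0"
  using bop_scale[of f H K 0 0] by simp

lemma bop_neg: "f \<in> bop H K \<Longrightarrow> x \<in> hset H \<Longrightarrow> f (- x) = - f x"
  using bop_scale[of f H K x "- 1"] by (simp add: scaleC_minus1)

lemma bop_diff: "hilbert_space H \<Longrightarrow> f \<in> bop H K \<Longrightarrow> x \<in> hset H \<Longrightarrow> y \<in> hset H \<Longrightarrow> f (x - y) = f x - f y"
  using bop_add[of f H K x "- y"] by (simp add: bop_neg)

lemma bop_bound:
  assumes "hilbert_space H" "f \<in> bop H K"
  obtains B where "B \<ge> 0" "\<And>x. x \<in> hset H \<Longrightarrow> hnorm K (f x) \<le> B * hnorm H x"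
proof -
  obtain B where B: "\<forall>x\<in>hset H. hnorm K (f x) \<le> B * hnorm H x"
    using assms(2) by (auto simp: bop_def)
  show thesis
  proof (rule that[of "max B 0"])
    fix x
    assume x: "x \<in> hset H"
    then have "B * hnorm H x \<le> max B 0 * hnorm H x"
      using assms(1) by (intro mult_right_mono) auto
    with B x show "hnorm K (f x) \<le> max B 0 * hnorm H x"
      by fastforce
  qed simp
qed

lemma bopI:
  assumes "\<And>x. x \<notin> hset H \<Longrightarrow> f x = 0" "\<And>x. x \<in> hset H \<Longrightarrow> f x \<in> hset K"
    "\<And>x y. x \<in> hset H \<Longrightarrow> y \<in> hset H \<Longrightarrow> f (x + y) = f x + f y"
    "\<And>c x. x \<in> hset H \<Longrightarrow> f (c *\<^sub>C x) = c *\<^sub>C f x"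
    "\<And>x. x \<in> hset H \<Longrightarrow> hnorm K (f x) \<le> B * hnorm H x"
  shows "f \<in> bop H K"
  unfolding bop_def using assms by (simp, blast)

lemma bop_comp [intro]:
  assumes H: "hilbert_space H" and K: "hilbert_space K" and f: "f \<in> bop H K" and g: "g \<in> bop K L"
  shows "g \<circ> f \<in> bop H L"
proof -
  obtain B where B: "B \<ge> 0" "\<And>x. x \<in> hset H \<Longrightarrow> hnorm K (f x) \<le> B * hnorm H x"
    using bop_bound[OF H f] by blast
  obtain C where C: "C \<ge> 0" "\<And>x. x \<in> hset K \<Longrightarrow> hnorm L (g x) \<le> C * hnorm K x"
    using bop_bound[OF K g] by blast
  show ?thesis
  proof (rule bopI[where B = "C * B"])
    fix x
    assume x: "x \<in> hset H"
    have "hnorm L (g (f x)) \<le> C * hnorm K (f x)"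
      using C(2) bop_mem[OF f x] .
    also have "\<dots> \<le> C * (B * hnorm H x)"
      using B(2)[OF x] C(1) by (rule mult_left_mono)
    finally show "hnorm L ((g \<circ> f) x) \<le> C * B * hnorm H x"
      by (simp add: mult.assoc)
  qed (use f g K in \<open>simp_all add: bop_outside bop_mem bop_add bop_scale bop_zero\<close>)
qed

lemma bop_eqI:
  assumes "f \<in> bop H K" "g \<in> bop H K" "\<And>x. x \<in> hset H \<Longrightarrow> f x = g x"
  shows "f = g"
proof
  show "f x = g x" for x
    using assms by (cases "x \<in> hset H") (simp_all add: bop_outside)
qed

lemma bop_eq_ipI:
  assumes "hilbert_space K" "f \<in> bop H K" "g \<in> bop H K"
    "\<And>x y. x \<in> hset H \<Longrightarrow> y \<in> hset K \<Longrightarrow> hip K y (f x) = hip K y (g x)"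
  shows "f = g"
  using assms by (intro bop_eqI[of f H K g] hip_eqI[of K]) (auto simp: bop_mem)

lemma id_op_bop [simp]: "hilbert_space H \<Longrightarrow> id_op H \<in> bop H H"
  by (rule bopI[where B = 1]) (auto simp: id_op_def on_hset_def)

lemma id_op_apply [simp]: "x \<in> hset H \<Longrightarrow> id_op H x = x"
  by (simp add: id_op_def on_hset_def)

lemma bop_minus:
  assumes H: "hilbert_space H" and K: "hilbert_space K" and f: "f \<in> bop H K" and g: "g \<in> bop H K"
  shows "f - g \<in> bop H K"
proof -
  obtain B where B: "B \<ge> 0" "\<And>x. x \<in> hset H \<Longrightarrow> hnorm K (f x) \<le> B * hnorm H x"
    using bop_bound[OF H f] by blast
  obtain C where C: "C \<ge> 0" "\<And>x. x \<in> hset H \<Longrightarrow> hnorm K (g x) \<le> C * hnorm H x"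
    using bop_bound[OF H g] by blast
  show ?thesis
  proof (rule bopI[where B = "B + C"])
    fix x
    assume x: "x \<in> hset H"
    have "hnorm K (f x - g x) \<le> hnorm K (f x) + hnorm K (g x)"
      using hnorm_triangle[OF K bop_mem[OF f x], of "- g x"] K bop_mem[OF g x] by simp
    with B(2)[OF x] C(2)[OF x] show "hnorm K ((f - g) x) \<le> (B + C) * hnorm H x"
      by (simp add: algebra_simps)
  qed (use f g K in \<open>simp_all add: bop_outside bop_mem bop_add bop_scale bop_zero cvec.scale_right_diff_distrib\<close>)
qed

lemma hadj_exists:
  assumes H: "hilbert_space H" and K: "hilbert_space K" and f: "f \<in> bop H K" and y: "y \<in> hset K"
  shows "\<exists>x. x \<in> hset H \<and> (\<forall>z\<in>hset H. hip H z x = hip K (f z) y)"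
proof -
  obtain B where B: "B \<ge> 0" "\<And>x. x \<in> hset H \<Longrightarrow> hnorm K (f x) \<le> B * hnorm H x"
    using bop_bound[OF H f] by blast
  have "\<exists>x\<in>hset H. \<forall>z\<in>hset H. hip K (f z) y = hip H z x"
  proof (rule riesz[OF H])
    show "cmod (hip K (f u) y) \<le> (B * hnorm K y) * hnorm H u" if u: "u \<in> hset H" for u
    proof -
      have "cmod (hip K (f u) y) \<le> hnorm K (f u) * hnorm K y"
        using K bop_mem[OF f u] y by (rule hip_cauchy_schwarz)
      also have "\<dots> \<le> (B * hnorm H u) * hnorm K y"
        using B(2)[OF u] K y by (intro mult_right_mono) auto
      finally show ?thesis
        by (simp add: ac_simps)
    qed
  qed (use f K y in \<open>simp_all add: bop_mem bop_add bop_scale\<close>)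
  then show ?thesis
    by auto
qed

lemma hadj_unique:
  assumes H: "hilbert_space H"
    and x: "x \<in> hset H" "\<And>z. z \<in> hset H \<Longrightarrow> hip H z x = hip K (f z) y" and y: "y \<in> hset K"
  shows "hadj H K f y = x"
  unfolding hadj_def on_hset_def using y
  by (simp, intro the_equality) (auto intro!: hip_eqI[OF H] simp: x)

lemma hadj_mem_ip:
  assumes "hilbert_space H" "hilbert_space K" "f \<in> bop H K" "y \<in> hset K"
  shows "hadj H K f y \<in> hset H \<and> (\<forall>z\<in>hset H. hip H z (hadj H K f y) = hip K (f z) y)"
proof -
  obtain x where x: "x \<in> hset H" "\<And>z. z \<in> hset H \<Longrightarrow> hip H z x = hip K (f z) y"
    using hadj_exists[OF assms] by auto
  with hadj_unique[OF assms(1) this assms(4)] show ?thesis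
    by simp
qed

lemma hadj_mem: "hilbert_space H \<Longrightarrow> hilbert_space K \<Longrightarrow> f \<in> bop H K \<Longrightarrow> y \<in> hset K \<Longrightarrow>
    hadj H K f y \<in> hset H"
  and hip_hadj_right: "hilbert_space H \<Longrightarrow> hilbert_space K \<Longrightarrow> f \<in> bop H K \<Longrightarrow> y \<in> hset K \<Longrightarrow>
    z \<in> hset H \<Longrightarrow> hip H z (hadj H K f y) = hip K (f z) y"
  using hadj_mem_ip by blast+

lemma hip_hadj_left: "hilbert_space H \<Longrightarrow> hilbert_space K \<Longrightarrow> f \<in> bop H K \<Longrightarrow> y \<in> hset K \<Longrightarrow>
    z \<in> hset H \<Longrightarrow> hip H (hadj H K f y) z = hip K y (f z)"
  using hip_hadj_right[of H K f y z] hip_cnj[of H z "hadj H K f y"] hip_cnj[of K "f z" y]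
  by (simp add: hadj_mem bop_mem)

lemma hadj_outside: "y \<notin> hset K \<Longrightarrow> hadj H K f y = 0"
  by (simp add: hadj_def on_hset_def)

lemma hadj_bop:
  assumes H: "hilbert_space H" and K: "hilbert_space K" and f: "f \<in> bop H K"
  shows "hadj H K f \<in> bop K H"
proof -
  obtain B where B: "B \<ge> 0" "\<And>x. x \<in> hset H \<Longrightarrow> hnorm K (f x) \<le> B * hnorm H x"
    using bop_bound[OF H f] by blast
  note [simp] = hadj_mem[OF assms] bop_mem[OF f] hip_hadj_right[OF assms]
  show ?thesis
  proof (rule bopI[where B = B])
    fix y
    assume y: "y \<in> hset K"
    let ?x = "hadj H K f y"
    have "(hnorm H ?x)\<^sup>2 = cmod (hip H ?x ?x)"
      using H y by (subst hip_self) (simp_all add: norm_power del: hip_hadj_right)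
    also have "hip H ?x ?x = hip K (f ?x) y"
      using y by simp
    also have "cmod (hip K (f ?x) y) \<le> hnorm K (f ?x) * hnorm K y"
      using K y by (intro hip_cauchy_schwarz) simp_all
    also have "\<dots> \<le> (B * hnorm H ?x) * hnorm K y"
      using K y by (intro mult_right_mono B) simp_all
    finally have "hnorm H ?x * hnorm H ?x \<le> (B * hnorm K y) * hnorm H ?x"
      by (simp add: power2_eq_square mult_ac)
    then show "hnorm H ?x \<le> B * hnorm K y"
      by (rule square_le_mult_imp_le) (use H K y B(1) in simp_all)
  next
    show "hadj H K f (x + y) = hadj H K f x + hadj H K f y" if "x \<in> hset K" "y \<in> hset K" for x y
      using H K that by (intro hip_eqI[OF H]) simp_all
    show "hadj H K f (c *\<^sub>C x) = c *\<^sub>C hadj H K f x" if "x \<in> hset K" for c x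
      using H K that by (intro hip_eqI[OF H]) simp_all
  qed (use hadj_outside in auto)
qed

lemma hadj_eqI:
  assumes H: "hilbert_space H" and g: "g \<in> bop K H"
    and ip: "\<And>x y. x \<in> hset H \<Longrightarrow> y \<in> hset K \<Longrightarrow> hip H x (g y) = hip K (f x) y"
  shows "hadj H K f = g"
proof
  show "hadj H K f y = g y" for y
  proof (cases "y \<in> hset K")
    case True
    then show ?thesis
      using bop_mem[OF g True] ip by (intro hadj_unique[OF H]) auto
  qed (simp add: hadj_outside bop_outside[OF g])
qed

section \<open>Positive operators\<close>

text \<open>Polarization with \<open>t = 1\<close> and \<open>t = \<i>\<close>. Positivity only
  speaks about the diagonal of a form; this recovers its Hermitian symmetry, for operators and for
  kernels alike.\<close>

lemma real_form_hermitian: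
  fixes p q :: complex
  assumes "\<And>t. Im (cnj t * q + t * p) = 0"
  shows "q = cnj p"
  using assms[of 1] assms[of \<i>] by (simp add: complex_eq_iff)

lemma positive_op_bop: "positive_op H f \<Longrightarrow> f \<in> bop H H"
  and positive_op_nonneg: "positive_op H f \<Longrightarrow> x \<in> hset H \<Longrightarrow> hip H x (f x) \<in> \<real>\<^sub>\<ge>\<^sub>0"
  by (simp_all add: positive_op_def)

lemma positive_op_Re: "positive_op H f \<Longrightarrow> x \<in> hset H \<Longrightarrow> Re (hip H x (f x)) \<ge> 0"
  and positive_op_Im: "positive_op H f \<Longrightarrow> x \<in> hset H \<Longrightarrow> Im (hip H x (f x)) = 0"
  using positive_op_nonneg[of H f x] by (simp_all add: complex_nonneg_Reals_iff)

lemma positive_op_self_adjoint: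
  assumes H: "hilbert_space H" and f: "positive_op H f" and x: "x \<in> hset H" and y: "y \<in> hset H"
  shows "hip H y (f x) = hip H (f y) x"
proof -
  note f' = positive_op_bop[OF f]
  have "hip H y (f x) = cnj (hip H x (f y))"
  proof (rule real_form_hermitian)
    fix t
    have "Im (hip H (x + t *\<^sub>C y) (f (x + t *\<^sub>C y))) = 0"
      using assms by (intro positive_op_Im) auto
    moreover have "hip H (x + t *\<^sub>C y) (f (x + t *\<^sub>C y)) = hip H x (f x) +
        (cnj t * hip H y (f x) + t * hip H x (f y)) + (cnj t * t) * hip H y (f y)"
      using H x y by (simp add: bop_add[OF f'] bop_scale[OF f'] bop_mem[OF f'] algebra_simps)
    ultimately show "Im (cnj t * hip H y (f x) + t * hip H x (f y)) = 0"
      using positive_op_Im[OF f x] positive_op_Im[OF f y] by simp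
  qed
  then show ?thesis
    using hip_cnj[OF H x bop_mem[OF f' y]] by simp
qed

lemma positive_op_cauchy_schwarz:
  assumes H: "hilbert_space H" and f: "positive_op H f" and x: "x \<in> hset H" and y: "y \<in> hset H"
  shows "(cmod (hip H y (f x)))\<^sup>2 \<le> Re (hip H x (f x)) * Re (hip H y (f y))"
proof (rule quadratic_form_bound)
  note f' = positive_op_bop[OF f]
  fix t
  have "0 \<le> Re (hip H (x + t *\<^sub>C y) (f (x + t *\<^sub>C y)))"
    using assms by (intro positive_op_Re) auto
  also have "hip H (x + t *\<^sub>C y) (f (x + t *\<^sub>C y)) = hip H x (f x) +
      (cnj t * hip H y (f x) + t * hip H x (f y)) + (cnj t * t) * hip H y (f y)"
    using H x y by (simp add: bop_add[OF f'] bop_scale[OF f'] bop_mem[OF f'] algebra_simps)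
  also have "hip H x (f y) = cnj (hip H y (f x))"
    using positive_op_self_adjoint[OF H f x y] hip_cnj[OF H bop_mem[OF f' y] x] by simp
  finally show "0 \<le> Re (hip H x (f x)) + 2 * Re (cnj t * hip H y (f x)) + (cmod t)\<^sup>2 * Re (hip H y (f y))"
    using positive_op_Im[OF f y]
    by (simp add: complex_norm_square[symmetric] mult.commute[of "cnj t" t])
qed (use positive_op_Re[OF f y] in auto)

text \<open>Cauchy-Schwarz for the form of \<open>f\<close>, applied to \<open>x\<close> and
  \<open>f x\<close>.\<close>

lemma positive_op_form_zero:
  assumes H: "hilbert_space H" and f: "positive_op H f" and x: "x \<in> hset H"
    and z: "Re (hip H x (f x)) = 0"
  shows "f x = 0"
proof -
  have fx: "f x \<in> hset H"
    using bop_mem[OF positive_op_bop[OF f] x] .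
  have "hip H (f x) (f x) = 0"
    using positive_op_cauchy_schwarz[OF H f x fx] z by simp
  then show ?thesis
    by (rule hip_self_zero[OF H fx])
qed

text \<open>Turns the order bound \<open>f \<le> 1\<close> into a norm bound: Cauchy-Schwarz for the
  form of \<open>f\<close> at \<open>x\<close> and \<open>f x\<close> bounds the fourth power of the
  norm of \<open>f x\<close> by the product of the squared norms of \<open>x\<close> and
  \<open>f x\<close>.\<close>

lemma positive_op_sub_id_bound:
  assumes H: "hilbert_space H" and f: "positive_op H f" and x: "x \<in> hset H"
    and le: "\<And>x. x \<in> hset H \<Longrightarrow> Re (hip H x (f x)) \<le> (hnorm H x)\<^sup>2"
  shows "hnorm H (f x) \<le> hnorm H x"
proof -
  have fx: "f x \<in> hset H"
    using bop_mem[OF positive_op_bop[OF f] x] .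
  have "((hnorm H (f x))\<^sup>2)\<^sup>2 = (cmod (hip H (f x) (f x)))\<^sup>2"
    using H fx by (simp add: hip_self norm_power)
  also have "\<dots> \<le> Re (hip H x (f x)) * Re (hip H (f x) (f (f x)))"
    using positive_op_cauchy_schwarz[OF H f x fx] .
  also have "\<dots> \<le> (hnorm H x)\<^sup>2 * (hnorm H (f x))\<^sup>2"
    using le x fx positive_op_Re[OF f] by (intro mult_mono) auto
  finally have "(hnorm H (f x))\<^sup>2 * (hnorm H (f x))\<^sup>2 \<le> (hnorm H x)\<^sup>2 * (hnorm H (f x))\<^sup>2"
    by (simp add: power2_eq_square)
  then have "(hnorm H (f x))\<^sup>2 \<le> (hnorm H x)\<^sup>2"
    by (cases "hnorm H (f x) = 0") (simp, erule mult_right_le_imp_le, simp)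
  then show ?thesis
    by (rule power2_le_imp_le) (use H x in simp)
qed

lemma contraction_op_form:
  assumes H: "hilbert_space H" and f: "contraction_op H f" and x: "x \<in> hset H"
  shows "Re (hip H x (f x)) \<le> (hnorm H x)\<^sup>2"
proof -
  have fx: "f x \<in> hset H" "hnorm H (f x) \<le> hnorm H x"
    using f x by (auto simp: contraction_op_def bop_mem)
  have "Re (hip H x (f x)) \<le> hnorm H x * hnorm H (f x)"
    using hip_cauchy_schwarz[OF H x fx(1)] complex_Re_le_cmod order_trans by blast
  also have "\<dots> \<le> hnorm H x * hnorm H x"
    using fx(2) H x by (intro mult_left_mono) auto
  finally show ?thesis
    by (simp add: power2_eq_square)
qed

lemma complement_positive:
  assumes H: "hilbert_space H" and T: "positive_op H T" "contraction_op H T"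
  shows "positive_op H (id_op H - T)"
  unfolding positive_op_def
proof (intro conjI ballI)
  show "id_op H - T \<in> bop H H"
    using H T(1) by (simp add: bop_minus positive_op_bop)
  fix x
  assume x: "x \<in> hset H"
  then show "hip H x ((id_op H - T) x) \<in> \<real>\<^sub>\<ge>\<^sub>0"
    using contraction_op_form[OF H T(2) x] positive_op_Im[OF T(1) x] H bop_mem[OF positive_op_bop[OF T(1)] x]
    by (simp add: complex_nonneg_Reals_iff hip_self)
qed

subsection \<open>Square roots of positive contractions\<close>

text \<open>The matrix coefficients of the binomial series in \<open>id_op H - T\<close>. Summing
  weakly requires only scalar series; the operator itself is then recovered through the Riesz
  representation.\<close>

definition sqrt_form :: "'v::complex_vector hspace \<Rightarrow> ('v \<Rightarrow> 'v) \<Rightarrow> 'v \<Rightarrow> 'v \<Rightarrow> complex" where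
  "sqrt_form H T y x = (\<Sum>n. of_real (sqrt_coeff n) * hip H y (((id_op H - T) ^^ n) x))"

definition sqrt_series :: "'v::complex_vector hspace \<Rightarrow> ('v \<Rightarrow> 'v) \<Rightarrow> 'v \<Rightarrow> 'v" where
  "sqrt_series H T = on_hset H (\<lambda>x. THE v. v \<in> hset H \<and> (\<forall>y\<in>hset H. sqrt_form H T y x = hip H y v))"

locale positive_contraction =
  fixes H :: "'v::complex_vector hspace" and T :: "'v \<Rightarrow> 'v"
  assumes H [simp]: "hilbert_space H" and pos: "positive_op H T" and contr: "contraction_op H T"
begin

abbreviation "A \<equiv> id_op H - T"

lemma T_bop: "T \<in> bop H H"
  using pos by (rule positive_op_bop)

lemma A_pos: "positive_op H A"
  by (rule complement_positive[OF H pos contr])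

lemma A_bop: "A \<in> bop H H"
  using A_pos by (rule positive_op_bop)

lemma A_norm: "x \<in> hset H \<Longrightarrow> hnorm H (A x) \<le> hnorm H x"
proof (rule positive_op_sub_id_bound[OF H A_pos])
  fix x
  assume "x \<in> hset H"
  then show "Re (hip H x (A x)) \<le> (hnorm H x)\<^sup>2"
    using positive_op_Re[OF pos] by (simp add: bop_mem[OF T_bop] hip_self)
qed

lemma pow_mem [simp]: "x \<in> hset H \<Longrightarrow> (A ^^ n) x \<in> hset H"
  by (induction n) (simp_all del: minus_apply add: bop_mem[OF A_bop])

lemma pow_norm: "x \<in> hset H \<Longrightarrow> hnorm H ((A ^^ n) x) \<le> hnorm H x"
proof (induction n)
  case (Suc n)
  then show ?case
    using A_norm[of "(A ^^ n) x"] by (simp del: minus_apply)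
qed simp

lemma pow_add: "x \<in> hset H \<Longrightarrow> y \<in> hset H \<Longrightarrow> (A ^^ n) (x + y) = (A ^^ n) x + (A ^^ n) y"
  by (induction n) (simp_all del: minus_apply add: bop_add[OF A_bop])

lemma pow_scale: "x \<in> hset H \<Longrightarrow> (A ^^ n) (c *\<^sub>C x) = c *\<^sub>C (A ^^ n) x"
  by (induction n) (simp_all del: minus_apply add: bop_scale[OF A_bop])

lemma pow_self_adjoint: "x \<in> hset H \<Longrightarrow> y \<in> hset H \<Longrightarrow> hip H y ((A ^^ n) x) = hip H ((A ^^ n) y) x"
proof (induction n arbitrary: y)
  case (Suc n)
  have "hip H y (A ((A ^^ n) x)) = hip H (A y) ((A ^^ n) x)"
    using Suc.prems by (intro positive_op_self_adjoint[OF H A_pos]) simp_all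
  also have "\<dots> = hip H ((A ^^ n) (A y)) x"
    using Suc.prems by (intro Suc.IH bop_mem[OF A_bop]) simp_all
  finally show ?case
    unfolding funpow_Suc_right by (simp del: minus_apply add: funpow_swap1)
qed simp

lemma pow_ip_bound:
  assumes "x \<in> hset H" "y \<in> hset H"
  shows "cmod (hip H y ((A ^^ n) x)) \<le> hnorm H y * hnorm H x"
proof -
  have "cmod (hip H y ((A ^^ n) x)) \<le> hnorm H y * hnorm H ((A ^^ n) x)"
    using assms by (intro hip_cauchy_schwarz) simp_all
  also have "\<dots> \<le> hnorm H y * hnorm H x"
    using assms pow_norm by (intro mult_left_mono) simp_all
  finally show ?thesis .
qed

lemma sqrt_form_abs_summable:
  assumes "x \<in> hset H" "y \<in> hset H"
  shows "summable (\<lambda>n. norm (of_real (sqrt_coeff n) * hip H y ((A ^^ n) x)))"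
  by (rule summable_comparison_test'[OF summable_mult2[OF summable_sqrt_coeff, of "hnorm H y * hnorm H x"]])
    (auto simp: norm_mult abs_mult assms simp del: minus_apply intro!: mult_left_mono pow_ip_bound)

lemma sqrt_form_summable:
  "x \<in> hset H \<Longrightarrow> y \<in> hset H \<Longrightarrow> summable (\<lambda>n. of_real (sqrt_coeff n) * hip H y ((A ^^ n) x))"
  using sqrt_form_abs_summable by (rule summable_norm_cancel)

definition M :: real where
  "M = (\<Sum>n. \<bar>sqrt_coeff n\<bar>)"

lemma sqrt_form_bound:
  assumes "x \<in> hset H" "y \<in> hset H"
  shows "cmod (sqrt_form H T y x) \<le> M * (hnorm H y * hnorm H x)"
proof -
  have "cmod (sqrt_form H T y x) \<le> (\<Sum>n. norm (of_real (sqrt_coeff n) * hip H y ((A ^^ n) x)))"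
    unfolding sqrt_form_def by (rule summable_norm) (rule sqrt_form_abs_summable[OF assms])
  also have "\<dots> \<le> (\<Sum>n. \<bar>sqrt_coeff n\<bar> * (hnorm H y * hnorm H x))"
    by (intro suminf_le sqrt_form_abs_summable assms summable_mult2 summable_sqrt_coeff)
      (auto simp: norm_mult assms simp del: minus_apply intro!: mult_left_mono pow_ip_bound)
  also have "\<dots> = M * (hnorm H y * hnorm H x)"
    unfolding M_def by (rule suminf_mult2[symmetric, OF summable_sqrt_coeff])
  finally show ?thesis .
qed

lemma sqrt_form_add_left: "x \<in> hset H \<Longrightarrow> y \<in> hset H \<Longrightarrow> z \<in> hset H \<Longrightarrow>
    sqrt_form H T (y + z) x = sqrt_form H T y x + sqrt_form H T z x"
  unfolding sqrt_form_def
  by (subst suminf_add[OF sqrt_form_summable sqrt_form_summable])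
    (simp_all add: distrib_left del: minus_apply)

lemma sqrt_form_scale_left: "x \<in> hset H \<Longrightarrow> y \<in> hset H \<Longrightarrow>
    sqrt_form H T (c *\<^sub>C y) x = cnj c * sqrt_form H T y x"
  unfolding sqrt_form_def
  by (subst suminf_mult[symmetric, OF sqrt_form_summable])
    (simp_all add: mult_ac del: minus_apply)

lemma sqrt_form_add_right: "x \<in> hset H \<Longrightarrow> y \<in> hset H \<Longrightarrow> z \<in> hset H \<Longrightarrow>
    sqrt_form H T x (y + z) = sqrt_form H T x y + sqrt_form H T x z"
  unfolding sqrt_form_def
  by (subst suminf_add[OF sqrt_form_summable sqrt_form_summable])
    (simp_all add: distrib_left pow_add del: minus_apply)

lemma sqrt_form_scale_right: "x \<in> hset H \<Longrightarrow> y \<in> hset H \<Longrightarrow>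
    sqrt_form H T x (c *\<^sub>C y) = c * sqrt_form H T x y"
  unfolding sqrt_form_def
  by (subst suminf_mult[symmetric, OF sqrt_form_summable])
    (simp_all add: mult_ac pow_scale del: minus_apply)

lemma sqrt_series_mem_ip:
  assumes x: "x \<in> hset H"
  shows "sqrt_series H T x \<in> hset H \<and> (\<forall>y\<in>hset H. sqrt_form H T y x = hip H y (sqrt_series H T x))"
proof -
  have "\<exists>v\<in>hset H. \<forall>y\<in>hset H. sqrt_form H T y x = hip H y v"
  proof (rule riesz[OF H])
    show "cmod (sqrt_form H T u x) \<le> (M * hnorm H x) * hnorm H u" if "u \<in> hset H" for u
      using sqrt_form_bound[OF x that] by (simp add: mult_ac)
  qed (simp_all add: sqrt_form_add_left sqrt_form_scale_left x)
  then obtain v where "v \<in> hset H" "\<forall>y\<in>hset H. sqrt_form H T y x = hip H y v"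
    by blast
  then have "\<exists>!v. v \<in> hset H \<and> (\<forall>y\<in>hset H. sqrt_form H T y x = hip H y v)"
    by (intro ex1I[of _ v]) (auto intro!: hip_eqI[OF H])
  then show ?thesis
    unfolding sqrt_series_def on_hset_def if_P[OF x] by (rule theI')
qed

lemma sqrt_series_mem [simp]: "x \<in> hset H \<Longrightarrow> sqrt_series H T x \<in> hset H"
  and sqrt_series_ip: "x \<in> hset H \<Longrightarrow> y \<in> hset H \<Longrightarrow> hip H y (sqrt_series H T x) = sqrt_form H T y x"
  using sqrt_series_mem_ip[of x] by simp_all

lemma sqrt_series_bop: "sqrt_series H T \<in> bop H H"
proof (rule bopI[where B = M])
  show "sqrt_series H T (x + y) = sqrt_series H T x + sqrt_series H T y"
    if "x \<in> hset H" "y \<in> hset H" for x y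
    using that by (intro hip_eqI[OF H]) (simp_all add: sqrt_series_ip sqrt_form_add_right)
  show "sqrt_series H T (c *\<^sub>C x) = c *\<^sub>C sqrt_series H T x" if "x \<in> hset H" for c x
    using that by (intro hip_eqI[OF H]) (simp_all add: sqrt_series_ip sqrt_form_scale_right)
  fix x
  assume x: "x \<in> hset H"
  let ?g = "sqrt_series H T x"
  have "(hnorm H ?g)\<^sup>2 = cmod (hip H ?g ?g)"
    using x by (subst hip_self) (simp_all add: norm_power)
  also have "\<dots> = cmod (sqrt_form H T ?g x)"
    using x by (subst sqrt_series_ip) simp_all
  also have "\<dots> \<le> M * (hnorm H ?g * hnorm H x)"
    using x by (intro sqrt_form_bound) simp_all
  finally have "hnorm H ?g * hnorm H ?g \<le> (M * hnorm H x) * hnorm H ?g"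
    by (simp add: power2_eq_square mult_ac)
  then show "hnorm H ?g \<le> M * hnorm H x"
  proof (rule square_le_mult_imp_le)
    have "M \<ge> 0"
      unfolding M_def by (rule suminf_nonneg[OF summable_sqrt_coeff]) simp
    with x show "M * hnorm H x \<ge> 0"
      by simp
  qed (use x in simp)
next
  show "sqrt_series H T x = 0" if "x \<notin> hset H" for x
    using that by (simp add: sqrt_series_def on_hset_def)
qed simp

text \<open>The numbers \<open>r n\<close>, that is the pairings of \<open>x\<close> with
  \<open>(A ^^ n) x\<close>, are real and at most the squared norm of \<open>x\<close>, with
  equality at \<open>n = 0\<close>. As all later coefficients are nonpositive, replacing every
  \<open>r n\<close> by that bound only lowers the sum, and the result is a nonnegative multiple of
  \<open>suminf sqrt_coeff\<close>.\<close>

lemma sqrt_series_positive: "positive_op H (sqrt_series H T)"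
  unfolding positive_op_def
proof (intro conjI ballI sqrt_series_bop)
  fix x
  assume x: "x \<in> hset H"
  define r where "r n = Re (hip H x ((A ^^ n) x))" for n
  have r: "hip H x ((A ^^ n) x) = of_real (r n)" for n
    using pow_self_adjoint[OF x x, of n] hip_cnj[OF H x pow_mem[OF x, of n]]
    by (simp add: complex_eq_iff r_def del: minus_apply)
  have r_le: "\<bar>r n\<bar> \<le> (hnorm H x)\<^sup>2" for n
    using pow_ip_bound[OF x x, of n] by (simp add: r power2_eq_square del: minus_apply)
  have s: "summable (\<lambda>n. sqrt_coeff n * r n)"
    using sqrt_form_summable[OF x x] unfolding r by (simp del: minus_apply flip: of_real_mult add: summable_of_real_iff)
  have sc: "summable sqrt_coeff"
    using summable_sqrt_coeff by (rule summable_rabs_cancel)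
  have "0 \<le> suminf sqrt_coeff * (hnorm H x)\<^sup>2"
    using suminf_sqrt_coeff_nonneg by simp
  also have "\<dots> = (\<Sum>n. sqrt_coeff n * (hnorm H x)\<^sup>2)"
    by (rule suminf_mult2[OF sc])
  also have "\<dots> \<le> (\<Sum>n. sqrt_coeff n * r n)"
  proof (rule suminf_le)
    fix n
    show "sqrt_coeff n * (hnorm H x)\<^sup>2 \<le> sqrt_coeff n * r n"
    proof (cases "n = 0")
      case True
      then show ?thesis
        using x by (simp add: r_def hip_self)
    next
      case False
      then show ?thesis
        using sqrt_coeff_nonpos[of n] r_le[of n] by (intro mult_left_mono_neg) auto
    qed
  qed (use s sc in \<open>auto intro: summable_mult2\<close>)
  finally have "0 \<le> (\<Sum>n. sqrt_coeff n * r n)" .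
  moreover have "hip H x (sqrt_series H T x) = of_real (\<Sum>n. sqrt_coeff n * r n)"
    unfolding sqrt_series_ip[OF x x] sqrt_form_def r
    using suminf_of_real[OF s, where 'a = complex] by simp
  ultimately show "hip H x (sqrt_series H T x) \<in> \<real>\<^sub>\<ge>\<^sub>0"
    by simp
qed

text \<open>Self-adjointness moves one factor to the left argument, so both factors can be expanded
  weakly. This yields the double sum with \<open>b k\<close> the pairing of \<open>y\<close> with
  \<open>(A ^^ k) x\<close>, which collapses to the coefficient of
  \<open>id_op H - A = T\<close>.\<close>

lemma sqrt_series_square: "sqrt_series H T \<circ> sqrt_series H T = T"
proof (rule bop_eq_ipI[OF H _ T_bop])
  show "sqrt_series H T \<circ> sqrt_series H T \<in> bop H H"
    by (rule bop_comp[OF H H sqrt_series_bop sqrt_series_bop])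
  fix x y
  assume x: "x \<in> hset H" and y: "y \<in> hset H"
  let ?g = "sqrt_series H T"
  have "hip H y (?g (?g x)) = hip H (?g y) (?g x)"
    using x y by (intro positive_op_self_adjoint[OF H sqrt_series_positive]) simp_all
  also have "\<dots> = (\<Sum>m. of_real (sqrt_coeff m) * hip H (?g y) ((A ^^ m) x))"
    using x y by (subst sqrt_series_ip) (simp_all add: sqrt_form_def del: minus_apply)
  also have "(\<lambda>m. hip H (?g y) ((A ^^ m) x)) =
      (\<lambda>m. \<Sum>n. of_real (sqrt_coeff n) * hip H y ((A ^^ (n + m)) x))"
  proof
    fix m
    have "hip H (?g y) ((A ^^ m) x) = hip H y (?g ((A ^^ m) x))"
      using x y by (intro positive_op_self_adjoint[OF H sqrt_series_positive, symmetric]) simp_all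
    also have "\<dots> = (\<Sum>n. of_real (sqrt_coeff n) * hip H y ((A ^^ n) ((A ^^ m) x)))"
      using x y by (subst sqrt_series_ip) (simp_all add: sqrt_form_def del: minus_apply)
    finally show "hip H (?g y) ((A ^^ m) x) =
        (\<Sum>n. of_real (sqrt_coeff n) * hip H y ((A ^^ (n + m)) x))"
      by (simp add: funpow_add del: minus_apply)
  qed
  also have "(\<Sum>m. of_real (sqrt_coeff m) * (\<Sum>n. of_real (sqrt_coeff n) * hip H y ((A ^^ (n + m)) x))) =
      hip H y ((A ^^ 0) x) - hip H y ((A ^^ 1) x)"
    using pow_ip_bound[OF x y] by (rule sqrt_coeff_double_sum)
  also have "\<dots> = hip H y (T x)"
    using x y by (simp add: bop_mem[OF T_bop])
  finally show "hip H y ((?g \<circ> ?g) x) = hip H y (T x)"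
    by simp
qed

end

text \<open>Intertwining passes to the powers of the complements and so to the series; the adjoint
  of \<open>B\<close> carries it to the left argument, where the weak definition applies. Two
  different spaces are allowed because \<open>B\<close> will be \<Psi> at a module element.\<close>

lemma sqrt_series_intertwine:
  assumes T: "positive_contraction H T" and S: "positive_contraction K S"
    and B: "B \<in> bop K H" and TB: "T \<circ> B = B \<circ> S"
  shows "sqrt_series H T \<circ> B = B \<circ> sqrt_series K S"
proof -
  interpret T: positive_contraction H T by fact
  interpret S: positive_contraction K S by fact
  have AB: "T.A (B x) = B (S.A x)" if "x \<in> hset K" for x
    using that fun_cong[OF TB, of x]
    by (simp add: bop_mem[OF B] bop_diff[OF S.H B] bop_mem[OF S.T_bop])
  have powB: "(T.A ^^ n) (B x) = B ((S.A ^^ n) x)" if "x \<in> hset K" for x n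
    using that by (induction n) (simp_all del: minus_apply add: AB)
  show ?thesis
  proof (rule bop_eq_ipI[OF T.H])
    show "sqrt_series H T \<circ> B \<in> bop K H"
      by (rule bop_comp[OF S.H T.H B T.sqrt_series_bop])
    show "B \<circ> sqrt_series K S \<in> bop K H"
      by (rule bop_comp[OF S.H S.H S.sqrt_series_bop B])
    fix x y
    assume x: "x \<in> hset K" and y: "y \<in> hset H"
    have "hip H y (sqrt_series H T (B x)) =
        (\<Sum>n. of_real (sqrt_coeff n) * hip H y (B ((S.A ^^ n) x)))"
      using x y by (subst T.sqrt_series_ip)
        (simp_all add: sqrt_form_def powB bop_mem[OF B] del: minus_apply)
    also have "\<dots> = (\<Sum>n. of_real (sqrt_coeff n) * hip K (hadj K H B y) ((S.A ^^ n) x))"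
      using x y by (simp add: hip_hadj_left[OF S.H T.H B] del: minus_apply)
    also have "\<dots> = hip K (hadj K H B y) (sqrt_series K S x)"
      using x hadj_mem[OF S.H T.H B y] by (simp add: S.sqrt_series_ip sqrt_form_def)
    finally show "hip H y ((sqrt_series H T \<circ> B) x) = hip H y ((B \<circ> sqrt_series K S) x)"
      using x y by (simp add: hip_hadj_left[OF S.H T.H B])
  qed
qed

text \<open>For \<open>y = f x - g x\<close>, commutation gives \<open>f y + g y = 0\<close>. Both
  forms are nonnegative at \<open>y\<close>, so both vanish and \<open>f y = g y = 0\<close>; moving
  \<open>f\<close> and \<open>g\<close> across the inner product then shows that \<open>y\<close> is
  orthogonal to itself.\<close>

lemma commuting_positive_sqrt_unique:
  assumes H: "hilbert_space H" and f: "positive_op H f" and g: "positive_op H g"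
    and comm: "f \<circ> g = g \<circ> f" and sq: "f \<circ> f = g \<circ> g"
  shows "f = g"
proof (rule bop_eqI[OF positive_op_bop[OF f] positive_op_bop[OF g]])
  fix x
  assume x: "x \<in> hset H"
  note f' = positive_op_bop[OF f] and g' = positive_op_bop[OF g]
  note mem [simp] = bop_mem[OF f'] bop_mem[OF g']
  define y where "y = f x - g x"
  have y [simp]: "y \<in> hset H"
    using H x by (simp add: y_def)
  have "f y + g y = 0"
    using fun_cong[OF comm, of x] fun_cong[OF sq, of x] H x
    by (simp add: y_def bop_diff[OF H f'] bop_diff[OF H g'])
  then have "hip H y (f y) + hip H y (g y) = 0"
    using H hip_add_right[OF H y mem(1)[OF y] mem(2)[OF y]] by simp
  then have "Re (hip H y (f y)) + Re (hip H y (g y)) = 0"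
    by (metis plus_complex.sel(1) zero_complex.sel(1))
  with positive_op_Re[OF f y] positive_op_Re[OF g y]
  have z: "f y = 0" "g y = 0"
    by (auto intro!: positive_op_form_zero[OF H f y] positive_op_form_zero[OF H g y])
  have "hip H y y = hip H (f x - g x) y"
    by (simp only: y_def)
  also have "\<dots> = hip H x (f y) - hip H x (g y)"
    using H x by (simp add: positive_op_self_adjoint[OF H f y x] positive_op_self_adjoint[OF H g y x])
  finally have "hip H y y = 0"
    using H x by (simp add: z)
  then show "f x = g x"
    using hip_self_zero[OF H y] by (simp add: y_def)
qed

text \<open>Any competing root \<open>g\<close> commutes with \<open>T = g \<circ> g\<close>, hence
  with the series in \<open>T\<close>, and commuting positive roots coincide.\<close>

lemma op_sqrt_eq:
  assumes "positive_contraction H T"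
  shows "op_sqrt H T = sqrt_series H T"
proof -
  interpret positive_contraction H T by fact
  show ?thesis
    unfolding op_sqrt_def
  proof (rule the_equality)
    fix g
    assume "positive_op H g \<and> g \<circ> g = T"
    then have g: "positive_op H g" "g \<circ> g = T"
      by blast+
    have "T \<circ> g = g \<circ> T"
      unfolding g(2)[symmetric] by (simp only: comp_assoc)
    then have "sqrt_series H T \<circ> g = g \<circ> sqrt_series H T"
      by (rule sqrt_series_intertwine[OF assms assms positive_op_bop[OF g(1)]])
    then show "g = sqrt_series H T"
      by (intro commuting_positive_sqrt_unique[OF H g(1) sqrt_series_positive])
        (simp_all only: g(2) sqrt_series_square)
  qed (intro conjI sqrt_series_positive sqrt_series_square)
qed

lemma op_sqrt_intertwine:
  "positive_contraction H T \<Longrightarrow> positive_contraction K S \<Longrightarrow> B \<in> bop K H \<Longrightarrow> T \<circ> B = B \<circ> S \<Longrightarrow>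
    op_sqrt H T \<circ> B = B \<circ> op_sqrt K S"
  by (simp add: op_sqrt_eq sqrt_series_intertwine)

lemma op_sqrt_square: "positive_contraction H T \<Longrightarrow> op_sqrt H T \<circ> op_sqrt H T = T"
  by (simp add: op_sqrt_eq positive_contraction.sqrt_series_square)

section \<open>Closed subspaces and orthogonal sums\<close>

text \<open>Closed subspaces are always presented as orthogonal complements: they inherit
  completeness from continuity of the inner product, and membership is a system of
  equations.\<close>

definition orth_hspace :: "'v::complex_vector hspace \<Rightarrow> 'v set \<Rightarrow> 'v hspace" where
  "orth_hspace L N = L\<lparr>hset := {f \<in> hset L. \<forall>n\<in>N. hip L n f = 0}\<rparr>"

lemma hip_orth [simp]: "hip (orth_hspace L N) = hip L"
  and hnorm_orth [simp]: "hnorm (orth_hspace L N) = hnorm L"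
  and hset_orth: "hset (orth_hspace L N) = {f \<in> hset L. \<forall>n\<in>N. hip L n f = 0}"
  by (simp_all add: orth_hspace_def hnorm_def fun_eq_iff)

lemma orth_subset: "f \<in> hset (orth_hspace L N) \<Longrightarrow> f \<in> hset L"
  by (simp add: hset_orth)

lemma hilbert_orth [simp]:
  assumes L: "hilbert_space L" and N: "N \<subseteq> hset L"
  shows "hilbert_space (orth_hspace L N)"
proof -
  have N': "n \<in> hset L" if "n \<in> N" for n
    using N that by (rule subsetD)
  have sub: "module.subspace scaleC (hset (orth_hspace L N))"
    unfolding cvec.subspace_def using L N' by (simp add: hset_orth)
  have complete: "\<exists>x\<in>hset (orth_hspace L N). (\<lambda>n. hnorm L (X n - x)) \<longlonglongrightarrow> 0"
    if X: "\<forall>n. X n \<in> hset (orth_hspace L N)"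
      and cauchy: "\<forall>e>0. \<exists>M. \<forall>m\<ge>M. \<forall>n\<ge>M. hnorm L (X m - X n) < e" for X
  proof -
    have XL: "X n \<in> hset L" for n
      using X orth_subset by blast
    then have "(\<forall>n. X n \<in> hset L) \<and> (\<forall>e>0. \<exists>M. \<forall>m\<ge>M. \<forall>n\<ge>M. hnorm L (X m - X n) < e)"
      using cauchy by blast
    from hilbert_spaceD(6)[OF L, THEN spec, THEN mp, OF this]
    obtain x where x: "x \<in> hset L" "(\<lambda>n. hnorm L (X n - x)) \<longlonglongrightarrow> 0"
      by blast
    have "hip L n x = 0" if n: "n \<in> N" for n
    proof (rule LIMSEQ_unique)
      show "(\<lambda>k. hip L n (X k)) \<longlonglongrightarrow> hip L n x"
        by (rule hip_tendsto_right[OF L XL x(1) N'[OF n] x(2)])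
      show "(\<lambda>k. hip L n (X k)) \<longlonglongrightarrow> 0"
        using X n by (simp add: hset_orth)
    qed
    with x show ?thesis
      by (auto simp: hset_orth)
  qed
  show ?thesis
    unfolding hilbert_space_def hip_orth hnorm_orth
  proof (intro conjI sub)
    show "\<forall>X. (\<forall>n. X n \<in> hset (orth_hspace L N)) \<and>
        (\<forall>e>0. \<exists>M. \<forall>m\<ge>M. \<forall>n\<ge>M. hnorm L (X m - X n) < e) \<longrightarrow>
        (\<exists>x\<in>hset (orth_hspace L N). (\<lambda>n. hnorm L (X n - x)) \<longlonglongrightarrow> 0)"
      using complete by blast
    show "\<forall>x\<in>hset (orth_hspace L N). \<forall>y\<in>hset (orth_hspace L N). hip L y x = cnj (hip L x y)"
      using hip_cnj[OF L] orth_subset by blast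
  qed (use L hip_self_nonneg[OF L] hip_self_zero[OF L] orth_subset[of _ L N] in simp_all)
qed

definition inclusion_op :: "'v::complex_vector hspace \<Rightarrow> 'v \<Rightarrow> 'v" where
  "inclusion_op K = on_hset K (\<lambda>x. x)"

definition orth_proj :: "'v::complex_vector hspace \<Rightarrow> 'v set \<Rightarrow> 'v \<Rightarrow> 'v" where
  "orth_proj L N = hadj (orth_hspace L N) L (inclusion_op (orth_hspace L N))"

lemma restrict_op_bop:
  assumes L: "hilbert_space L" and N: "N \<subseteq> hset L" and L': "hilbert_space L'" and f: "f \<in> bop L L'"
    and maps: "\<And>x. x \<in> hset (orth_hspace L N) \<Longrightarrow> f x \<in> hset (orth_hspace L' N')"
  shows "on_hset (orth_hspace L N) f \<in> bop (orth_hspace L N) (orth_hspace L' N')"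
proof -
  obtain B where B: "B \<ge> 0" "\<And>x. x \<in> hset L \<Longrightarrow> hnorm L' (f x) \<le> B * hnorm L x"
    using bop_bound[OF L f] by blast
  show ?thesis
    by (rule bopI[where B = B])
      (use L N B f maps in \<open>simp_all add: on_hset_def orth_subset bop_add bop_scale\<close>)
qed

lemma inclusion_op_bop:
  "hilbert_space L \<Longrightarrow> N \<subseteq> hset L \<Longrightarrow> inclusion_op (orth_hspace L N) \<in> bop (orth_hspace L N) L"
  by (rule bopI[where B = 1]) (simp_all add: inclusion_op_def on_hset_def orth_subset)

lemma orth_proj_bop:
  "hilbert_space L \<Longrightarrow> N \<subseteq> hset L \<Longrightarrow> orth_proj L N \<in> bop L (orth_hspace L N)"
  unfolding orth_proj_def by (intro hadj_bop inclusion_op_bop) simp_all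

lemma hip_orth_proj:
  assumes "hilbert_space L" "N \<subseteq> hset L" "f \<in> hset L" "z \<in> hset (orth_hspace L N)"
  shows "hip L z (orth_proj L N f) = hip L z f"
  using hip_hadj_right[OF hilbert_orth[OF assms(1,2)] assms(1) inclusion_op_bop[OF assms(1,2)] assms(3,4)]
    assms(4)
  by (simp add: orth_proj_def inclusion_op_def on_hset_def)

definition compress_op :: "'v::complex_vector hspace \<Rightarrow> 'v set \<Rightarrow> ('v \<Rightarrow> 'v) \<Rightarrow> 'v \<Rightarrow> 'v" where
  "compress_op L N P = orth_proj L N \<circ> (P \<circ> inclusion_op (orth_hspace L N))"

lemma compress_op_bop:
  "hilbert_space L \<Longrightarrow> N \<subseteq> hset L \<Longrightarrow> P \<in> bop L L \<Longrightarrow>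
    compress_op L N P \<in> bop (orth_hspace L N) (orth_hspace L N)"
  unfolding compress_op_def
  by (rule bop_comp[OF _ _ bop_comp[OF _ _ inclusion_op_bop] orth_proj_bop]) simp_all

lemma hip_compress_op:
  assumes "hilbert_space L" "N \<subseteq> hset L" "P \<in> bop L L"
    "x \<in> hset (orth_hspace L N)" "z \<in> hset (orth_hspace L N)"
  shows "hip L z (compress_op L N P x) = hip L z (P x)"
  using assms hip_orth_proj[OF assms(1,2) bop_mem[OF assms(3) orth_subset[OF assms(4)]] assms(5)]
  by (simp add: compress_op_def inclusion_op_def on_hset_def)

text \<open>On the subspace the form of the compression at \<open>x\<close> is the squared norm of
  \<open>P x\<close>. The compression of a projection is in general no projection, which is why
  square roots genuinely matter for it.\<close>

lemma compress_projection_contraction: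
  assumes L: "hilbert_space L" and N: "N \<subseteq> hset L" and P: "P \<in> bop L L"
    and sa: "\<And>x y. x \<in> hset L \<Longrightarrow> y \<in> hset L \<Longrightarrow> hip L x (P y) = hip L (P x) y"
    and idem: "\<And>x. x \<in> hset L \<Longrightarrow> P (P x) = P x"
  shows "positive_contraction (orth_hspace L N) (compress_op L N P)"
proof -
  let ?K = "orth_hspace L N" and ?C = "compress_op L N P"
  note K = hilbert_orth[OF L N]
  have form: "hip L x (?C x) = of_real ((hnorm L (P x))\<^sup>2)" if x: "x \<in> hset ?K" for x
  proof -
    have "hip L x (?C x) = hip L x (P (P x))"
      using hip_compress_op[OF L N P x x] idem[OF orth_subset[OF x]] by simp
    also have "\<dots> = hip L (P x) (P x)"
      using x by (intro sa) (simp_all add: orth_subset bop_mem[OF P])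
    finally show ?thesis
      using hip_self[OF L bop_mem[OF P orth_subset[OF x]]] by simp
  qed
  have P_le: "hnorm L (P x) \<le> hnorm L x" if x: "x \<in> hset L" for x
  proof (rule square_le_mult_imp_le)
    have "hip L (P x) (P x) = hip L x (P x)"
      using sa[OF x bop_mem[OF P x]] idem[OF x] by simp
    then have "(hnorm L (P x))\<^sup>2 = Re (hip L x (P x))"
      using hip_self[OF L bop_mem[OF P x]] by (metis Re_complex_of_real)
    also have "\<dots> \<le> hnorm L x * hnorm L (P x)"
      using hip_cauchy_schwarz[OF L x bop_mem[OF P x]] complex_Re_le_cmod order_trans by blast
    finally show "hnorm L (P x) * hnorm L (P x) \<le> hnorm L x * hnorm L (P x)"
      by (simp add: power2_eq_square)
  qed (use L x bop_mem[OF P x] in simp_all)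
  have pos: "positive_op ?K ?C"
    unfolding positive_op_def using compress_op_bop[OF L N P] form by (simp del: of_real_power)
  show ?thesis
  proof
    show "contraction_op ?K ?C"
      unfolding contraction_op_def
    proof (intro conjI ballI compress_op_bop[OF L N P] positive_op_sub_id_bound[OF K pos])
      fix x
      assume x: "x \<in> hset ?K"
      then have "(hnorm L (P x))\<^sup>2 \<le> (hnorm L x)\<^sup>2"
        using P_le[OF orth_subset[OF x]] hnorm_nonneg[OF L bop_mem[OF P orth_subset[OF x]]]
        by (intro power_mono)
      then show "Re (hip ?K x (?C x)) \<le> (hnorm ?K x)\<^sup>2"
        using form[OF x] by simp
    qed
  qed (use K pos in simp_all)
qed

section \<open>Orthogonal sums of two spaces and diagonal operators\<close>

lemma hset_hsum [simp]: "hset (hsum H K) = hset H \<times> hset K"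
  and hip_hsum [simp]: "hip (hsum H K) p q = hip H (fst p) (fst q) + hip K (snd p) (snd q)"
  by (simp_all add: hsum_def)

lemma hnorm_hsum:
  "hilbert_space H \<Longrightarrow> hilbert_space K \<Longrightarrow> x \<in> hset H \<Longrightarrow> y \<in> hset K \<Longrightarrow>
    hnorm (hsum H K) (x, y) = sqrt ((hnorm H x)\<^sup>2 + (hnorm K y)\<^sup>2)"
  by (simp add: hnorm_def[of "hsum H K"] hip_self)

lemma diag_op_apply [simp]:
  "x \<in> hset H \<Longrightarrow> y \<in> hset K \<Longrightarrow> diag_op H K f g (x, y) = (f x, g y)"
  by (simp add: diag_op_def block_op_def on_hset_def)

lemma diag_op_inject:
  assumes "hilbert_space H" "hilbert_space K" "f \<in> bop H H" "f' \<in> bop H H" "g \<in> bop K K" "g' \<in> bop K K"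
    and eq: "diag_op H K f g = diag_op H K f' g'"
  shows "f = f' \<and> g = g'"
proof
  have "(f x, g y) = (f' x, g' y)" if "x \<in> hset H" "y \<in> hset K" for x y
    using fun_cong[OF eq, of "(x, y)"] that by simp
  then show "f = f'" "g = g'"
    using hs_zero[OF assms(1)] hs_zero[OF assms(2)]
    by (intro bop_eqI[OF assms(3,4)] bop_eqI[OF assms(5,6)]; blast)+
qed

text \<open>Testing on \<open>(x, 0)\<close> and \<open>(0, y)\<close> separates the two blocks, so
  that \<open>T\<close> and \<open>S\<close> can be treated individually.\<close>

lemma diag_op_positive_contraction:
  assumes H: "hilbert_space H" and K: "hilbert_space K" and f: "f \<in> bop H H" and g: "g \<in> bop K K"
  shows "positive_op (hsum H K) (diag_op H K f g) \<and> contraction_op (hsum H K) (diag_op H K f g) \<longleftrightarrow>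
    positive_contraction H f \<and> positive_contraction K g"
proof
  assume *: "positive_op (hsum H K) (diag_op H K f g) \<and> contraction_op (hsum H K) (diag_op H K f g)"
  have pos: "hip H x (f x) + hip K y (g y) \<in> \<real>\<^sub>\<ge>\<^sub>0" if "x \<in> hset H" "y \<in> hset K" for x y
    using * that unfolding positive_op_def by fastforce
  have contr: "(hnorm H (f x))\<^sup>2 + (hnorm K (g y))\<^sup>2 \<le> (hnorm H x)\<^sup>2 + (hnorm K y)\<^sup>2"
    if "x \<in> hset H" "y \<in> hset K" for x y
  proof -
    have "hnorm (hsum H K) (diag_op H K f g (x, y)) \<le> hnorm (hsum H K) (x, y)"
      using * that unfolding contraction_op_def by auto
    then show ?thesis
      using that H K f g by (simp add: hnorm_hsum bop_mem)
  qed
  have "hip H x (f x) \<in> \<real>\<^sub>\<ge>\<^sub>0" "hnorm H (f x) \<le> hnorm H x" if x: "x \<in> hset H" for x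
  proof -
    show "hip H x (f x) \<in> \<real>\<^sub>\<ge>\<^sub>0"
      using pos[OF x hs_zero[OF K]] K g by (simp add: bop_zero)
    have "(hnorm H (f x))\<^sup>2 \<le> (hnorm H x)\<^sup>2"
      using contr[OF x hs_zero[OF K]] K g by (simp add: bop_zero)
    then show "hnorm H (f x) \<le> hnorm H x"
      by (rule power2_le_imp_le) (use H x in simp)
  qed
  moreover have "hip K y (g y) \<in> \<real>\<^sub>\<ge>\<^sub>0" "hnorm K (g y) \<le> hnorm K y" if y: "y \<in> hset K" for y
  proof -
    show "hip K y (g y) \<in> \<real>\<^sub>\<ge>\<^sub>0"
      using pos[OF hs_zero[OF H] y] H f by (simp add: bop_zero)
    have "(hnorm K (g y))\<^sup>2 \<le> (hnorm K y)\<^sup>2"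
      using contr[OF hs_zero[OF H] y] H f by (simp add: bop_zero)
    then show "hnorm K (g y) \<le> hnorm K y"
      by (rule power2_le_imp_le) (use K y in simp)
  qed
  ultimately show "positive_contraction H f \<and> positive_contraction K g"
    using H K f g by (simp add: positive_contraction_def positive_op_def contraction_op_def)
next
  assume "positive_contraction H f \<and> positive_contraction K g"
  then interpret F: positive_contraction H f + G: positive_contraction K g
    by simp_all
  have norm_le: "hnorm (hsum H K) (diag_op H K f g p) \<le> hnorm (hsum H K) p"
    if mem: "p \<in> hset H \<times> hset K" for p
  proof -
    obtain x y where p: "p = (x, y)" and xy: "x \<in> hset H" "y \<in> hset K"
      using mem by auto
    have "hnorm H (f x) \<le> hnorm H x" "hnorm K (g y) \<le> hnorm K y"
      using F.contr G.contr xy by (auto simp: contraction_op_def)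
    then have "(hnorm H (f x))\<^sup>2 + (hnorm K (g y))\<^sup>2 \<le> (hnorm H x)\<^sup>2 + (hnorm K y)\<^sup>2"
      using xy H K f g by (intro add_mono power_mono) (simp_all add: bop_mem)
    then show ?thesis
      using xy H K f g by (simp add: p hnorm_hsum bop_mem)
  qed
  have bop: "diag_op H K f g \<in> bop (hsum H K) (hsum H K)"
  proof (rule bopI[where B = 1])
    show "diag_op H K f g p = 0" if "p \<notin> hset (hsum H K)" for p
      using that by (simp add: diag_op_def block_op_def on_hset_def)
  qed (use norm_le f g H K in \<open>auto simp: bop_mem bop_add bop_scale scaleC_prod_def\<close>)
  show "positive_op (hsum H K) (diag_op H K f g) \<and> contraction_op (hsum H K) (diag_op H K f g)"
    unfolding positive_op_def contraction_op_def
    using bop norm_le positive_op_nonneg[OF F.pos] positive_op_nonneg[OF G.pos]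
    by (auto intro: nonneg_Reals_add_I)
qed

section \<open>Compressing an ambient dilation\<close>

text \<open>The ambient data split the dilation of \<open>\<phi>\<^sub>2\<close> by commuting projections \<open>P\<^sub>1\<close>, \<open>P\<^sub>2\<close> onto a dilation of
  \<open>\<phi>\<^sub>1\<close> whose \<open>L\<^sub>2\<close> part contains the range of \<open>W\<close>.\<close>

locale ambient_dilation = hilbert_module act ip
  for act :: "'e::complex_banach \<Rightarrow> 'a::cstar_algebra_1 \<Rightarrow> 'e" and ip :: "'e \<Rightarrow> 'e \<Rightarrow> 'a" +
  fixes H1 :: "'h1::complex_vector hspace" and H2 :: "'h2::complex_vector hspace"
    and L1 :: "'k1::complex_vector hspace" and L2 :: "'k2::complex_vector hspace"
    and \<phi>1 \<phi>2 :: "'a \<Rightarrow> 'h1 \<Rightarrow> 'h1" and \<Phi> :: "'e \<Rightarrow> 'h1 \<Rightarrow> 'h2"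
    and \<rho> :: "'a \<Rightarrow> 'k1 \<Rightarrow> 'k1" and \<Psi> :: "'e \<Rightarrow> 'k1 \<Rightarrow> 'k2"
    and V :: "'h1 \<Rightarrow> 'k1" and W :: "'h2 \<Rightarrow> 'k2"
    and P1 :: "'k1 \<Rightarrow> 'k1" and P2 :: "'k2 \<Rightarrow> 'k2"
  assumes full: "full_module ip"
    and hilbert [simp]: "hilbert_space H1" "hilbert_space H2" "hilbert_space L1" "hilbert_space L2"
    and rep: "unital_star_rep L1 \<rho>"
    and rep_norm: "\<And>a x. x \<in> hset L1 \<Longrightarrow> hnorm L1 (\<rho> a x) \<le> norm a * hnorm L1 x"
    and repmap: "rep_map ip L1 L2 \<rho> \<Psi>"
    and \<Psi>_act: "\<And>x a k. k \<in> hset L1 \<Longrightarrow> \<Psi> (act x a) k = \<Psi> x (\<rho> a k)"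
    and V: "V \<in> bop H1 L1" and W: "W \<in> bop H2 L2" and P1: "P1 \<in> bop L1 L1" and P2: "P2 \<in> bop L2 L2"
    and P1_sa: "\<And>x y. x \<in> hset L1 \<Longrightarrow> y \<in> hset L1 \<Longrightarrow> hip L1 x (P1 y) = hip L1 (P1 x) y"
    and P2_sa: "\<And>x y. x \<in> hset L2 \<Longrightarrow> y \<in> hset L2 \<Longrightarrow> hip L2 x (P2 y) = hip L2 (P2 x) y"
    and P1_idem: "\<And>x. x \<in> hset L1 \<Longrightarrow> P1 (P1 x) = P1 x"
    and P2_idem: "\<And>x. x \<in> hset L2 \<Longrightarrow> P2 (P2 x) = P2 x"
    and P\<Psi>: "\<And>x k. k \<in> hset L1 \<Longrightarrow> P2 (\<Psi> x k) = \<Psi> x (P1 k)"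
    and P\<rho>: "\<And>a k. k \<in> hset L1 \<Longrightarrow> P1 (\<rho> a k) = \<rho> a (P1 k)"
    and PW: "\<And>g. g \<in> hset H2 \<Longrightarrow> P2 (W g) = W g"
    and \<phi>2_bop: "\<And>a. \<phi>2 a \<in> bop H1 H1" and \<phi>1_bop: "\<And>a. \<phi>1 a \<in> bop H1 H1"
    and \<Phi>_bop: "\<And>x. \<Phi> x \<in> bop H1 H2"
    and \<phi>2: "\<And>a h k. h \<in> hset H1 \<Longrightarrow> k \<in> hset H1 \<Longrightarrow> hip L1 (V h) (\<rho> a (V k)) = hip H1 h (\<phi>2 a k)"
    and \<phi>1: "\<And>a h k. h \<in> hset H1 \<Longrightarrow> k \<in> hset H1 \<Longrightarrow> hip L1 (V h) (P1 (\<rho> a (V k))) = hip H1 h (\<phi>1 a k)"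
    and \<Phi>: "\<And>x g h. g \<in> hset H2 \<Longrightarrow> h \<in> hset H1 \<Longrightarrow> hip L2 (W g) (\<Psi> x (V h)) = hip H2 g (\<Phi> x h)"
    and total: "\<And>f. f \<in> hset L1 \<Longrightarrow> P1 f = f \<Longrightarrow>
      (\<And>a h. h \<in> hset H1 \<Longrightarrow> hip L1 (\<rho> a (V h)) f = 0) \<Longrightarrow> f = 0"
begin

lemma \<rho>_bop: "\<rho> a \<in> bop L1 L1"
  using rep unfolding unital_star_rep_def by blast

lemma \<rho>_lin: "\<rho> (a + b) = \<rho> a + \<rho> b" "\<rho> (c *\<^sub>C a) = c *\<^sub>C \<rho> a"
  using rep unfolding unital_star_rep_def clinear_iff by simp_all

lemma \<rho>_mult: "\<rho> (a * b) k = \<rho> a (\<rho> b k)"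
  using rep unfolding unital_star_rep_def by simp

lemma \<rho>_one: "k \<in> hset L1 \<Longrightarrow> \<rho> 1 k = k"
  using rep unfolding unital_star_rep_def by simp

lemma \<Psi>_bop: "\<Psi> x \<in> bop L1 L2"
  using repmap unfolding rep_map_def by blast

lemma \<Psi>_lin: "\<Psi> (x + y) = \<Psi> x + \<Psi> y" "\<Psi> (c *\<^sub>C x) = c *\<^sub>C \<Psi> x"
  using repmap unfolding rep_map_def clinear_iff by simp_all

lemma mem [simp]:
  "k \<in> hset L1 \<Longrightarrow> \<rho> a k \<in> hset L1" "k \<in> hset L1 \<Longrightarrow> \<Psi> x k \<in> hset L2"
  "h \<in> hset H1 \<Longrightarrow> V h \<in> hset L1" "g \<in> hset H2 \<Longrightarrow> W g \<in> hset L2"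
  "k \<in> hset L1 \<Longrightarrow> P1 k \<in> hset L1" "l \<in> hset L2 \<Longrightarrow> P2 l \<in> hset L2"
  "h \<in> hset H1 \<Longrightarrow> \<phi>1 a h \<in> hset H1" "h \<in> hset H1 \<Longrightarrow> \<phi>2 a h \<in> hset H1" "h \<in> hset H1 \<Longrightarrow> \<Phi> x h \<in> hset H2"
  using bop_mem[OF \<rho>_bop] bop_mem[OF \<Psi>_bop] bop_mem[OF V] bop_mem[OF W] bop_mem[OF P1] bop_mem[OF P2]
    bop_mem[OF \<phi>1_bop] bop_mem[OF \<phi>2_bop] bop_mem[OF \<Phi>_bop]
  by simp_all

abbreviation "\<Psi>s x \<equiv> hadj L1 L2 (\<Psi> x)"

lemma \<Psi>s_mem [simp]: "l \<in> hset L2 \<Longrightarrow> \<Psi>s x l \<in> hset L1"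
  by (simp add: hadj_mem[OF _ _ \<Psi>_bop])

lemma ip_\<Psi>s_right: "l \<in> hset L2 \<Longrightarrow> k \<in> hset L1 \<Longrightarrow> hip L1 k (\<Psi>s x l) = hip L2 (\<Psi> x k) l"
  and ip_\<Psi>s_left: "l \<in> hset L2 \<Longrightarrow> k \<in> hset L1 \<Longrightarrow> hip L1 (\<Psi>s x l) k = hip L2 l (\<Psi> x k)"
  by (simp_all add: hip_hadj_right[OF _ _ \<Psi>_bop] hip_hadj_left[OF _ _ \<Psi>_bop])

lemma \<Psi>s_\<Psi>: "\<Psi>s x (\<Psi> y k) = \<rho> (ip x y) k"
proof -
  have "\<Psi>s x \<circ> \<Psi> y = \<rho> (ip x y)"
    using repmap unfolding rep_map_def by blast
  from fun_cong[OF this, of k] show ?thesis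
    by simp
qed

lemma ip_\<rho>_star: "k \<in> hset L1 \<Longrightarrow> l \<in> hset L1 \<Longrightarrow> hip L1 k (\<rho> (star a) l) = hip L1 (\<rho> a k) l"
proof -
  assume "k \<in> hset L1" "l \<in> hset L1"
  moreover have "\<rho> (star a) = hadj L1 L1 (\<rho> a)"
    using rep unfolding unital_star_rep_def by blast
  ultimately show ?thesis
    by (simp add: hip_hadj_right[OF _ _ \<rho>_bop])
qed

lemma ip_\<rho>: "k \<in> hset L1 \<Longrightarrow> l \<in> hset L1 \<Longrightarrow> hip L1 k (\<rho> a l) = hip L1 (\<rho> (star a) k) l"
  using ip_\<rho>_star[of k l "star a"] by (simp add: star_star)

section \<open>The generated subspaces of the ambient spaces\<close>

definition N1 :: "'k1 set" where
  "N1 = {n \<in> hset L1. (\<forall>a. \<forall>h\<in>hset H1. hip L1 (\<rho> a (V h)) n = 0) \<and>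
    (\<forall>x. \<forall>g\<in>hset H2. hip L2 (W g) (\<Psi> x n) = 0)}"

abbreviation "K1 \<equiv> orth_hspace L1 N1"

text \<open>\<open>N1\<close> consists of the vectors orthogonal to all
  \<open>\<rho> a (V h)\<close> and all \<open>\<Psi>s x (W g)\<close>, so \<open>K1\<close> is the
  closed subspace generated by these. \<open>K2\<close> is generated by the images of
  \<open>K1\<close> under \<Psi>, which makes nondegeneracy automatic.\<close>

definition N2 :: "'k2 set" where
  "N2 = {n \<in> hset L2. \<forall>x. \<forall>k\<in>hset K1. hip L2 (\<Psi> x k) n = 0}"

abbreviation "K2 \<equiv> orth_hspace L2 N2"

lemma N1_sub: "N1 \<subseteq> hset L1" and N2_sub: "N2 \<subseteq> hset L2"
  by (auto simp: N1_def N2_def)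

lemma N1D: "n \<in> N1 \<Longrightarrow> n \<in> hset L1" and N2D: "m \<in> N2 \<Longrightarrow> m \<in> hset L2"
  by (simp_all add: N1_def N2_def)

lemma K_hilbert [simp]: "hilbert_space K1" "hilbert_space K2"
  by (simp_all add: N1_sub N2_sub)

lemma K1D: "k \<in> hset K1 \<Longrightarrow> k \<in> hset L1" and K2D: "l \<in> hset K2 \<Longrightarrow> l \<in> hset L2"
  by (simp_all add: hset_orth)

lemma K1_orth: "k \<in> hset K1 \<Longrightarrow> n \<in> N1 \<Longrightarrow> hip L1 n k = 0"
  and K2_orth: "l \<in> hset K2 \<Longrightarrow> m \<in> N2 \<Longrightarrow> hip L2 m l = 0"
  by (simp_all add: hset_orth)

lemma zero_left: "x \<in> hset L1 \<Longrightarrow> y \<in> hset L1 \<Longrightarrow> hip L1 x y = 0 \<Longrightarrow> hip L1 y x = 0"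
  using hip_cnj[of L1 x y] by simp

lemma zero_left2: "x \<in> hset L2 \<Longrightarrow> y \<in> hset L2 \<Longrightarrow> hip L2 x y = 0 \<Longrightarrow> hip L2 y x = 0"
  using hip_cnj[of L2 x y] by simp

lemma V_K1 [simp]: "h \<in> hset H1 \<Longrightarrow> V h \<in> hset K1"
proof -
  assume h: "h \<in> hset H1"
  have "hip L1 n (V h) = 0" if n: "n \<in> N1" for n
  proof (rule zero_left)
    have "hip L1 (\<rho> 1 (V h)) n = 0"
      using n h unfolding N1_def by blast
    then show "hip L1 (V h) n = 0"
      using h by (simp add: \<rho>_one)
  qed (use h N1D[OF n] in simp_all)
  then show ?thesis
    using h by (simp add: hset_orth)
qed

text \<open>Moving \<open>\<rho> a\<close> to the left turns one orbit vector into another, and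
  \<open>\<Psi> x (\<rho> a n)\<close> is \<open>\<Psi> (act x a) n\<close>. Since
  \<open>\<rho>(A)\<close> is closed under adjoints, \<open>K1\<close> is then invariant as
  well.\<close>

lemma N1_\<rho>: "n \<in> N1 \<Longrightarrow> \<rho> a n \<in> N1"
proof -
  assume n: "n \<in> N1"
  note nL = N1D[OF n]
  have "hip L1 (\<rho> b (V h)) (\<rho> a n) = 0" if h: "h \<in> hset H1" for b h
    using n h nL ip_\<rho>[of "\<rho> b (V h)" n a] unfolding N1_def
    by (simp flip: \<rho>_mult)
  moreover have "hip L2 (W g) (\<Psi> x (\<rho> a n)) = 0" if g: "g \<in> hset H2" for x g
    using n g nL unfolding N1_def by (simp flip: \<Psi>_act)
  ultimately show ?thesis
    using nL by (simp add: N1_def)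
qed

lemma \<rho>_K1 [simp]: "k \<in> hset K1 \<Longrightarrow> \<rho> a k \<in> hset K1"
proof -
  assume k: "k \<in> hset K1"
  have "hip L1 n (\<rho> a k) = 0" if n: "n \<in> N1" for n
    using K1_orth[OF k N1_\<rho>[OF n]] N1D[OF n] K1D[OF k] by (simp add: ip_\<rho>)
  then show ?thesis
    using K1D[OF k] by (simp add: hset_orth)
qed

lemma \<Psi>_K [simp]: "k \<in> hset K1 \<Longrightarrow> \<Psi> x k \<in> hset K2"
proof -
  assume k: "k \<in> hset K1"
  have "hip L2 n (\<Psi> x k) = 0" if n: "n \<in> N2" for n
    by (rule zero_left2) (use n k K1D[OF k] N2D[OF n] in \<open>auto simp: N2_def\<close>)
  then show ?thesis
    using K1D[OF k] by (simp add: hset_orth)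
qed

text \<open>Together with \<open>\<Psi>_K\<close>, the operator \<open>\<Psi> x\<close> respects
  both the chosen subspaces and their complements. Therefore its adjoint maps \<open>K2\<close> into
  \<open>K1\<close>, and restricting commutes with taking adjoints.\<close>

lemma \<Psi>_N: "n \<in> N1 \<Longrightarrow> \<Psi> x n \<in> N2"
proof -
  assume n: "n \<in> N1"
  note nL = N1D[OF n]
  have "hip L2 (\<Psi> y k) (\<Psi> x n) = 0" if k: "k \<in> hset K1" for y k
  proof -
    have "hip L2 (\<Psi> y k) (\<Psi> x n) = hip L1 k (\<rho> (ip y x) n)"
      using nL K1D[OF k] by (simp add: ip_\<Psi>s_right flip: \<Psi>s_\<Psi>)
    then show ?thesis
      using zero_left[OF _ _ K1_orth[OF k N1_\<rho>[OF n]]] nL K1D[OF k] by simp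
  qed
  then show ?thesis
    using nL by (simp add: N2_def)
qed

lemma \<Psi>s_K [simp]: "l \<in> hset K2 \<Longrightarrow> \<Psi>s x l \<in> hset K1"
proof -
  assume l: "l \<in> hset K2"
  have "hip L1 n (\<Psi>s x l) = 0" if n: "n \<in> N1" for n
    using K2_orth[OF l \<Psi>_N[OF n]] N1D[OF n] K2D[OF l] by (simp add: ip_\<Psi>s_right)
  then show ?thesis
    using K2D[OF l] by (simp add: hset_orth)
qed

lemma \<Psi>sW_K1 [simp]: "g \<in> hset H2 \<Longrightarrow> \<Psi>s x (W g) \<in> hset K1"
proof -
  assume g: "g \<in> hset H2"
  have "hip L1 n (\<Psi>s x (W g)) = 0" if n: "n \<in> N1" for n
    by (rule zero_left) (use g n N1D[OF n] in \<open>simp_all add: ip_\<Psi>s_left N1_def\<close>)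
  then show ?thesis
    using g by (simp add: hset_orth)
qed

lemma K1_eq_zeroI:
  assumes k: "k \<in> hset K1"
    and "\<And>a h. h \<in> hset H1 \<Longrightarrow> hip L1 (\<rho> a (V h)) k = 0"
    and "\<And>x g. g \<in> hset H2 \<Longrightarrow> hip L1 (\<Psi>s x (W g)) k = 0"
  shows "k = 0"
proof -
  have "k \<in> N1"
    using assms K1D[OF k] by (simp add: N1_def ip_\<Psi>s_left)
  then show ?thesis
    using K1_orth[OF k] hip_self_zero[OF hilbert(3) K1D[OF k]] by simp
qed

section \<open>The restricted dilation pair\<close>

definition \<rho>' :: "'a \<Rightarrow> 'k1 \<Rightarrow> 'k1" where "\<rho>' a = on_hset K1 (\<rho> a)"
definition \<Psi>' :: "'e \<Rightarrow> 'k1 \<Rightarrow> 'k2" where "\<Psi>' x = on_hset K1 (\<Psi> x)"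
text \<open>\<open>V\<close> already takes values in \<open>K1\<close>, but \<open>W g\<close> may
  leave \<open>K2\<close>. Projecting it does not change its pairings with vectors of
  \<open>K2\<close>, and only these enter the dilation equation.\<close>

definition W' :: "'h2 \<Rightarrow> 'k2" where "W' = orth_proj L2 N2 \<circ> W"

lemma \<rho>'_apply [simp]: "k \<in> hset K1 \<Longrightarrow> \<rho>' a k = \<rho> a k"
  and \<Psi>'_apply [simp]: "k \<in> hset K1 \<Longrightarrow> \<Psi>' x k = \<Psi> x k"
  by (simp_all add: \<rho>'_def \<Psi>'_def on_hset_def)

lemma \<rho>'_bop: "\<rho>' a \<in> bop K1 K1"
  unfolding \<rho>'_def using N1_sub by (intro restrict_op_bop \<rho>_bop) simp_all

lemma \<Psi>'_bop: "\<Psi>' x \<in> bop K1 K2"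
  unfolding \<Psi>'_def using N1_sub by (intro restrict_op_bop \<Psi>_bop) simp_all

lemma V_bop: "V \<in> bop H1 K1"
proof -
  obtain B where "B \<ge> 0" "\<And>x. x \<in> hset H1 \<Longrightarrow> hnorm L1 (V x) \<le> B * hnorm H1 x"
    using bop_bound[OF hilbert(1) V] by blast
  then show ?thesis
    by (intro bopI[where B = B]) (simp_all add: bop_outside[OF V] bop_add[OF V] bop_scale[OF V])
qed

lemma W'_bop: "W' \<in> bop H2 K2"
  unfolding W'_def by (rule bop_comp[OF _ _ W orth_proj_bop]) (simp_all add: N2_sub)

lemma W'_mem: "g \<in> hset H2 \<Longrightarrow> W' g \<in> hset K2"
  using W'_bop by (rule bop_mem)

lemma ip_W': "g \<in> hset H2 \<Longrightarrow> l \<in> hset K2 \<Longrightarrow> hip L2 (W' g) l = hip L2 (W g) l"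
  using hip_orth_proj[OF hilbert(4) N2_sub, of "W g" l] K2D[OF W'_mem, of g] K2D[of l]
    hip_cnj[of L2 l "W' g"] hip_cnj[of L2 l "W g"]
  by (simp add: W'_def)

lemma \<rho>'_rep: "unital_star_rep K1 \<rho>'"
  unfolding unital_star_rep_def
proof (intro conjI allI)
  show "range \<rho>' \<subseteq> bop K1 K1"
    using \<rho>'_bop by blast
  show "Vector_Spaces.linear scaleC scaleC \<rho>'"
    unfolding clinear_iff by (simp add: \<rho>'_def on_hset_def \<rho>_lin fun_eq_iff)
  show "\<rho>' (a * b) = \<rho>' a \<circ> \<rho>' b" for a b
    by (rule bop_eqI[OF \<rho>'_bop bop_comp[OF _ _ \<rho>'_bop \<rho>'_bop]]) (simp_all add: \<rho>_mult)
  show "\<rho>' (star a) = hadj K1 K1 (\<rho>' a)" for a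
    by (rule hadj_eqI[OF _ \<rho>'_bop, symmetric]) (simp_all add: ip_\<rho>_star K1D)
  show "\<rho>' 1 = id_op K1"
    by (rule bop_eqI[OF \<rho>'_bop id_op_bop]) (simp_all add: \<rho>_one K1D)
qed

lemma hadj_\<Psi>': "l \<in> hset K2 \<Longrightarrow> hadj K1 K2 (\<Psi>' x) l = \<Psi>s x l"
  by (rule hadj_unique) (simp_all add: ip_\<Psi>s_right K1D K2D)

lemma \<Psi>'_rep_map: "rep_map ip K1 K2 \<rho>' \<Psi>'"
  unfolding rep_map_def
proof (intro conjI allI)
  show "range \<Psi>' \<subseteq> bop K1 K2"
    using \<Psi>'_bop by blast
  show "Vector_Spaces.linear scaleC scaleC \<Psi>'"
    unfolding clinear_iff by (simp add: \<Psi>'_def on_hset_def \<Psi>_lin fun_eq_iff)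
  show "hadj K1 K2 (\<Psi>' x) \<circ> \<Psi>' y = \<rho>' (ip x y)" for x y
    by (rule bop_eqI[OF bop_comp[OF _ _ \<Psi>'_bop hadj_bop[OF _ _ \<Psi>'_bop]] \<rho>'_bop])
      (simp_all add: hadj_\<Psi>' \<Psi>s_\<Psi>)
qed

lemma \<Psi>'_nondegenerate: "nondegenerate K1 K2 \<Psi>'"
  unfolding nondegenerate_def
proof (rule hclosed_span_total)
  show "{\<Psi>' x k |x k. k \<in> hset K1} \<subseteq> hset K2"
    by auto
  fix f
  assume f: "f \<in> hset K2" and orth: "\<And>m. m \<in> {\<Psi>' x k |x k. k \<in> hset K1} \<Longrightarrow> hip K2 m f = 0"
  have "hip L2 (\<Psi> x k) f = 0" if "k \<in> hset K1" for x k
  proof -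
    have "hip K2 (\<Psi>' x k) f = 0"
      by (rule orth) (use that in blast)
    with that show ?thesis
      by simp
  qed
  then have "f \<in> N2"
    using K2D[OF f] by (simp add: N2_def)
  then show "f = 0"
    using K2_orth[OF f] hip_self_zero[OF hilbert(4) K2D[OF f]] by simp
qed simp

lemma dilation: "dilation_pair ip H1 H2 (\<phi>2, \<Phi>) (\<rho>', K1, V) (\<Psi>', K2, W')"
  unfolding dilation_pair_def prod.case
proof (intro conjI allI)
  show "\<Phi> x = hadj H2 K2 W' \<circ> \<Psi>' x \<circ> V" for x
  proof (rule bop_eq_ipI[OF hilbert(2) \<Phi>_bop])
    show "hadj H2 K2 W' \<circ> \<Psi>' x \<circ> V \<in> bop H1 H2"
      by (intro bop_comp[OF _ K_hilbert(1) V_bop] bop_comp[OF _ K_hilbert(2) \<Psi>'_bop] hadj_bop W'_bop) simp_all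
    show "hip H2 g (\<Phi> x h) = hip H2 g ((hadj H2 K2 W' \<circ> \<Psi>' x \<circ> V) h)"
      if "h \<in> hset H1" "g \<in> hset H2" for h g
      using that by (simp add: hip_hadj_right[OF _ _ W'_bop] ip_W' \<Phi>)
  qed
  show "\<phi>2 a = hadj H1 K1 V \<circ> \<rho>' a \<circ> V" for a
  proof (rule bop_eq_ipI[OF hilbert(1) \<phi>2_bop])
    show "hadj H1 K1 V \<circ> \<rho>' a \<circ> V \<in> bop H1 H1"
      by (intro bop_comp[OF _ K_hilbert(1) V_bop] bop_comp[OF _ K_hilbert(1) \<rho>'_bop] hadj_bop V_bop) simp_all
    show "hip H1 g (\<phi>2 a h) = hip H1 g ((hadj H1 K1 V \<circ> \<rho>' a \<circ> V) h)"
      if "h \<in> hset H1" "g \<in> hset H1" for h g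
      using that by (simp add: hip_hadj_right[OF _ _ V_bop] \<phi>2)
  qed
qed (simp_all add: \<rho>'_rep \<Psi>'_rep_map V_bop W'_bop)

section \<open>Compressed projections as a solution\<close>

definition S0 :: "'k1 \<Rightarrow> 'k1" where "S0 = compress_op L1 N1 P1"
definition T0 :: "'k2 \<Rightarrow> 'k2" where "T0 = compress_op L2 N2 P2"

lemma S0_contr: "positive_contraction K1 S0" and T0_contr: "positive_contraction K2 T0"
  unfolding S0_def T0_def
  by (intro compress_projection_contraction N1_sub N2_sub P1 P2 P1_sa P2_sa P1_idem P2_idem; simp)+

lemma S0_bop: "S0 \<in> bop K1 K1" and T0_bop: "T0 \<in> bop K2 K2"
  using S0_contr T0_contr by (simp_all add: positive_contraction.T_bop)

lemma ip_S0: "k \<in> hset K1 \<Longrightarrow> z \<in> hset K1 \<Longrightarrow> hip L1 z (S0 k) = hip L1 z (P1 k)"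
  and ip_T0: "l \<in> hset K2 \<Longrightarrow> w \<in> hset K2 \<Longrightarrow> hip L2 w (T0 l) = hip L2 w (P2 l)"
  by (simp_all add: S0_def T0_def hip_compress_op N1_sub N2_sub P1 P2)

text \<open>Pairing with \<open>z\<close> in \<open>K2\<close> only tests \<open>P1 k\<close>
  against \<open>\<Psi>s x z\<close>, which lies in \<open>K1\<close>; there \<open>P1\<close> and
  its compression have the same pairings.\<close>

lemma T0_\<Psi>: "k \<in> hset K1 \<Longrightarrow> T0 (\<Psi> x k) = \<Psi> x (S0 k)"
proof (rule hip_eqI[OF K_hilbert(2)])
  assume k: "k \<in> hset K1"
  note S0k = bop_mem[OF S0_bop k]
  show "T0 (\<Psi> x k) \<in> hset K2" "\<Psi> x (S0 k) \<in> hset K2"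
    using k S0k by (simp_all add: bop_mem[OF T0_bop])
  fix z
  assume z: "z \<in> hset K2"
  have "hip L2 z (T0 (\<Psi> x k)) = hip L1 (\<Psi>s x z) (P1 k)"
    using k z by (simp add: ip_T0 P\<Psi> K1D K2D ip_\<Psi>s_left)
  also have "\<dots> = hip L2 z (\<Psi> x (S0 k))"
    using k z S0k by (simp add: ip_S0[symmetric] K1D K2D ip_\<Psi>s_left)
  finally show "hip K2 z (T0 (\<Psi> x k)) = hip K2 z (\<Psi> x (S0 k))"
    by simp
qed

text \<open>The conditions of the theorem with operator equations replaced by matrix coefficients
  and with the square roots merged into \<open>S\<close>; \<open>derivative_pair_iff\<close>
  translates back.\<close>

definition derivative_pair :: "('k2 \<Rightarrow> 'k2) \<Rightarrow> ('k1 \<Rightarrow> 'k1) \<Rightarrow> bool" where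
  "derivative_pair T S \<longleftrightarrow> positive_contraction K2 T \<and> positive_contraction K1 S \<and>
    (\<forall>x. \<forall>k\<in>hset K1. T (\<Psi> x k) = \<Psi> x (S k)) \<and>
    (\<forall>a. \<forall>h\<in>hset H1. \<forall>k\<in>hset H1. hip L1 (V h) (S (\<rho> a (V k))) = hip H1 h (\<phi>1 a k)) \<and>
    (\<forall>x. \<forall>g\<in>hset H2. \<forall>h\<in>hset H1. hip L2 (W g) (\<Psi> x (S (V h))) = hip H2 g (\<Phi> x h))"

lemma derivative_pair_T0_S0: "derivative_pair T0 S0"
  unfolding derivative_pair_def
proof (intro conjI allI ballI S0_contr T0_contr T0_\<Psi>)
  show "hip L1 (V h) (S0 (\<rho> a (V k))) = hip H1 h (\<phi>1 a k)" if "h \<in> hset H1" "k \<in> hset H1" for a h k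
    using that by (simp add: ip_S0 \<phi>1)
  fix x g h
  assume g: "g \<in> hset H2" and h: "h \<in> hset H1"
  have "hip L2 (W g) (\<Psi> x (S0 (V h))) = hip L1 (\<Psi>s x (W g)) (S0 (V h))"
    using g h by (simp add: ip_\<Psi>s_left K1D bop_mem[OF S0_bop])
  also have "\<dots> = hip L2 (W g) (P2 (\<Psi> x (V h)))"
    using g h by (simp add: ip_S0 ip_\<Psi>s_left P\<Psi>)
  \<comment> \<open>\<open>P2\<close> is moved onto \<open>W g\<close>, which it fixes. Placing the
    range of \<open>W\<close> in the first summand pays off here: passing through \<open>S0\<close>
    does not shrink \<Phi>.\<close>
  also have "\<dots> = hip L2 (W g) (\<Psi> x (V h))"
    using g h by (simp add: P2_sa PW)
  finally show "hip L2 (W g) (\<Psi> x (S0 (V h))) = hip H2 g (\<Phi> x h)"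
    using g h by (simp add: \<Phi>)
qed

section \<open>Rigidity of an arbitrary solution\<close>

context
  fixes T :: "'k2 \<Rightarrow> 'k2" and S :: "'k1 \<Rightarrow> 'k1"
  assumes TS: "derivative_pair T S"
begin

lemma T_contr: "positive_contraction K2 T" and S_contr: "positive_contraction K1 S"
  and T_\<Psi>: "k \<in> hset K1 \<Longrightarrow> T (\<Psi> x k) = \<Psi> x (S k)"
  and S_\<phi>1: "h \<in> hset H1 \<Longrightarrow> h' \<in> hset H1 \<Longrightarrow> hip L1 (V h) (S (\<rho> a (V h'))) = hip H1 h (\<phi>1 a h')"
  and S_\<Phi>: "g \<in> hset H2 \<Longrightarrow> h \<in> hset H1 \<Longrightarrow> hip L2 (W g) (\<Psi> x (S (V h))) = hip H2 g (\<Phi> x h)"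
  using TS unfolding derivative_pair_def by blast+

lemma S_bop: "S \<in> bop K1 K1"
  using S_contr by (rule positive_contraction.T_bop)

lemma S_mem [simp]: "k \<in> hset K1 \<Longrightarrow> S k \<in> hset K1"
  using S_bop by (rule bop_mem)

lemma S_sa: "k \<in> hset K1 \<Longrightarrow> z \<in> hset K1 \<Longrightarrow> hip L1 z (S k) = hip L1 (S z) k"
  using positive_op_self_adjoint[OF K_hilbert(1) positive_contraction.pos[OF S_contr], of k z] by simp

lemma T_sa: "k \<in> hset K2 \<Longrightarrow> z \<in> hset K2 \<Longrightarrow> hip L2 z (T k) = hip L2 (T z) k"
  using positive_op_self_adjoint[OF K_hilbert(2) positive_contraction.pos[OF T_contr], of k z] by simp

text \<open>\<open>\<rho> (ip x y)\<close> factors as \<open>\<Psi>s x\<close> after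
  \<open>\<Psi> y\<close>, and self-adjointness of \<open>T\<close> and \<open>S\<close> lets the
  pair be pushed through both factors.\<close>

lemma S_commutes_ip:
  assumes "k \<in> hset K1" "z \<in> hset K1"
  shows "hip L1 (S z) (\<rho> (ip x y) k) = hip L1 z (\<rho> (ip x y) (S k))"
proof -
  have "hip L1 (S z) (\<rho> (ip x y) k) = hip L2 (T (\<Psi> x z)) (\<Psi> y k)"
    using assms by (simp add: ip_\<Psi>s_right K1D T_\<Psi> flip: \<Psi>s_\<Psi>)
  also have "\<dots> = hip L2 (\<Psi> x z) (T (\<Psi> y k))"
    using assms by (intro T_sa[symmetric]) simp_all
  also have "\<dots> = hip L2 (\<Psi> x z) (\<Psi> y (S k))"
    using assms by (simp add: T_\<Psi>)
  also have "\<dots> = hip L1 z (\<rho> (ip x y) (S k))"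
    using assms by (simp add: ip_\<Psi>s_right K1D flip: \<Psi>s_\<Psi>)
  finally show ?thesis .
qed

lemma continuous_\<rho>_form:
  assumes "u \<in> hset L1" "v \<in> hset L1"
  shows "continuous_on UNIV (\<lambda>b. hip L1 u (\<rho> b v))"
proof (intro linear_continuous_on bounded_linear_intro[where K = "hnorm L1 u * hnorm L1 v"])
  fix a b :: 'a and r :: real
  show "hip L1 u (\<rho> (a + b) v) = hip L1 u (\<rho> a v) + hip L1 u (\<rho> b v)"
    using assms by (simp add: \<rho>_lin)
  show "hip L1 u (\<rho> (r *\<^sub>R a) v) = r *\<^sub>R hip L1 u (\<rho> a v)"
    using assms by (simp add: scaleR_scaleC \<rho>_lin scaleR_conv_of_real)
  have "cmod (hip L1 u (\<rho> a v)) \<le> hnorm L1 u * hnorm L1 (\<rho> a v)"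
    using assms by (intro hip_cauchy_schwarz) simp_all
  also have "\<dots> \<le> hnorm L1 u * (norm a * hnorm L1 v)"
    using assms rep_norm by (intro mult_left_mono) simp_all
  finally show "norm (hip L1 u (\<rho> a v)) \<le> norm a * (hnorm L1 u * hnorm L1 v)"
    by (simp add: mult_ac)
qed

text \<open>Fullness enters here: the elements \<open>b\<close> satisfying the identity form a
  closed subspace that contains every inner product \<open>ip x y\<close>.\<close>

lemma S_commutes:
  assumes "k \<in> hset K1" "z \<in> hset K1"
  shows "hip L1 (S z) (\<rho> b k) = hip L1 z (\<rho> b (S k))"
proof -
  define C where "C = {b. hip L1 (S z) (\<rho> b k) = hip L1 z (\<rho> b (S k))}"
  have "module.span scaleC {ip x y |x y. True} \<subseteq> C"
  proof (rule cvec.span_minimal)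
    show "{ip x y |x y. True} \<subseteq> C"
      using S_commutes_ip[OF assms] by (auto simp: C_def)
    have "\<rho> 0 v = 0" for v
      using \<rho>_lin(2)[of 0 0] by (simp add: fun_eq_iff)
    then show "module.subspace scaleC C"
      unfolding cvec.subspace_def C_def using assms by (simp add: \<rho>_lin K1D)
  qed
  moreover have "closed C"
    unfolding C_def using assms by (intro closed_Collect_eq continuous_\<rho>_form) (simp_all add: K1D)
  ultimately have "closure (module.span scaleC {ip x y |x y. True}) \<subseteq> C"
    by (rule closure_minimal)
  then show ?thesis
    using full unfolding full_module_def C_def by auto
qed

text \<open>By commutation every coefficient of \<open>S\<close> between orbit vectors reduces to
  one of the form \<open>V h\<close> against \<open>S (\<rho> c (V h'))\<close>, and
  \<open>\<phi>1\<close> prescribes those. The same reduction applies to \<open>P1\<close>.\<close>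

lemma ip_gen_S_gen:
  assumes "h \<in> hset H1" "h' \<in> hset H1"
  shows "hip L1 (\<rho> a (V h)) (S (\<rho> b (V h'))) = hip L1 (\<rho> a (V h)) (P1 (\<rho> b (V h')))"
proof -
  have "hip L1 (\<rho> a (V h)) (S (\<rho> b (V h'))) = hip L1 (S (V h)) (\<rho> (star a) (\<rho> b (V h')))"
    using assms S_commutes[of "\<rho> b (V h')" "V h" "star a"] by (simp add: ip_\<rho>_star K1D)
  also have "\<dots> = hip H1 h (\<phi>1 (star a * b) h')"
    using assms by (simp add: S_\<phi>1 flip: \<rho>_mult S_sa)
  also have "\<dots> = hip L1 (\<rho> a (V h)) (P1 (\<rho> b (V h')))"
    using assms by (simp add: P\<rho> ip_\<rho>_star \<rho>_mult flip: \<phi>1)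
  finally show ?thesis .
qed

text \<open>Both sides equal the coefficient of \<open>\<Phi> (act x b)\<close>: on the left through
  the equation for \<Phi>, on the right because \<open>P2\<close> fixes \<open>W g\<close>.\<close>

lemma ip_\<Psi>sW_S_gen:
  assumes "g \<in> hset H2" "h \<in> hset H1"
  shows "hip L1 (\<Psi>s x (W g)) (S (\<rho> b (V h))) = hip L1 (\<Psi>s x (W g)) (P1 (\<rho> b (V h)))"
proof -
  have "hip L1 (\<Psi>s x (W g)) (S (\<rho> b (V h))) = hip L2 (W g) (T (\<Psi> (act x b) (V h)))"
    using assms by (simp add: ip_\<Psi>s_left K1D T_\<Psi> \<Psi>_act)
  also have "\<dots> = hip H2 g (\<Phi> (act x b) h)"
    using assms by (simp add: T_\<Psi> S_\<Phi>)
  also have "\<dots> = hip L2 (P2 (W g)) (\<Psi> (act x b) (V h))"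
    using assms by (simp add: PW \<Phi>)
  also have "\<dots> = hip L1 (\<Psi>s x (W g)) (P1 (\<rho> b (V h)))"
    using assms by (simp add: ip_\<Psi>s_left \<Psi>_act P\<Psi> flip: P2_sa)
  finally show ?thesis .
qed

lemma span_gen_S:
  assumes e: "e \<in> module.span scaleC {\<rho> a (V h) |a h. h \<in> hset H1}"
  shows "e \<in> hset K1" "hip L1 e (S e) = hip L1 (P1 e) (P1 e)"
    "g \<in> hset H2 \<Longrightarrow> hip L1 (\<Psi>s x (W g)) (S e) = hip L1 (\<Psi>s x (W g)) (P1 e)"
proof -
  let ?G = "{\<rho> a (V h) |a h. h \<in> hset H1}"
  have G: "?G \<subseteq> hset K1"
    by auto
  have span_K1: "u \<in> hset K1" if "u \<in> module.span scaleC ?G" for u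
    using span_subset_hset[OF K_hilbert(1) G] that by (rule subsetD)
  note P1_lin = bop_add[OF P1 K1D K1D] bop_scale[OF P1 K1D] bop_zero[OF hilbert(3) P1]
  note S_lin = bop_add[OF S_bop] bop_scale[OF S_bop] bop_zero[OF K_hilbert(1) S_bop]
  have extend: "hip L1 z (S u) = hip L1 z (P1 u)" if z: "z \<in> hset K1"
    and zG: "\<And>b h. h \<in> hset H1 \<Longrightarrow> hip L1 z (S (\<rho> b (V h))) = hip L1 z (P1 (\<rho> b (V h)))"
    and u: "u \<in> module.span scaleC ?G" for z u
  proof -
    have "module.span scaleC ?G \<subseteq> {u \<in> hset K1. hip L1 z (S u) = hip L1 z (P1 u)}"
    proof (rule cvec.span_minimal)
      show "?G \<subseteq> {u \<in> hset K1. hip L1 z (S u) = hip L1 z (P1 u)}"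
        using zG by auto
      show "module.subspace scaleC {u \<in> hset K1. hip L1 z (S u) = hip L1 z (P1 u)}"
        unfolding cvec.subspace_def using z by (simp add: P1_lin S_lin K1D)
    qed
    with u show ?thesis
      by blast
  qed
  show eK: "e \<in> hset K1"
    using e by (rule span_K1)
  have "hip L1 e (S e) = hip L1 e (P1 e)"
  proof (rule extend[OF eK _ e])
    fix b h
    assume h: "h \<in> hset H1"
    \<comment> \<open>\<open>extend\<close> varies only the right argument. It is run first against
      orbit vectors; conjugation then yields its hypothesis for the left argument
      \<open>e\<close>.\<close>
    have sym: "hip L1 (\<rho> b (V h)) (S e) = hip L1 (\<rho> b (V h)) (P1 e)"
      by (rule extend[OF _ _ e]) (use h ip_gen_S_gen in auto)
    have "hip L1 e (S (\<rho> b (V h))) = cnj (hip L1 (\<rho> b (V h)) (S e))"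
      using h eK by (simp add: K1D S_sa flip: hip_cnj)
    also have "\<dots> = cnj (hip L1 (\<rho> b (V h)) (P1 e))"
      by (simp only: sym)
    also have "\<dots> = hip L1 e (P1 (\<rho> b (V h)))"
      using h eK by (simp add: K1D P1_sa flip: hip_cnj)
    finally show "hip L1 e (S (\<rho> b (V h))) = hip L1 e (P1 (\<rho> b (V h)))" .
  qed
  also have "\<dots> = hip L1 (P1 e) (P1 e)"
    using eK P1_sa[of e "P1 e"] by (simp add: K1D P1_idem)
  finally show "hip L1 e (S e) = hip L1 (P1 e) (P1 e)" .
  show "hip L1 (\<Psi>s x (W g)) (S e) = hip L1 (\<Psi>s x (W g)) (P1 e)" if "g \<in> hset H2"
    by (rule extend[OF _ _ e]) (use that ip_\<Psi>sW_S_gen in auto)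
qed

lemma P1_\<Psi>sW: "g \<in> hset H2 \<Longrightarrow> P1 (\<Psi>s x (W g)) = \<Psi>s x (W g)"
proof (rule hip_eqI[OF hilbert(3)])
  fix z
  assume g: "g \<in> hset H2" and z: "z \<in> hset L1"
  have "hip L1 z (P1 (\<Psi>s x (W g))) = hip L2 (P2 (\<Psi> x z)) (W g)"
    using g z by (simp add: P1_sa P\<Psi> ip_\<Psi>s_right)
  also have "\<dots> = hip L1 z (\<Psi>s x (W g))"
    using g z by (simp add: PW ip_\<Psi>s_right flip: P2_sa)
  finally show "hip L1 z (P1 (\<Psi>s x (W g))) = hip L1 z (\<Psi>s x (W g))" .
qed simp_all

text \<open>Vectors \<open>\<eta> = \<Psi>(x)\<^sup>* W g\<close> are limits of \<open>P\<^sub>1 e\<close> with \<open>e\<close> in the span of \<open>\<rho>(A) V H\<^sub>1\<close>. Since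
  \<open>\<langle>\<eta>, S e\<rangle> = \<langle>\<eta>, P\<^sub>1 e\<rangle>\<close> and \<open>\<langle>e, S e\<rangle> = \<parallel>P\<^sub>1 e\<parallel>\<^sup>2\<close>, the Cauchy-Schwarz inequality for the form of \<open>S\<close> forces
  \<open>\<langle>\<eta>, S \<eta>\<rangle> \<ge> \<parallel>\<eta>\<parallel>\<^sup>2\<close>, and a positive contraction with this property fixes \<open>\<eta>\<close>.\<close>

lemma S_fixes:
  assumes g: "g \<in> hset H2"
  shows "S (\<Psi>s x (W g)) = \<Psi>s x (W g)"
proof -
  define \<eta> where "\<eta> = \<Psi>s x (W g)"
  have \<eta>K [simp]: "\<eta> \<in> hset K1"
    using g by (simp add: \<eta>_def)
  note \<eta>L [simp] = K1D[OF \<eta>K]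
  have P\<eta>: "P1 \<eta> = \<eta>"
    using g by (simp add: \<eta>_def P1_\<Psi>sW)
  let ?G = "{\<rho> a (V h) |a h. h \<in> hset H1}"
  \<comment> \<open>The range of \<open>P1\<close> is presented as the complement of the range of
    \<open>id - P1\<close>, which makes it a Hilbert space in which density can be tested by
    orthogonality.\<close>
  let ?N = "{f - P1 f |f. f \<in> hset L1}"
  let ?R = "orth_hspace L1 ?N"
  have N: "?N \<subseteq> hset L1"
    by auto
  have R_iff: "f \<in> hset ?R \<longleftrightarrow> f \<in> hset L1 \<and> P1 f = f" for f
  proof -
    have "(\<forall>n\<in>?N. hip L1 n f = 0) \<longleftrightarrow> P1 f = f" if f: "f \<in> hset L1"
    proof
      assume *: "\<forall>n\<in>?N. hip L1 n f = 0"
      show "P1 f = f"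
      proof (rule hip_eqI[OF hilbert(3)])
        fix z
        assume z: "z \<in> hset L1"
        then have "hip L1 (z - P1 z) f = 0"
          using * by blast
        then show "hip L1 z (P1 f) = hip L1 z f"
          using z f by (simp add: P1_sa)
      qed (use f in simp_all)
    qed (use f in \<open>auto simp flip: P1_sa\<close>)
    then show ?thesis
      by (auto simp: hset_orth)
  qed
  \<comment> \<open>A vector fixed by \<open>P1\<close> has the same pairing with an orbit vector as
    with its projection, so \<open>total\<close> excludes any nonzero vector orthogonal to the
    projected orbits.\<close>
  have dense: "hclosed_span ?R (P1 ` ?G) = hset ?R"
  proof (rule hclosed_span_total)
    show "hilbert_space ?R"
      using N by simp
    show "P1 ` ?G \<subseteq> hset ?R"
      by (auto simp: R_iff P1_idem)
    fix f
    assume f: "f \<in> hset ?R" and orth: "\<And>m. m \<in> P1 ` ?G \<Longrightarrow> hip ?R m f = 0"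
    show "f = 0"
    proof (rule total)
      show "f \<in> hset L1" "P1 f = f"
        using f by (simp_all add: R_iff)
      fix a h
      assume h: "h \<in> hset H1"
      have "hip ?R (P1 (\<rho> a (V h))) f = 0"
        by (rule orth) (use h in blast)
      then show "hip L1 (\<rho> a (V h)) f = 0"
        using h f by (simp add: R_iff flip: P1_sa)
    qed
  qed
  have span_image: "u \<in> P1 ` module.span scaleC ?G" if "u \<in> module.span scaleC (P1 ` ?G)" for u
  proof -
    have sub: "module.subspace scaleC (P1 ` module.span scaleC ?G)"
      unfolding cvec.subspace_def
    proof (intro conjI ballI allI)
      show "0 \<in> P1 ` module.span scaleC ?G"
        using bop_zero[OF hilbert(3) P1] cvec.span_zero[of ?G] by force
      show "u + v \<in> P1 ` module.span scaleC ?G"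
        if mem_uv: "u \<in> P1 ` module.span scaleC ?G" "v \<in> P1 ` module.span scaleC ?G" for u v
      proof -
        obtain u' v' where uv: "u' \<in> module.span scaleC ?G" "v' \<in> module.span scaleC ?G"
          "u = P1 u'" "v = P1 v'"
          using mem_uv by blast
        then have "u + v = P1 (u' + v')"
          using bop_add[OF P1 K1D[OF span_gen_S(1)[OF uv(1)]] K1D[OF span_gen_S(1)[OF uv(2)]]] by simp
        then show ?thesis
          using cvec.span_add[OF uv(1,2)] by blast
      qed
      show "c *\<^sub>C u \<in> P1 ` module.span scaleC ?G" if mem_u: "u \<in> P1 ` module.span scaleC ?G" for c u
      proof -
        obtain u' where u: "u' \<in> module.span scaleC ?G" "u = P1 u'"
          using mem_u by blast
        then have "c *\<^sub>C u = P1 (c *\<^sub>C u')"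
          using bop_scale[OF P1 K1D[OF span_gen_S(1)[OF u(1)]]] by simp
        then show ?thesis
          using cvec.span_scale[OF u(1)] by blast
      qed
    qed
    have "module.span scaleC (P1 ` ?G) \<subseteq> P1 ` module.span scaleC ?G"
      by (rule cvec.span_minimal[OF image_mono[OF cvec.span_superset] sub])
    with that show ?thesis
      by (rule subsetD[rotated])
  qed
  define s where "s = Re (hip L1 \<eta> (S \<eta>))"
  have s_nonneg: "s \<ge> 0"
    using positive_op_Re[OF positive_contraction.pos[OF S_contr] \<eta>K] by (simp add: s_def)
  have test: "cmod (hip L1 \<eta> u) \<le> sqrt s * hnorm L1 u" if "u = P1 e" "e \<in> module.span scaleC ?G" for u e
  proof (rule power2_le_imp_le)
    note eK = span_gen_S(1)[OF that(2)]
    have "(cmod (hip L1 \<eta> u))\<^sup>2 = (cmod (hip L1 \<eta> (S e)))\<^sup>2"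
      using span_gen_S(3)[OF that(2) g, of x] by (simp add: \<eta>_def that(1))
    also have "\<dots> \<le> Re (hip L1 e (S e)) * s"
      using positive_op_cauchy_schwarz[OF K_hilbert(1) positive_contraction.pos[OF S_contr] eK \<eta>K]
      by (simp add: s_def)
    also have "Re (hip L1 e (S e)) = (hnorm L1 u)\<^sup>2"
      using K1D[OF eK] by (simp add: span_gen_S(2)[OF that(2)] that(1) hip_self)
    finally show "(cmod (hip L1 \<eta> u))\<^sup>2 \<le> (sqrt s * hnorm L1 u)\<^sup>2"
      using s_nonneg by (simp add: power_mult_distrib mult.commute)
    show "0 \<le> sqrt s * hnorm L1 u"
      using s_nonneg K1D[OF eK] that(1) by simp
  qed
  \<comment> \<open>\<open>test\<close> holds only for projected span vectors \<open>u\<close>;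
    replacing \<eta> by such a \<open>u\<close> within distance \<open>d\<close> costs terms
    proportional to \<open>d\<close>, which are removed below.\<close>
  have approx: "(hnorm L1 \<eta>)\<^sup>2 \<le> sqrt s * hnorm L1 \<eta> + d * (hnorm L1 \<eta> + sqrt s)" if d: "d > 0" for d
  proof -
    have "\<eta> \<in> hclosed_span ?R (P1 ` ?G)"
      unfolding dense by (simp add: R_iff P\<eta>)
    with d obtain u where u: "u \<in> module.span scaleC (P1 ` ?G)" "hnorm L1 (\<eta> - u) < d"
      unfolding hclosed_span_def by auto
    from span_image[OF u(1)] obtain e where e: "u = P1 e" "e \<in> module.span scaleC ?G"
      by blast
    have uL: "u \<in> hset L1"
      using K1D[OF span_gen_S(1)[OF e(2)]] by (simp add: e(1))
    have "(hnorm L1 \<eta>)\<^sup>2 = cmod (hip L1 \<eta> (\<eta> - u) + hip L1 \<eta> u)"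
      using uL by (simp add: hip_self norm_power)
    also have "\<dots> \<le> cmod (hip L1 \<eta> (\<eta> - u)) + cmod (hip L1 \<eta> u)"
      by (rule norm_triangle_ineq)
    also have "\<dots> \<le> hnorm L1 \<eta> * d + sqrt s * (hnorm L1 \<eta> + d)"
    proof (rule add_mono)
      have "cmod (hip L1 \<eta> (\<eta> - u)) \<le> hnorm L1 \<eta> * hnorm L1 (\<eta> - u)"
        using uL by (intro hip_cauchy_schwarz) simp_all
      also have "\<dots> \<le> hnorm L1 \<eta> * d"
        using u(2) by (intro mult_left_mono) simp_all
      finally show "cmod (hip L1 \<eta> (\<eta> - u)) \<le> hnorm L1 \<eta> * d" .
      have "hnorm L1 u \<le> hnorm L1 \<eta> + hnorm L1 (u - \<eta>)"
        using hnorm_triangle[of L1 \<eta> "u - \<eta>"] uL by simp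
      also have "\<dots> \<le> hnorm L1 \<eta> + d"
        using u(2) hnorm_minus_commute[of L1 u \<eta>] uL by simp
      finally show "cmod (hip L1 \<eta> u) \<le> sqrt s * (hnorm L1 \<eta> + d)"
        using test[OF e] s_nonneg by (meson mult_left_mono order_trans real_sqrt_ge_zero)
    qed
    finally show ?thesis
      by (simp add: algebra_simps)
  qed
  have "(hnorm L1 \<eta>)\<^sup>2 \<le> sqrt s * hnorm L1 \<eta>"
  proof (rule field_le_epsilon)
    fix r :: real
    assume r: "r > 0"
    \<comment> \<open>The summand 1 keeps the divisor positive even when \<eta> and \<open>s\<close>
      vanish.\<close>
    define c where "c = hnorm L1 \<eta> + sqrt s + 1"
    have c: "c > 0"
      unfolding c_def using s_nonneg by (intro add_nonneg_pos) simp_all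
    have "r / c * (hnorm L1 \<eta> + sqrt s) \<le> r / c * c"
      using r c by (intro mult_left_mono) (simp_all add: c_def)
    then show "(hnorm L1 \<eta>)\<^sup>2 \<le> sqrt s * hnorm L1 \<eta> + r"
      using approx[of "r / c"] r c by simp
  qed
  then have "hnorm L1 \<eta> * hnorm L1 \<eta> \<le> sqrt s * hnorm L1 \<eta>"
    by (simp add: power2_eq_square)
  then have "hnorm L1 \<eta> \<le> sqrt s"
    by (rule square_le_mult_imp_le) (use s_nonneg in simp_all)
  then have le: "(hnorm L1 \<eta>)\<^sup>2 \<le> s"
    using s_nonneg by (metis hilbert(3) \<eta>L hnorm_nonneg power_mono real_sqrt_pow2)
  note A_pos = positive_contraction.A_pos[OF S_contr]
  have "Re (hip L1 \<eta> ((id_op K1 - S) \<eta>)) = (hnorm L1 \<eta>)\<^sup>2 - s"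
    by (simp add: K1D hip_self s_def)
  moreover have "Re (hip L1 \<eta> ((id_op K1 - S) \<eta>)) \<ge> 0"
    using positive_op_Re[OF A_pos \<eta>K] by simp
  ultimately have "Re (hip K1 \<eta> ((id_op K1 - S) \<eta>)) = 0"
    using le by simp
  from positive_op_form_zero[OF K_hilbert(1) A_pos \<eta>K this] show ?thesis
    by (simp add: \<eta>_def[symmetric])
qed

end

text \<open>On orbit vectors both generating families of \<open>K1\<close> give \<open>S\<close> and
  \<open>S0\<close> the same pairings, so they agree there. For arbitrary \<open>k\<close>,
  self-adjointness moves the difference onto a generator: orbit vectors are settled by the first
  step, the vectors \<open>\<Psi>s x (W g)\<close> because both operators fix them. Intertwining
  then fixes \<open>T\<close> on the images that generate \<open>K2\<close>.\<close>

lemma derivative_pair_unique: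
  assumes TS: "derivative_pair T S"
  shows "T = T0 \<and> S = S0"
proof
  note TS0 = derivative_pair_T0_S0
  note mem' [simp] = S_mem[OF TS] S_mem[OF TS0]
  have gen: "S (\<rho> b (V k)) - S0 (\<rho> b (V k)) = 0" if k: "k \<in> hset H1" for b k
  proof (rule K1_eq_zeroI)
    show "hip L1 (\<rho> a (V h)) (S (\<rho> b (V k)) - S0 (\<rho> b (V k))) = 0" if "h \<in> hset H1" for a h
      using k that by (simp add: K1D ip_gen_S_gen[OF TS] ip_gen_S_gen[OF TS0])
    show "hip L1 (\<Psi>s x (W g)) (S (\<rho> b (V k)) - S0 (\<rho> b (V k))) = 0" if "g \<in> hset H2" for x g
      using k that by (simp add: K1D ip_\<Psi>sW_S_gen[OF TS] ip_\<Psi>sW_S_gen[OF TS0])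
  qed (use k in simp)
  have "S k - S0 k = 0" if k: "k \<in> hset K1" for k
  proof (rule K1_eq_zeroI)
    show "hip L1 (\<rho> a (V h)) (S k - S0 k) = 0" if h: "h \<in> hset H1" for a h
    proof -
      have "hip L1 (\<rho> a (V h)) (S k - S0 k) = hip L1 (S (\<rho> a (V h)) - S0 (\<rho> a (V h))) k"
        using k h by (simp add: K1D S_sa[OF TS] S_sa[OF TS0])
      then show ?thesis
        using gen[OF h] k by (simp add: K1D)
    qed
    show "hip L1 (\<Psi>s x (W g)) (S k - S0 k) = 0" if g: "g \<in> hset H2" for x g
      using k g by (simp add: K1D S_sa[OF TS] S_sa[OF TS0] S_fixes[OF TS] S_fixes[OF TS0])
  qed (use k in simp)
  then show S: "S = S0"
    by (intro bop_eqI[OF S_bop[OF TS] S0_bop]) simp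
  note T_bop = positive_contraction.T_bop[OF T_contr[OF TS]]
  have "hip L2 (\<Psi> x k) (T l - T0 l) = 0" if "k \<in> hset K1" "l \<in> hset K2" for x k l
  proof -
    have "hip L2 (\<Psi> x k) (T l - T0 l) = hip L2 (T (\<Psi> x k) - T0 (\<Psi> x k)) l"
      using that by (simp add: K2D bop_mem[OF T_bop] bop_mem[OF T0_bop] T_sa[OF TS] T_sa[OF TS0] K1D
          del: T_\<Psi>)
    then show ?thesis
      using that by (simp add: T_\<Psi>[OF TS] T_\<Psi>[OF TS0] S K2D)
  qed
  then have N2: "T l - T0 l \<in> N2" if "l \<in> hset K2" for l
    using that K2D[OF bop_mem[OF T_bop]] K2D[OF bop_mem[OF T0_bop]] unfolding N2_def by simp
  have "T l - T0 l = 0" if l: "l \<in> hset K2" for l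
  proof (rule hip_self_zero[OF hilbert(4) N2D[OF N2[OF l]]])
    show "hip L2 (T l - T0 l) (T l - T0 l) = 0"
      by (rule K2_orth[OF _ N2[OF l]]) (use bop_mem[OF T_bop l] bop_mem[OF T0_bop l] in simp)
  qed
  then show "T = T0"
    by (intro bop_eqI[OF T_bop T0_bop]) simp
qed

section \<open>Translation into commutant and square roots\<close>

lemma commutant_iff:
  assumes T: "positive_contraction K2 T" and S: "positive_contraction K1 S"
  shows "diag_op K2 K1 T S \<in> commutant K1 K2 \<Psi>' \<longleftrightarrow> (\<forall>x. T \<circ> \<Psi>' x = \<Psi>' x \<circ> S)"
proof
  note T' = positive_contraction.T_bop[OF T] and S' = positive_contraction.T_bop[OF S]
  {
    assume "diag_op K2 K1 T S \<in> commutant K1 K2 \<Psi>'"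
    then obtain P Q where PQ: "diag_op K2 K1 T S = diag_op K2 K1 P Q" "P \<in> bop K2 K2" "Q \<in> bop K1 K1"
      "\<forall>x. P \<circ> \<Psi>' x = \<Psi>' x \<circ> Q"
      unfolding commutant_def by blast
    \<comment> \<open>Membership in the commutant only provides some blocks \<open>P\<close>,
      \<open>Q\<close>; injectivity of \<open>diag_op\<close> identifies them with \<open>T\<close>
      and \<open>S\<close>.\<close>
    with diag_op_inject[OF K_hilbert(2,1) T' PQ(2) S' PQ(3) PQ(1)]
    show "\<forall>x. T \<circ> \<Psi>' x = \<Psi>' x \<circ> S"
      by simp
  }
  assume comm: "\<forall>x. T \<circ> \<Psi>' x = \<Psi>' x \<circ> S"
  \<comment> \<open>The second relation of the commutant is the adjoint of the first, as
    \<open>T\<close> and \<open>S\<close> are self-adjoint.\<close>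
  have "S \<circ> hadj K1 K2 (\<Psi>' x) = hadj K1 K2 (\<Psi>' x) \<circ> T" for x
  proof (rule bop_eq_ipI[OF K_hilbert(1)])
    note adj = hadj_bop[OF K_hilbert \<Psi>'_bop]
    show "S \<circ> hadj K1 K2 (\<Psi>' x) \<in> bop K2 K1"
      by (rule bop_comp[OF K_hilbert(2,1) adj S'])
    show "hadj K1 K2 (\<Psi>' x) \<circ> T \<in> bop K2 K1"
      by (rule bop_comp[OF K_hilbert(2,2) T' adj])
    fix l k
    assume l: "l \<in> hset K2" and k: "k \<in> hset K1"
    note sa = positive_op_self_adjoint[OF K_hilbert(1) positive_contraction.pos[OF S] bop_mem[OF adj l] k]
      positive_op_self_adjoint[OF K_hilbert(2) positive_contraction.pos[OF T] l bop_mem[OF \<Psi>'_bop k]]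
    have "hip K1 k ((S \<circ> hadj K1 K2 (\<Psi>' x)) l) = hip K2 (\<Psi>' x (S k)) l"
      using sa(1) hip_hadj_right[OF K_hilbert \<Psi>'_bop l bop_mem[OF S' k], of x] by simp
    also have "\<Psi>' x (S k) = T (\<Psi>' x k)"
      using fun_cong[OF comm[rule_format, of x], of k] by simp
    also have "hip K2 (T (\<Psi>' x k)) l = hip K1 k ((hadj K1 K2 (\<Psi>' x) \<circ> T) l)"
      using sa(2)[of x] hip_hadj_right[OF K_hilbert \<Psi>'_bop bop_mem[OF T' l] k, of x] by simp
    finally show "hip K1 k ((S \<circ> hadj K1 K2 (\<Psi>' x)) l) = hip K1 k ((hadj K1 K2 (\<Psi>' x) \<circ> T) l)" .
  qed
  with comm T' S' show "diag_op K2 K1 T S \<in> commutant K1 K2 \<Psi>'"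
    unfolding commutant_def by blast
qed

text \<open>The root of \<open>T\<close> passes through \<open>\<Psi>' x\<close> as the root of
  \<open>S\<close>, and the two roots of \<open>S\<close> multiply to \<open>S\<close>.\<close>

lemma op_sqrt_\<Psi>':
  assumes T: "positive_contraction K2 T" and S: "positive_contraction K1 S"
    and comm: "T \<circ> \<Psi>' x = \<Psi>' x \<circ> S"
  shows "hadj H2 K2 W' \<circ> op_sqrt K2 T \<circ> \<Psi>' x \<circ> op_sqrt K1 S \<circ> V = hadj H2 K2 W' \<circ> \<Psi>' x \<circ> S \<circ> V"
proof -
  have "op_sqrt K2 T \<circ> \<Psi>' x \<circ> op_sqrt K1 S = \<Psi>' x \<circ> (op_sqrt K1 S \<circ> op_sqrt K1 S)"
    using op_sqrt_intertwine[OF T S \<Psi>'_bop comm] by (simp add: comp_assoc)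
  then show ?thesis
    unfolding op_sqrt_square[OF S] by (simp add: comp_assoc)
qed

lemma derivative_pair_iff:
  "derivative_pair T S \<longleftrightarrow> T \<in> bop K2 K2 \<and> S \<in> bop K1 K1 \<and>
    diag_op K2 K1 T S \<in> commutant K1 K2 \<Psi>' \<and>
    positive_op (hsum K2 K1) (diag_op K2 K1 T S) \<and> contraction_op (hsum K2 K1) (diag_op K2 K1 T S) \<and>
    (\<forall>a. \<phi>1 a = hadj H1 K1 V \<circ> S \<circ> \<rho>' a \<circ> V) \<and>
    (\<forall>x. \<Phi> x = hadj H2 K2 W' \<circ> op_sqrt K2 T \<circ> \<Psi>' x \<circ> op_sqrt K1 S \<circ> V)"
proof -
  \<comment> \<open>Positive contractivity is assumed first, so that \<open>op_sqrt\<close> really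
    denotes the roots; each side of the full equivalence supplies it.\<close>
  have "derivative_pair T S \<longleftrightarrow> diag_op K2 K1 T S \<in> commutant K1 K2 \<Psi>' \<and>
      (\<forall>a. \<phi>1 a = hadj H1 K1 V \<circ> S \<circ> \<rho>' a \<circ> V) \<and>
      (\<forall>x. \<Phi> x = hadj H2 K2 W' \<circ> op_sqrt K2 T \<circ> \<Psi>' x \<circ> op_sqrt K1 S \<circ> V)"
    if T: "positive_contraction K2 T" and S: "positive_contraction K1 S"
  proof -
    note T' = positive_contraction.T_bop[OF T] and S' = positive_contraction.T_bop[OF S]
    have comm: "(\<forall>x. \<forall>k\<in>hset K1. T (\<Psi> x k) = \<Psi> x (S k)) \<longleftrightarrow> (\<forall>x. T \<circ> \<Psi>' x = \<Psi>' x \<circ> S)"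
    proof -
      have "(\<forall>k\<in>hset K1. T (\<Psi> x k) = \<Psi> x (S k)) \<longleftrightarrow> T \<circ> \<Psi>' x = \<Psi>' x \<circ> S" for x
      proof
        assume *: "\<forall>k\<in>hset K1. T (\<Psi> x k) = \<Psi> x (S k)"
        show "T \<circ> \<Psi>' x = \<Psi>' x \<circ> S"
          by (rule bop_eqI[OF bop_comp[OF K_hilbert \<Psi>'_bop T'] bop_comp[OF K_hilbert(1,1) S' \<Psi>'_bop]])
            (use * in \<open>simp add: bop_mem[OF S']\<close>)
      next
        assume *: "T \<circ> \<Psi>' x = \<Psi>' x \<circ> S"
        show "\<forall>k\<in>hset K1. T (\<Psi> x k) = \<Psi> x (S k)"
        proof
          fix k
          assume "k \<in> hset K1"
          then show "T (\<Psi> x k) = \<Psi> x (S k)"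
            using fun_cong[OF *, of k] by (simp add: bop_mem[OF S'])
        qed
      qed
      then show ?thesis
        by simp
    qed
    have phi: "(\<forall>h\<in>hset H1. \<forall>k\<in>hset H1. hip L1 (V h) (S (\<rho> a (V k))) = hip H1 h (\<phi>1 a k)) \<longleftrightarrow>
        \<phi>1 a = hadj H1 K1 V \<circ> S \<circ> \<rho>' a \<circ> V" for a
    proof -
      have rhs: "hip H1 h ((hadj H1 K1 V \<circ> S \<circ> \<rho>' a \<circ> V) k) = hip L1 (V h) (S (\<rho> a (V k)))"
        if "h \<in> hset H1" "k \<in> hset H1" for h k
        using that by (simp add: hip_hadj_right[OF _ _ V_bop] bop_mem[OF S'])
      have bop: "hadj H1 K1 V \<circ> S \<circ> \<rho>' a \<circ> V \<in> bop H1 H1"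
        by (intro bop_comp[OF _ K_hilbert(1) V_bop] bop_comp[OF _ K_hilbert(1) \<rho>'_bop]
            bop_comp[OF _ K_hilbert(1) S'] hadj_bop V_bop) simp_all
      show ?thesis
      proof
        assume *: "\<forall>h\<in>hset H1. \<forall>k\<in>hset H1. hip L1 (V h) (S (\<rho> a (V k))) = hip H1 h (\<phi>1 a k)"
        show "\<phi>1 a = hadj H1 K1 V \<circ> S \<circ> \<rho>' a \<circ> V"
          by (rule bop_eq_ipI[OF hilbert(1) \<phi>1_bop bop]) (use * rhs in auto)
      next
        assume *: "\<phi>1 a = hadj H1 K1 V \<circ> S \<circ> \<rho>' a \<circ> V"
        show "\<forall>h\<in>hset H1. \<forall>k\<in>hset H1. hip L1 (V h) (S (\<rho> a (V k))) = hip H1 h (\<phi>1 a k)"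
          unfolding * using rhs by simp
      qed
    qed
    have Phi: "(\<forall>g\<in>hset H2. \<forall>h\<in>hset H1. hip L2 (W g) (\<Psi> x (S (V h))) = hip H2 g (\<Phi> x h)) \<longleftrightarrow>
        \<Phi> x = hadj H2 K2 W' \<circ> \<Psi>' x \<circ> S \<circ> V" for x
    proof -
      have rhs: "hip H2 g ((hadj H2 K2 W' \<circ> \<Psi>' x \<circ> S \<circ> V) h) = hip L2 (W g) (\<Psi> x (S (V h)))"
        if "g \<in> hset H2" "h \<in> hset H1" for g h
        using that by (simp add: hip_hadj_right[OF _ _ W'_bop] bop_mem[OF S'] ip_W')
      have bop: "hadj H2 K2 W' \<circ> \<Psi>' x \<circ> S \<circ> V \<in> bop H1 H2"
        by (intro bop_comp[OF _ K_hilbert(1) V_bop] bop_comp[OF _ K_hilbert(1) S']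
            bop_comp[OF _ K_hilbert(2) \<Psi>'_bop] hadj_bop W'_bop) simp_all
      show ?thesis
      proof
        assume *: "\<forall>g\<in>hset H2. \<forall>h\<in>hset H1. hip L2 (W g) (\<Psi> x (S (V h))) = hip H2 g (\<Phi> x h)"
        show "\<Phi> x = hadj H2 K2 W' \<circ> \<Psi>' x \<circ> S \<circ> V"
          by (rule bop_eq_ipI[OF hilbert(2) \<Phi>_bop bop]) (use * rhs in auto)
      next
        assume *: "\<Phi> x = hadj H2 K2 W' \<circ> \<Psi>' x \<circ> S \<circ> V"
        show "\<forall>g\<in>hset H2. \<forall>h\<in>hset H1. hip L2 (W g) (\<Psi> x (S (V h))) = hip H2 g (\<Phi> x h)"
          unfolding * using rhs by simp
      qed
    qed
    show ?thesis
      unfolding derivative_pair_def commutant_iff[OF T S] comm phi Phi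
      using T S op_sqrt_\<Psi>'[OF T S] by auto
  qed
  then show ?thesis
    using diag_op_positive_contraction[OF K_hilbert(2,1), of T S] positive_contraction.T_bop[of K2 T]
      positive_contraction.T_bop[of K1 S]
    unfolding derivative_pair_def by blast
qed

theorem dilation_with_unique_derivative:
  "\<exists>(K1 :: 'k1 hspace) (K2 :: 'k2 hspace) \<rho> \<Psi> W' W.
    dilation_pair ip H1 H2 (\<phi>2, \<Phi>) (\<rho>, K1, W') (\<Psi>, K2, W) \<and>
    nondegenerate K1 K2 \<Psi> \<and>
    (\<exists>!TS. case TS of (T, S) \<Rightarrow>
      T \<in> bop K2 K2 \<and> S \<in> bop K1 K1 \<and>
      diag_op K2 K1 T S \<in> commutant K1 K2 \<Psi> \<and>
      positive_op (hsum K2 K1) (diag_op K2 K1 T S) \<and>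
      contraction_op (hsum K2 K1) (diag_op K2 K1 T S) \<and>
      (\<forall>a. \<phi>1 a = hadj H1 K1 W' \<circ> S \<circ> \<rho> a \<circ> W') \<and>
      (\<forall>e. \<Phi> e = hadj H2 K2 W \<circ> op_sqrt K2 T \<circ> \<Psi> e \<circ> op_sqrt K1 S \<circ> W'))"
proof (intro exI conjI)
  show "dilation_pair ip H1 H2 (\<phi>2, \<Phi>) (\<rho>', K1, V) (\<Psi>', K2, W')"
    by (rule dilation)
  show "nondegenerate K1 K2 \<Psi>'"
    by (rule \<Psi>'_nondegenerate)
  have "\<exists>!TS. case TS of (T, S) \<Rightarrow> derivative_pair T S"
  proof (rule ex1I[of _ "(T0, S0)"])
    show "case (T0, S0) of (T, S) \<Rightarrow> derivative_pair T S"
      using derivative_pair_T0_S0 by simp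
    show "TS = (T0, S0)" if "case TS of (T, S) \<Rightarrow> derivative_pair T S" for TS
      using derivative_pair_unique[of "fst TS" "snd TS"] that by (simp add: case_prod_beta prod_eq_iff)
  qed
  then show "\<exists>!TS. case TS of (T, S) \<Rightarrow>
      T \<in> bop K2 K2 \<and> S \<in> bop K1 K1 \<and>
      diag_op K2 K1 T S \<in> commutant K1 K2 \<Psi>' \<and>
      positive_op (hsum K2 K1) (diag_op K2 K1 T S) \<and>
      contraction_op (hsum K2 K1) (diag_op K2 K1 T S) \<and>
      (\<forall>a. \<phi>1 a = hadj H1 K1 V \<circ> S \<circ> \<rho>' a \<circ> V) \<and>
      (\<forall>e. \<Phi> e = hadj H2 K2 W' \<circ> op_sqrt K2 T \<circ> \<Psi>' e \<circ> op_sqrt K1 S \<circ> V)"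
    unfolding derivative_pair_iff .
qed

end

section \<open>Reproducing kernel Hilbert spaces\<close>

text \<open>A list of pairs \<open>(z, x)\<close> stands for the formal combination \<open>\<Sum> z \<cdot> x\<close>; \<open>lpair c f\<close> is its pairing with
  a function, antilinear in the coefficients.\<close>

definition lpair :: "(complex \<times> 'x) list \<Rightarrow> ('x \<Rightarrow> complex) \<Rightarrow> complex" where
  "lpair c f = (\<Sum>(z, x)\<leftarrow>c. cnj z * f x)"

definition lscale :: "complex \<Rightarrow> (complex \<times> 'x) list \<Rightarrow> (complex \<times> 'x) list" where
  "lscale t c = map (\<lambda>(z, x). (t * z, x)) c"

text \<open>The function represented by a formal combination of kernel sections. Seminorms live on
  the lists, so combinations representing the same function never have to be identified.\<close>

definition kcomb :: "('x \<Rightarrow> 'x \<Rightarrow> complex) \<Rightarrow> (complex \<times> 'x) list \<Rightarrow> 'x \<Rightarrow> complex" where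
  "kcomb k c = (\<lambda>x. \<Sum>(z, y)\<leftarrow>c. k x y * z)"

lemma lpair_Nil [simp]: "lpair [] f = 0"
  and lpair_Cons [simp]: "lpair ((z, x) # c) f = cnj z * f x + lpair c f"
  and lpair_append [simp]: "lpair (c @ d) f = lpair c f + lpair d f"
  by (simp_all add: lpair_def)

lemma lpair_lscale [simp]: "lpair (lscale t c) f = cnj t * lpair c f"
  by (induction c) (auto simp: lscale_def algebra_simps)

lemma lpair_add [simp]: "lpair c (f + g) = lpair c f + lpair c g"
  and lpair_diff [simp]: "lpair c (f - g) = lpair c f - lpair c g"
  and lpair_scale [simp]: "lpair c (t *\<^sub>C f) = t * lpair c f"
  and lpair_zero [simp]: "lpair c 0 = 0"
  by (induction c) (auto simp: scaleC_complex_def algebra_simps)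

lemma kcomb_Nil [simp]: "kcomb k [] = 0"
  and kcomb_append [simp]: "kcomb k (c @ d) = kcomb k c + kcomb k d"
  by (simp_all add: kcomb_def fun_eq_iff)

lemma kcomb_lscale [simp]: "kcomb k (lscale t c) = t *\<^sub>C kcomb k c"
proof
  show "kcomb k (lscale t c) x = (t *\<^sub>C kcomb k c) x" for x
    by (induction c) (auto simp: kcomb_def lscale_def scaleC_complex_def algebra_simps)
qed

lemma tendsto_lpair:
  assumes "\<And>x. (\<lambda>n. X n x) \<longlonglongrightarrow> f x"
  shows "(\<lambda>n. lpair c (X n)) \<longlonglongrightarrow> lpair c f"
proof (induction c)
  case (Cons p c)
  obtain z x where "p = (z, x)"
    by (cases p)
  with Cons assms show ?case
    by (simp add: tendsto_add tendsto_mult_left)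
qed simp

text \<open>The Moore-Aronszajn construction. The completed space consists of the functions that are
  bounded as functionals on formal combinations, so its carrier type depends only on the index type
  of the kernel.\<close>

locale psd_kernel =
  fixes k :: "'x \<Rightarrow> 'x \<Rightarrow> complex"
  assumes psd: "lpair c (kcomb k c) \<in> \<real>\<^sub>\<ge>\<^sub>0"
begin

definition qn :: "(complex \<times> 'x) list \<Rightarrow> real" where
  "qn c = sqrt (Re (lpair c (kcomb k c)))"

lemma lpair_self: "lpair c (kcomb k c) = of_real ((qn c)\<^sup>2)" and qn_nonneg [simp]: "qn c \<ge> 0"
  using psd[of c] by (simp_all add: complex_nonneg_Reals_iff qn_def complex_eq_iff)

lemma lpair_kcomb_expand:
  "lpair (c @ lscale t d) (kcomb k (c @ lscale t d)) = lpair c (kcomb k c) +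
    (cnj t * lpair d (kcomb k c) + t * lpair c (kcomb k d)) + (cnj t * t) * lpair d (kcomb k d)"
  by (simp add: algebra_simps)

lemma lpair_hermitian: "lpair d (kcomb k c) = cnj (lpair c (kcomb k d))"
proof (rule real_form_hermitian)
  fix t
  have "Im (lpair (c @ lscale t d) (kcomb k (c @ lscale t d))) = 0"
    by (simp only: lpair_self) simp
  then show "Im (cnj t * lpair d (kcomb k c) + t * lpair c (kcomb k d)) = 0"
    unfolding lpair_kcomb_expand by (simp add: lpair_self)
qed

lemma lpair_kcomb_bound: "cmod (lpair d (kcomb k c)) \<le> qn c * qn d"
proof (rule power2_le_imp_le)
  have "(cmod (lpair d (kcomb k c)))\<^sup>2 \<le> (qn c)\<^sup>2 * (qn d)\<^sup>2"
  proof (rule quadratic_form_bound)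
    fix t
    have "0 \<le> Re (lpair (c @ lscale t d) (kcomb k (c @ lscale t d)))"
      by (simp only: lpair_self) simp
    then show "0 \<le> (qn c)\<^sup>2 + 2 * Re (cnj t * lpair d (kcomb k c)) + (cmod t)\<^sup>2 * (qn d)\<^sup>2"
      unfolding lpair_kcomb_expand lpair_hermitian[of d c]
      by (simp add: lpair_self complex_norm_square[symmetric] mult.commute[of "cnj t" t])
  qed simp
  then show "(cmod (lpair d (kcomb k c)))\<^sup>2 \<le> (qn c * qn d)\<^sup>2"
    by (simp add: power_mult_distrib)
qed simp

text \<open>\<open>bd C f\<close> says that \<open>f\<close> has norm at most \<open>C\<close> as a functional on the combinations.\<close>

definition bd :: "real \<Rightarrow> ('x \<Rightarrow> complex) \<Rightarrow> bool" where
  "bd C f \<longleftrightarrow> (\<forall>c. cmod (lpair c f) \<le> C * qn c)"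

lemma bdD: "bd C f \<Longrightarrow> cmod (lpair c f) \<le> C * qn c"
  by (simp add: bd_def)

lemma bd_add: "bd B f \<Longrightarrow> bd C g \<Longrightarrow> bd (B + C) (f + g)"
  unfolding bd_def by (auto simp: distrib_right intro: norm_triangle_mono)

lemma bd_scale: "bd B f \<Longrightarrow> bd (cmod t * B) (t *\<^sub>C f)"
  unfolding bd_def by (auto simp: norm_mult mult.assoc intro!: mult_left_mono)

lemma bd_diff: "bd B f \<Longrightarrow> bd C g \<Longrightarrow> bd (B + C) (f - g)"
  using bd_add[of B f C "- g"] bd_scale[of C g "- 1"] by (simp add: scaleC_minus1)

lemma bd_mono: "bd B f \<Longrightarrow> B \<le> C \<Longrightarrow> bd C f"
  unfolding bd_def by (meson mult_right_mono order_trans qn_nonneg)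

lemma bd_kcomb: "bd (qn d) (kcomb k d)"
  unfolding bd_def using lpair_kcomb_bound by blast

lemma bd_point: "bd C f \<Longrightarrow> cmod (f x) \<le> C * qn [(1, x)]"
  using bdD[of C f "[(1, x)]"] by simp

lemma bd_zero: "bd 0 f \<Longrightarrow> f = 0"
  using bd_point[of 0 f] by (auto simp: fun_eq_iff)

lemma qn_le:
  assumes "bd C (kcomb k d)" "C \<ge> 0"
  shows "qn d \<le> C"
proof (rule square_le_mult_imp_le)
  have "cmod (of_real ((qn d)\<^sup>2)) \<le> C * qn d"
    using bdD[OF assms(1), of d] unfolding lpair_self .
  then show "qn d * qn d \<le> C * qn d"
    by (simp only: norm_of_real abs_power2 power2_eq_square[symmetric])
qed (use assms in simp_all)

text \<open>Density of the combinations among the bounded functionals, proved before those carry an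
  inner product; the inner product is defined through these approximations.\<close>

lemma bd_approx:
  assumes f: "bd C f" and e: "e > 0"
  shows "\<exists>c. bd e (f - kcomb k c)"
proof -
  have crit: "\<exists>c. \<forall>d. cmod (lpair d (f - kcomb k c)) \<le> e * sqrt ((qn d)\<^sup>2)"
  proof (rule approx_critical_point[where D = UNIV and start = "[]" and e = e and B = "C\<^sup>2"
        and J = "\<lambda>c. 2 * Re (lpair c f) - (qn c)\<^sup>2" and q = "\<lambda>d. (qn d)\<^sup>2"
        and R = "\<lambda>c d. lpair d (f - kcomb k c)"])
    show "2 * Re (lpair c f) - (qn c)\<^sup>2 \<le> C\<^sup>2" for c
    proof -
      have "Re (lpair c f) \<le> C * qn c"
        using bdD[OF f] complex_Re_le_cmod order_trans by blast
      moreover have "2 * (C * qn c) \<le> C\<^sup>2 + (qn c)\<^sup>2"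
        using sum_squares_bound[of C "qn c"] by (simp add: power2_eq_square)
      ultimately show ?thesis
        by linarith
    qed
    show "\<exists>c'\<in>UNIV. 2 * Re (lpair c' f) - (qn c')\<^sup>2 = 2 * Re (lpair c f) - (qn c)\<^sup>2 +
        2 * Re (cnj t * lpair d (f - kcomb k c)) - (cmod t)\<^sup>2 * (qn d)\<^sup>2" for c d t
    proof (rule bexI[of _ "c @ lscale t d"])
      have "(qn (c @ lscale t d))\<^sup>2 = Re (lpair (c @ lscale t d) (kcomb k (c @ lscale t d)))"
        by (simp only: lpair_self) simp
      also have "\<dots> = (qn c)\<^sup>2 + 2 * Re (cnj t * lpair d (kcomb k c)) + (cmod t)\<^sup>2 * (qn d)\<^sup>2"
        unfolding lpair_kcomb_expand lpair_hermitian[of d c]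
        by (simp add: lpair_self complex_norm_square[symmetric] mult.commute[of "cnj t" t])
      finally show "2 * Re (lpair (c @ lscale t d) f) - (qn (c @ lscale t d))\<^sup>2 =
          2 * Re (lpair c f) - (qn c)\<^sup>2 +
          2 * Re (cnj t * lpair d (f - kcomb k c)) - (cmod t)\<^sup>2 * (qn d)\<^sup>2"
        by (simp add: algebra_simps)
    qed simp
  qed (use e in auto)
  show ?thesis
    using crit by (auto simp: bd_def)
qed

section \<open>The completed function space and its inner product\<close>

definition rk_set :: "('x \<Rightarrow> complex) set" where
  "rk_set = {f. \<exists>C\<ge>0. bd C f}"

lemma rk_setI: "bd C f \<Longrightarrow> f \<in> rk_set"
  unfolding rk_set_def using bd_mono[of C f "max C 0"] by (auto intro!: exI[of _ "max C 0"])

lemma rk_set_subspace: "module.subspace scaleC rk_set"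
  unfolding cvec.subspace_def
proof (intro conjI ballI allI)
  show "0 \<in> rk_set"
    by (rule rk_setI[of 0]) (simp add: bd_def)
  show "f + g \<in> rk_set" if "f \<in> rk_set" "g \<in> rk_set" for f g
    using that bd_add rk_setI unfolding rk_set_def by blast
  show "t *\<^sub>C f \<in> rk_set" if "f \<in> rk_set" for t f
    using that bd_scale rk_setI unfolding rk_set_def by blast
qed

lemma rk_set_diff: "f \<in> rk_set \<Longrightarrow> g \<in> rk_set \<Longrightarrow> f - g \<in> rk_set"
  using rk_set_subspace by (rule cvec.subspace_diff)

lemma kcomb_rk_set [simp]: "kcomb k c \<in> rk_set"
  using bd_kcomb by (rule rk_setI)

definition apx :: "('x \<Rightarrow> complex) \<Rightarrow> nat \<Rightarrow> (complex \<times> 'x) list" where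
  "apx f n = (SOME c. bd (inverse (real (Suc n))) (f - kcomb k c))"

definition rip :: "('x \<Rightarrow> complex) \<Rightarrow> ('x \<Rightarrow> complex) \<Rightarrow> complex" where
  "rip f g = lim (\<lambda>n. lpair (apx f n) g)"

lemma bd_apx: "f \<in> rk_set \<Longrightarrow> bd (inverse (real (Suc n))) (f - kcomb k (apx f n))"
proof -
  assume "f \<in> rk_set"
  then obtain C where "bd C f"
    by (auto simp: rk_set_def)
  then have "\<exists>c. bd (inverse (real (Suc n))) (f - kcomb k c)"
    by (rule bd_approx) simp
  then show ?thesis
    unfolding apx_def by (rule someI_ex)
qed

text \<open>Two combinations approximating the same \<open>f\<close> differ by one of seminorm at
  most \<open>e + e'\<close>, so a bounded \<open>g\<close> hardly distinguishes them. This makes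
  the limit defining \<open>rip\<close> exist and agree with \<open>lpair\<close> on
  combinations.\<close>

lemma lpair_close:
  assumes "bd e (f - kcomb k c)" "bd e' (f - kcomb k d)" "bd B g" "B \<ge> 0" "e + e' \<ge> 0"
  shows "cmod (lpair c g - lpair d g) \<le> B * (e + e')"
proof -
  have "kcomb k (c @ lscale (- 1) d) = (f - kcomb k d) - (f - kcomb k c)"
    by (simp add: scaleC_minus1)
  then have "bd (e' + e) (kcomb k (c @ lscale (- 1) d))"
    using bd_diff[OF assms(2,1)] by simp
  then have "qn (c @ lscale (- 1) d) \<le> e' + e"
    using assms(5) by (intro qn_le) auto
  moreover have "cmod (lpair (c @ lscale (- 1) d) g) \<le> B * qn (c @ lscale (- 1) d)"
    using assms(3) by (rule bdD)
  ultimately have "cmod (lpair (c @ lscale (- 1) d) g) \<le> B * (e' + e)"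
    using assms(4) by (meson mult_left_mono order_trans)
  then show ?thesis
    by (simp add: add.commute)
qed

lemma inverse_Suc_tendsto: "(\<lambda>n. C * inverse (real (Suc n))) \<longlonglongrightarrow> 0"
  using tendsto_mult_left[OF LIMSEQ_inverse_real_of_nat, of C] by simp

lemma rip_tendsto:
  assumes f: "f \<in> rk_set" and g: "g \<in> rk_set"
  shows "(\<lambda>n. lpair (apx f n) g) \<longlonglongrightarrow> rip f g"
proof -
  obtain B where B: "B \<ge> 0" "bd B g"
    using g by (auto simp: rk_set_def)
  have "Cauchy (\<lambda>n. lpair (apx f n) g)"
  proof (rule metric_CauchyI)
    fix e :: real
    assume e: "e > 0"
    have "(\<lambda>n. 2 * B * inverse (real (Suc n))) \<longlonglongrightarrow> 0"
      by (rule inverse_Suc_tendsto)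
    then have "\<forall>\<^sub>F n in sequentially. 2 * B * inverse (real (Suc n)) < e"
      using e by (rule order_tendstoD(2))
    then obtain N where N: "2 * B * inverse (real (Suc N)) < e"
      using eventually_happens'[OF sequentially_bot] by blast
    show "\<exists>M. \<forall>m\<ge>M. \<forall>n\<ge>M. dist (lpair (apx f m) g) (lpair (apx f n) g) < e"
    proof (intro exI[of _ N] allI impI)
      fix m n
      assume mn: "N \<le> m" "N \<le> n"
      have "dist (lpair (apx f m) g) (lpair (apx f n) g) \<le>
          B * (inverse (real (Suc m)) + inverse (real (Suc n)))"
        unfolding dist_norm using f B by (intro lpair_close[of _ f] bd_apx) auto
      also have "\<dots> \<le> B * (inverse (real (Suc N)) + inverse (real (Suc N)))"
        using mn B(1) by (intro mult_left_mono add_mono le_imp_inverse_le) auto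
      also have "\<dots> < e"
        using N by (simp add: algebra_simps)
      finally show "dist (lpair (apx f m) g) (lpair (apx f n) g) < e" .
    qed
  qed
  then show ?thesis
    unfolding rip_def by (simp add: Cauchy_convergent convergent_LIMSEQ_iff[symmetric])
qed

lemma rip_kcomb: "g \<in> rk_set \<Longrightarrow> rip (kcomb k c) g = lpair c g"
proof -
  assume g: "g \<in> rk_set"
  then obtain B where B: "B \<ge> 0" "bd B g"
    by (auto simp: rk_set_def)
  have "(\<lambda>n. lpair (apx (kcomb k c) n) g - lpair c g) \<longlonglongrightarrow> 0"
  proof (rule Lim_null_comparison[OF _ inverse_Suc_tendsto])
    have "cmod (lpair (apx (kcomb k c) n) g - lpair c g) \<le> B * (inverse (real (Suc n)) + 0)" for n
      using B by (intro lpair_close[of _ "kcomb k c"] bd_apx) (auto simp: bd_def)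
    then show "\<forall>\<^sub>F n in sequentially. norm (lpair (apx (kcomb k c) n) g - lpair c g) \<le>
        B * inverse (real (Suc n))"
      by simp
  qed
  moreover have "(\<lambda>n. lpair (apx (kcomb k c) n) g - lpair c g) \<longlonglongrightarrow> rip (kcomb k c) g - lpair c g"
    using g by (intro tendsto_diff rip_tendsto) auto
  ultimately show ?thesis
    using LIMSEQ_unique by fastforce
qed

lemma rip_add_right: "f \<in> rk_set \<Longrightarrow> g \<in> rk_set \<Longrightarrow> h \<in> rk_set \<Longrightarrow> rip f (g + h) = rip f g + rip f h"
proof -
  assume *: "f \<in> rk_set" "g \<in> rk_set" "h \<in> rk_set"
  then have "(\<lambda>n. lpair (apx f n) (g + h)) \<longlonglongrightarrow> rip f g + rip f h"
    by (simp add: tendsto_add rip_tendsto)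
  moreover have "(\<lambda>n. lpair (apx f n) (g + h)) \<longlonglongrightarrow> rip f (g + h)"
    using * rk_set_subspace by (intro rip_tendsto cvec.subspace_add) auto
  ultimately show ?thesis
    using LIMSEQ_unique by blast
qed

lemma rip_scale_right: "f \<in> rk_set \<Longrightarrow> g \<in> rk_set \<Longrightarrow> rip f (t *\<^sub>C g) = t * rip f g"
proof -
  assume *: "f \<in> rk_set" "g \<in> rk_set"
  then have "(\<lambda>n. lpair (apx f n) (t *\<^sub>C g)) \<longlonglongrightarrow> t * rip f g"
    by (simp add: tendsto_mult_left rip_tendsto)
  moreover have "(\<lambda>n. lpair (apx f n) (t *\<^sub>C g)) \<longlonglongrightarrow> rip f (t *\<^sub>C g)"
    using * rk_set_subspace by (intro rip_tendsto cvec.subspace_scale) auto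
  ultimately show ?thesis
    using LIMSEQ_unique by blast
qed

text \<open>\<open>rip\<close> approximates only its left argument. Approximating both, with the
  seminorms of the left approximants bounded, gives a description through which conjugate symmetry
  and positivity are inherited from the kernel.\<close>

lemma rip_tendsto_kcomb:
  assumes f: "f \<in> rk_set" and g: "g \<in> rk_set"
  shows "(\<lambda>n. lpair (apx f n) (kcomb k (apx g n))) \<longlonglongrightarrow> rip f g"
proof -
  obtain B where B: "B \<ge> 0" "bd B f"
    using f by (auto simp: rk_set_def)
  have qn_apx: "qn (apx f n) \<le> B + 1" for n
  proof (rule qn_le)
    have "kcomb k (apx f n) = f - (f - kcomb k (apx f n))"
      by simp
    moreover have "bd (B + 1) (f - (f - kcomb k (apx f n)))"
      by (rule bd_diff[OF B(2) bd_mono[OF bd_apx[OF f]]]) (simp add: inverse_le_1_iff)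
    ultimately show "bd (B + 1) (kcomb k (apx f n))"
      by simp
  qed (use B in simp)
  have "(\<lambda>n. lpair (apx f n) (g - kcomb k (apx g n))) \<longlonglongrightarrow> 0"
  proof (rule Lim_null_comparison[OF _ inverse_Suc_tendsto])
    have "cmod (lpair (apx f n) (g - kcomb k (apx g n))) \<le> (B + 1) * inverse (real (Suc n))" for n
    proof -
      have "cmod (lpair (apx f n) (g - kcomb k (apx g n))) \<le> inverse (real (Suc n)) * qn (apx f n)"
        using bd_apx[OF g] by (rule bdD)
      also have "\<dots> \<le> inverse (real (Suc n)) * (B + 1)"
        using qn_apx by (intro mult_left_mono) simp_all
      finally show ?thesis
        by (simp add: mult.commute)
    qed
    then show "\<forall>\<^sub>F n in sequentially. norm (lpair (apx f n) (g - kcomb k (apx g n))) \<le>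
        (B + 1) * inverse (real (Suc n))"
      by simp
  qed
  from tendsto_diff[OF rip_tendsto[OF f g] this] show ?thesis
    by simp
qed

lemma rip_cnj: "f \<in> rk_set \<Longrightarrow> g \<in> rk_set \<Longrightarrow> rip g f = cnj (rip f g)"
proof -
  assume *: "f \<in> rk_set" "g \<in> rk_set"
  then have "(\<lambda>n. cnj (lpair (apx f n) (kcomb k (apx g n)))) \<longlonglongrightarrow> cnj (rip f g)"
    by (intro tendsto_cnj rip_tendsto_kcomb)
  then have "(\<lambda>n. lpair (apx g n) (kcomb k (apx f n))) \<longlonglongrightarrow> cnj (rip f g)"
    unfolding lpair_hermitian[symmetric] .
  with rip_tendsto_kcomb[OF *(2,1)] show ?thesis
    by (rule LIMSEQ_unique)
qed

lemma rip_self_nonneg: "f \<in> rk_set \<Longrightarrow> rip f f \<in> \<real>\<^sub>\<ge>\<^sub>0"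
  using closed_sequentially[OF closed_nonneg_Reals_complex _ rip_tendsto_kcomb] psd by blast

definition rnorm :: "('x \<Rightarrow> complex) \<Rightarrow> real" where
  "rnorm f = sqrt (Re (rip f f))"

lemma rip_self: "f \<in> rk_set \<Longrightarrow> rip f f = of_real ((rnorm f)\<^sup>2)"
  and rnorm_nonneg: "f \<in> rk_set \<Longrightarrow> rnorm f \<ge> 0"
  using rip_self_nonneg[of f] by (simp_all add: rnorm_def complex_nonneg_Reals_iff complex_eq_iff)

lemma qn_apx_tendsto: "f \<in> rk_set \<Longrightarrow> (\<lambda>n. qn (apx f n)) \<longlonglongrightarrow> rnorm f"
  unfolding qn_def rnorm_def by (intro tendsto_real_sqrt tendsto_Re rip_tendsto_kcomb)

text \<open>With \<open>rnorm_le\<close> this identifies \<open>rnorm f\<close> as the least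
  constant in \<open>bd\<close>, so norm estimates become estimates of functionals.\<close>

lemma bd_rnorm:
  assumes f: "f \<in> rk_set"
  shows "bd (rnorm f) f"
  unfolding bd_def
proof
  fix d
  have "(\<lambda>n. lpair d (f - kcomb k (apx f n))) \<longlonglongrightarrow> 0"
  proof (rule Lim_null_comparison[OF _ inverse_Suc_tendsto])
    show "\<forall>\<^sub>F n in sequentially. norm (lpair d (f - kcomb k (apx f n))) \<le> qn d * inverse (real (Suc n))"
      using bdD[OF bd_apx[OF f], of d] by (simp add: mult.commute)
  qed
  from tendsto_diff[OF tendsto_const this, of "lpair d f"]
  have "(\<lambda>n. lpair d (kcomb k (apx f n))) \<longlonglongrightarrow> lpair d f"
    by simp
  then have "(\<lambda>n. cmod (lpair d (kcomb k (apx f n)))) \<longlonglongrightarrow> cmod (lpair d f)"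
    by (rule tendsto_norm)
  with tendsto_mult_right[OF qn_apx_tendsto[OF f]] show "cmod (lpair d f) \<le> rnorm f * qn d"
    by (rule tendsto_le[OF sequentially_bot]) (simp add: lpair_kcomb_bound)
qed

lemma rnorm_le:
  assumes f: "bd C f" and C: "C \<ge> 0"
  shows "rnorm f \<le> C"
proof (rule square_le_mult_imp_le)
  note f' = rk_setI[OF f]
  have "cmod (rip f f) \<le> C * rnorm f"
    using tendsto_mult_left[OF qn_apx_tendsto[OF f']] tendsto_norm[OF rip_tendsto[OF f' f']]
    by (rule tendsto_le[OF sequentially_bot]) (simp add: bdD[OF f])
  then show "rnorm f * rnorm f \<le> C * rnorm f"
    by (simp only: rip_self[OF f'] norm_of_real abs_power2 power2_eq_square[symmetric])
qed (use C rnorm_nonneg[OF rk_setI[OF f]] in auto)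

definition RK :: "('x \<Rightarrow> complex) hspace" where
  "RK = \<lparr>hset = rk_set, hip = rip\<rparr>"

lemma hset_RK: "hset RK = rk_set" and hip_RK: "hip RK = rip" and hnorm_RK: "hnorm RK = rnorm"
  by (simp_all add: RK_def hnorm_def rnorm_def fun_eq_iff)

text \<open>Evaluations are bounded, so a Cauchy sequence converges pointwise; a bound on a
  functional survives pointwise limits because each combination involves finitely many
  points.\<close>

lemma rk_complete:
  assumes X: "\<And>n. X n \<in> rk_set"
    and cauchy: "\<And>e. e > 0 \<Longrightarrow> \<exists>N. \<forall>m\<ge>N. \<forall>n\<ge>N. rnorm (X m - X n) < e"
  shows "\<exists>f\<in>rk_set. (\<lambda>n. rnorm (X n - f)) \<longlonglongrightarrow> 0"
proof -
  have bdX: "\<exists>N. \<forall>m\<ge>N. \<forall>n\<ge>N. bd e (X m - X n)" if e: "e > 0" for e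
  proof -
    obtain N where "\<forall>m\<ge>N. \<forall>n\<ge>N. rnorm (X m - X n) < e"
      using cauchy[OF e] by blast
    then show ?thesis
      using bd_mono[OF bd_rnorm[OF rk_set_diff[OF X X]]] by (meson less_imp_le)
  qed
  have "convergent (\<lambda>n. X n x)" for x
  proof (rule Cauchy_convergent, rule metric_CauchyI)
    fix e :: real
    assume e: "e > 0"
    define q where "q = qn [(1, x)] + 1"
    have q: "q > 0"
      unfolding q_def by (intro add_nonneg_pos) simp_all
    obtain N where N: "\<And>m n. m \<ge> N \<Longrightarrow> n \<ge> N \<Longrightarrow> bd (e / q) (X m - X n)"
      using bdX[of "e / q"] e q by auto
    show "\<exists>M. \<forall>m\<ge>M. \<forall>n\<ge>M. dist (X m x) (X n x) < e"
    proof (intro exI[of _ N] allI impI)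
      fix m n
      assume "N \<le> m" "N \<le> n"
      from bd_point[OF N[OF this], of x]
      have "dist (X m x) (X n x) \<le> e / q * qn [(1, x)]"
        by (simp add: dist_norm)
      also have "\<dots> < e / q * q"
        using e q by (intro mult_strict_left_mono) (simp_all add: q_def)
      finally show "dist (X m x) (X n x) < e"
        using q by simp
    qed
  qed
  then obtain f where f: "\<And>x. (\<lambda>n. X n x) \<longlonglongrightarrow> f x"
    unfolding convergent_def by metis
  have bdf: "\<exists>N. \<forall>n\<ge>N. bd e (X n - f)" if e: "e > 0" for e
  proof -
    obtain N where N: "\<And>m n. m \<ge> N \<Longrightarrow> n \<ge> N \<Longrightarrow> bd e (X m - X n)"
      using bdX[OF e] by auto
    have "bd e (X n - f)" if n: "n \<ge> N" for n
      unfolding bd_def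
    proof
      fix c
      have "(\<lambda>m. cmod (lpair c (X n) - lpair c (X m))) \<longlonglongrightarrow> cmod (lpair c (X n) - lpair c f)"
        by (intro tendsto_norm tendsto_diff tendsto_const tendsto_lpair f)
      then have "cmod (lpair c (X n) - lpair c f) \<le> e * qn c"
      proof (rule LIMSEQ_le_const2)
        show "\<exists>M. \<forall>m\<ge>M. cmod (lpair c (X n) - lpair c (X m)) \<le> e * qn c"
          using bdD[OF N[OF n], of _ c] by auto
      qed
      then show "cmod (lpair c (X n - f)) \<le> e * qn c"
        by simp
    qed
    then show ?thesis
      by blast
  qed
  obtain N where "bd 1 (X N - f)"
    using bdf[of 1] by auto
  from rk_set_diff[OF X[of N] rk_setI[OF this]] have f_mem: "f \<in> rk_set"
    by simp
  have "(\<lambda>n. rnorm (X n - f)) \<longlonglongrightarrow> 0"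
  proof (rule LIMSEQ_I)
    fix e :: real
    assume e: "e > 0"
    then obtain N where N: "\<And>n. n \<ge> N \<Longrightarrow> bd (e / 2) (X n - f)"
      using bdf[of "e / 2"] by auto
    show "\<exists>N. \<forall>n\<ge>N. norm (rnorm (X n - f) - 0) < e"
    proof (intro exI[of _ N] allI impI)
      fix n
      assume "N \<le> n"
      then have "rnorm (X n - f) \<le> e / 2"
        using e N by (intro rnorm_le) auto
      then show "norm (rnorm (X n - f) - 0) < e"
        using e rnorm_nonneg[OF rk_set_diff[OF X f_mem], of n] by simp
    qed
  qed
  with f_mem show ?thesis
    by blast
qed

lemma RK_hilbert: "hilbert_space RK"
  unfolding hilbert_space_def hset_RK hip_RK hnorm_RK
proof (intro conjI rk_set_subspace)
  show "\<forall>f\<in>rk_set. rip f f \<in> \<real>\<^sub>\<ge>\<^sub>0 \<and> (rip f f = 0 \<longrightarrow> f = 0)"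
  proof (intro ballI conjI impI rip_self_nonneg)
    fix f
    assume "f \<in> rk_set" "rip f f = 0"
    then show "f = 0"
      using bd_rnorm[of f] by (intro bd_zero) (simp add: rnorm_def)
  qed
  show "\<forall>X. (\<forall>n. X n \<in> rk_set) \<and> (\<forall>e>0. \<exists>N. \<forall>m\<ge>N. \<forall>n\<ge>N. rnorm (X m - X n) < e) \<longrightarrow>
      (\<exists>x\<in>rk_set. (\<lambda>n. rnorm (X n - x)) \<longlonglongrightarrow> 0)"
    using rk_complete by blast
  show "\<forall>x\<in>rk_set. \<forall>y\<in>rk_set. rip y x = cnj (rip x y)"
    using rip_cnj by blast
qed (simp_all add: rip_add_right rip_scale_right)

lemma kcomb_RK [simp]: "kcomb k c \<in> hset RK"
  by (simp add: hset_RK)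

lemma hip_kcomb: "f \<in> hset RK \<Longrightarrow> hip RK (kcomb k c) f = lpair c f"
  by (simp add: hset_RK hip_RK rip_kcomb)

lemma bd_hnorm: "f \<in> hset RK \<Longrightarrow> bd (hnorm RK f) f"
  by (simp add: hset_RK hnorm_RK bd_rnorm)

lemma RK_I: "bd C f \<Longrightarrow> C \<ge> 0 \<Longrightarrow> f \<in> hset RK \<and> hnorm RK f \<le> C"
  by (simp add: hset_RK hnorm_RK rk_setI rnorm_le)

lemma kcomb_single: "kcomb k [(1, x)] = (\<lambda>y. k y x)"
  by (simp add: kcomb_def)

lemma kernel_RK [simp]: "(\<lambda>y. k y x) \<in> hset RK"
  using kcomb_RK[of "[(1, x)]"] by (simp only: kcomb_single)

text \<open>The reproducing property: identities between kernel sections become pointwise identities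
  for every function of the space.\<close>

lemma hip_kernel: "f \<in> hset RK \<Longrightarrow> hip RK (\<lambda>y. k y x) f = f x"
  using hip_kcomb[of f "[(1, x)]"] by (simp only: kcomb_single) simp

end

section \<open>Masked composition operators between kernel spaces\<close>

definition wcomp :: "('x \<Rightarrow> complex) hspace \<Rightarrow> ('y \<Rightarrow> bool) \<Rightarrow> ('y \<Rightarrow> 'x) \<Rightarrow> ('x \<Rightarrow> complex) \<Rightarrow> 'y \<Rightarrow> complex"
  where "wcomp K m \<sigma> = on_hset K (\<lambda>f y. if m y then f (\<sigma> y) else 0)"

lemma wcomp_apply: "f \<in> hset K \<Longrightarrow> wcomp K m \<sigma> f = (\<lambda>y. if m y then f (\<sigma> y) else 0)"
  by (simp add: wcomp_def on_hset_def)

definition ltrans :: "('y \<Rightarrow> bool) \<Rightarrow> ('y \<Rightarrow> 'x) \<Rightarrow> (complex \<times> 'y) list \<Rightarrow> (complex \<times> 'x) list" where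
  "ltrans m \<sigma> c = map (\<lambda>(z, y). (if m y then z else 0, \<sigma> y)) c"

lemma lpair_ltrans: "lpair c (\<lambda>y. if m y then f (\<sigma> y) else 0) = lpair (ltrans m \<sigma> c) f"
  by (induction c) (auto simp: ltrans_def)

text \<open>Duality: composing with \<sigma> is the transpose of the substitution
  \<open>ltrans\<close> on combinations, so a seminorm bound \<open>C\<close> for the substitution
  bounds the operator. The dilation operators will all be of this kind or adjoints of it.\<close>

lemma composition_bop:
  assumes K: "psd_kernel k" and K': "psd_kernel k'" and C: "C \<ge> 0"
    and bound: "\<And>c. Re (lpair (ltrans m \<sigma> c) (kcomb k (ltrans m \<sigma> c))) \<le> C\<^sup>2 * Re (lpair c (kcomb k' c))"
  defines "A \<equiv> wcomp (psd_kernel.RK k) m \<sigma>"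
  shows "A \<in> bop (psd_kernel.RK k) (psd_kernel.RK k')"
    and "\<And>f. f \<in> hset (psd_kernel.RK k) \<Longrightarrow> hnorm (psd_kernel.RK k') (A f) \<le> C * hnorm (psd_kernel.RK k) f"
proof -
  interpret K: psd_kernel k by fact
  interpret K': psd_kernel k' by fact
  have q: "K.qn (ltrans m \<sigma> c) \<le> C * K'.qn c" for c
    using real_sqrt_le_mono[OF bound[of c]] C by (simp add: K.qn_def K'.qn_def real_sqrt_mult)
  have main: "A f \<in> hset K'.RK \<and> hnorm K'.RK (A f) \<le> C * hnorm K.RK f" if f: "f \<in> hset K.RK" for f
  proof (rule K'.RK_I)
    show "K'.bd (C * hnorm K.RK f) (A f)"
      unfolding K'.bd_def
    proof
      fix c
      have "cmod (lpair c (A f)) = cmod (lpair (ltrans m \<sigma> c) f)"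
        using f by (simp add: A_def wcomp_apply lpair_ltrans)
      also have "\<dots> \<le> hnorm K.RK f * K.qn (ltrans m \<sigma> c)"
        using K.bd_hnorm[OF f] by (rule K.bdD)
      also have "\<dots> \<le> hnorm K.RK f * (C * K'.qn c)"
        using q f K.RK_hilbert by (intro mult_left_mono) simp_all
      finally show "cmod (lpair c (A f)) \<le> C * hnorm K.RK f * K'.qn c"
        by (simp add: mult_ac)
    qed
    show "C * hnorm K.RK f \<ge> 0"
      using C f K.RK_hilbert by simp
  qed
  then show "\<And>f. f \<in> hset K.RK \<Longrightarrow> hnorm K'.RK (A f) \<le> C * hnorm K.RK f"
    by blast
  show "A \<in> bop K.RK K'.RK"
  proof (rule bopI[where B = C])
    show "A f = 0" if "f \<notin> hset K.RK" for f
      using that by (simp add: A_def wcomp_def on_hset_def)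
    show "A (f + g) = A f + A g" if "f \<in> hset K.RK" "g \<in> hset K.RK" for f g
      using that K.RK_hilbert by (auto simp: A_def wcomp_def on_hset_def fun_eq_iff)
    show "A (t *\<^sub>C f) = t *\<^sub>C A f" if "f \<in> hset K.RK" for t f
      using that K.RK_hilbert by (auto simp: A_def wcomp_def on_hset_def fun_eq_iff)
  qed (use main in auto)
qed

text \<open>The hypothesis on the kernels says that the operator sends the section at
  \<open>p\<close> to the section at \<open>\<tau> p\<close>, or to 0. Evaluating the adjoint at
  \<open>p\<close> means pairing with exactly that image.\<close>

lemma hadj_wcomp:
  assumes K: "psd_kernel k" and K': "psd_kernel k'"
    and bop: "wcomp (psd_kernel.RK k) m \<sigma> \<in> bop (psd_kernel.RK k) (psd_kernel.RK k')"
    and adj: "\<And>p q. (if m q then k (\<sigma> q) p else 0) = (if m' p then k' q (\<tau> p) else 0)"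
    and f: "f \<in> hset (psd_kernel.RK k')"
  shows "hadj (psd_kernel.RK k) (psd_kernel.RK k') (wcomp (psd_kernel.RK k) m \<sigma>) f =
    (\<lambda>p. if m' p then f (\<tau> p) else 0)"
proof
  interpret K: psd_kernel k by fact
  interpret K': psd_kernel k' by fact
  fix p
  let ?A = "wcomp K.RK m \<sigma>" and ?g = "hadj K.RK K'.RK (wcomp K.RK m \<sigma>) f"
  have "?g p = hip K.RK (\<lambda>q. k q p) ?g"
    using hadj_mem[OF K.RK_hilbert K'.RK_hilbert bop f] by (simp only: K.hip_kernel)
  also have "\<dots> = hip K'.RK (?A (\<lambda>q. k q p)) f"
    by (rule hip_hadj_right[OF K.RK_hilbert K'.RK_hilbert bop f K.kernel_RK])
  also have "?A (\<lambda>q. k q p) = (if m' p then (\<lambda>q. k' q (\<tau> p)) else 0)"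
    by (auto simp: wcomp_apply adj fun_eq_iff)
  finally have "?g p = hip K'.RK (if m' p then (\<lambda>q. k' q (\<tau> p)) else 0) f" .
  then show "?g p = (if m' p then f (\<tau> p) else 0)"
    by (cases "m' p") (simp_all only: if_True if_False K'.hip_kernel[OF f] hip_zero_left[OF K'.RK_hilbert f])
qed

section \<open>Operator-valued kernels\<close>

lemma hadj_hadj: "hilbert_space H \<Longrightarrow> hilbert_space K \<Longrightarrow> f \<in> bop H K \<Longrightarrow> hadj K H (hadj H K f) = f"
  by (rule hadj_eqI) (simp_all add: hip_hadj_left)

text \<open>Vectors outside the carrier or with the wrong tag become 0, so kernels are defined on
  the whole index type without side conditions.\<close>

definition clip :: "'h::complex_vector hspace \<Rightarrow> nat \<Rightarrow> nat \<times> 'x \<times> 'h \<Rightarrow> 'h" where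
  "clip H r p = (if fst p = r \<and> snd (snd p) \<in> hset H then snd (snd p) else 0)"

text \<open>The scalar kernel of the orthogonal sum of the operator-valued kernels
  \<open>G 0\<close> and \<open>G 1\<close>; the natural number in an index is the tag of its
  summand, and tags from 2 on contribute nothing.\<close>

definition opk :: "'h::complex_vector hspace \<Rightarrow> (nat \<Rightarrow> 'x \<Rightarrow> 'x \<Rightarrow> 'h \<Rightarrow> 'h) \<Rightarrow>
    nat \<times> 'x \<times> 'h \<Rightarrow> nat \<times> 'x \<times> 'h \<Rightarrow> complex" where
  "opk H G p q = (\<Sum>r<2. hip H (clip H r p) (G r (fst (snd p)) (fst (snd q)) (clip H r q)))"

definition opform2 :: "'h hspace \<Rightarrow> ('x \<Rightarrow> 'x \<Rightarrow> 'h \<Rightarrow> 'h) \<Rightarrow> ('x \<times> 'h) list \<Rightarrow> ('x \<times> 'h) list \<Rightarrow> complex"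
  where "opform2 H g v w = (\<Sum>(x, h)\<leftarrow>v. \<Sum>(y, l)\<leftarrow>w. hip H h (g x y l))"

abbreviation opform :: "'h hspace \<Rightarrow> ('x \<Rightarrow> 'x \<Rightarrow> 'h \<Rightarrow> 'h) \<Rightarrow> ('x \<times> 'h) list \<Rightarrow> complex"
  where "opform H g v \<equiv> opform2 H g v v"

definition sel :: "'h::complex_vector hspace \<Rightarrow> nat \<Rightarrow> (complex \<times> nat \<times> 'x \<times> 'h) list \<Rightarrow> ('x \<times> 'h) list"
  where "sel H r c = map (\<lambda>(z, p). (fst (snd p), z *\<^sub>C clip H r p)) c"

lemma clip_mem [simp]: "hilbert_space H \<Longrightarrow> clip H r p \<in> hset H"
  by (simp add: clip_def)

lemma clip_mid: "clip H r (i, x, h) = (if i = r \<and> h \<in> hset H then h else 0)"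
  by (auto simp: clip_def)

lemma clip_tuple: "h \<in> hset H \<Longrightarrow> clip H r (i, x, h) = (if i = r then h else 0)"
  by (simp add: clip_def)

lemma sel_mem: "hilbert_space H \<Longrightarrow> snd ` set (sel H r c) \<subseteq> hset H"
  by (auto simp: sel_def)

lemma opform2_Nil [simp]: "opform2 H g [] w = 0" "opform2 H g v [] = 0"
  by (simp_all add: opform2_def case_prod_unfold)

lemma opform2_map_fst:
  "opform2 H g (map (apfst s) v) (map (apfst s) w) = opform2 H (\<lambda>x y. g (s x) (s y)) v w"
  by (simp add: opform2_def case_prod_unfold comp_def)

lemma opform2_add:
  assumes H: "hilbert_space H" and v: "snd ` set v \<subseteq> hset H" "snd ` set w \<subseteq> hset H"
    and g: "\<And>x y. g x y \<in> bop H H" "\<And>x y. g' x y \<in> bop H H"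
  shows "opform2 H (\<lambda>x y. g x y + g' x y) v w = opform2 H g v w + opform2 H g' v w"
proof -
  have "(\<Sum>(y, l)\<leftarrow>w. hip H h ((g x y + g' x y) l)) =
      (\<Sum>(y, l)\<leftarrow>w. hip H h (g x y l)) + (\<Sum>(y, l)\<leftarrow>w. hip H h (g' x y l))"
    if "h \<in> hset H" for x h
    using v(2) that H bop_mem[OF g(1)] bop_mem[OF g(2)] by (induction w) auto
  then show ?thesis
    using v(1) by (induction v) (auto simp: opform2_def)
qed

lemma opform2_scale:
  assumes H: "hilbert_space H" and v: "snd ` set v \<subseteq> hset H" "snd ` set w \<subseteq> hset H"
    and g: "\<And>x y. g x y \<in> bop H H"
  shows "opform2 H (\<lambda>x y. c *\<^sub>C g x y) v w = c * opform2 H g v w"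
proof -
  have "(\<Sum>(y, l)\<leftarrow>w. hip H h ((c *\<^sub>C g x y) l)) = c * (\<Sum>(y, l)\<leftarrow>w. hip H h (g x y l))"
    if "h \<in> hset H" for x h
    using v(2) that H bop_mem[OF g] by (induction w) (auto simp: distrib_left)
  then show ?thesis
    using v(1) by (induction v) (auto simp: opform2_def distrib_left)
qed

lemma lpair_opk:
  assumes H: "hilbert_space H" and G: "\<And>r x y. G r x y \<in> bop H H"
  shows "lpair c (kcomb (opk H G) d) = (\<Sum>r<2. opform2 H (G r) (sel H r c) (sel H r d))"
proof -
  note mem = bop_mem[OF G clip_mem[OF H]]
  have inner: "cnj z * kcomb (opk H G) d p =
      (\<Sum>r<2. \<Sum>(y, l)\<leftarrow>sel H r d. hip H (z *\<^sub>C clip H r p) (G r (fst (snd p)) y l))" for z p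
  proof (induction d)
    case (Cons a d)
    obtain w q where a: "a = (w, q)"
      by (cases a)
    have "cnj z * (opk H G p q * w) =
        (\<Sum>r<2. hip H (z *\<^sub>C clip H r p) (G r (fst (snd p)) (fst (snd q)) (w *\<^sub>C clip H r q)))"
      by (simp add: opk_def H mem bop_scale[OF G] sum_distrib_left sum_distrib_right mult_ac)
    with Cons show ?case
      by (simp add: a kcomb_def sel_def sum.distrib distrib_left)
  qed (simp add: sel_def)
  show ?thesis
  proof (induction c)
    case (Cons a c)
    then show ?case
      by (cases a) (simp add: inner opform2_def sel_def sum.distrib)
  qed (simp add: sel_def)
qed

lemma opk_psd:
  assumes H: "hilbert_space H" and G: "\<And>r x y. G r x y \<in> bop H H"
    and psd: "\<And>r v. snd ` set v \<subseteq> hset H \<Longrightarrow> opform H (G r) v \<in> \<real>\<^sub>\<ge>\<^sub>0"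
  shows "psd_kernel (opk H G)"
  by unfold_locales
    (simp add: lpair_opk[OF H G] numeral_2_eq_2 nonneg_Reals_add_I psd sel_mem H)

text \<open>Via the reproducing property, linearity of the kernel in its second index passes to all
  functions of the space. \<open>opk_scale\<close> and \<open>opk_eq_0\<close> work in the same way;
  scalars come out conjugated because sections pair from the left.\<close>

lemma opk_add:
  assumes H: "hilbert_space H" and G: "\<And>r x y. G r x y \<in> bop H H" and K: "psd_kernel (opk H G)"
    and add: "\<And>r u. G r u (x + y) = G r u x + G r u y"
    and f: "f \<in> hset (psd_kernel.RK (opk H G))"
  shows "f (i, x + y, h) = f (i, x, h) + f (i, y, h)"
proof -
  interpret K: psd_kernel "opk H G" by fact
  note mem = bop_mem[OF G clip_mem[OF H]]
  have "opk H G p (i, x + y, h) = opk H G p (i, x, h) + opk H G p (i, y, h)" for p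
  proof -
    have "clip H r (i, x + y, h) = clip H r (i, x, h)" "clip H r (i, y, h) = clip H r (i, x, h)" for r
      by (simp_all add: clip_def)
    then show ?thesis
      using H by (simp add: opk_def add mem sum.distrib)
  qed
  then have "(\<lambda>p. opk H G p (i, x + y, h)) = (\<lambda>p. opk H G p (i, x, h)) + (\<lambda>p. opk H G p (i, y, h))"
    by (simp add: fun_eq_iff)
  then have "hip K.RK (\<lambda>p. opk H G p (i, x + y, h)) f =
      hip K.RK (\<lambda>p. opk H G p (i, x, h)) f + hip K.RK (\<lambda>p. opk H G p (i, y, h)) f"
    using K.RK_hilbert f by simp
  then show ?thesis
    using f by (simp only: K.hip_kernel)
qed

lemma opk_scale:
  assumes H: "hilbert_space H" and G: "\<And>r x y. G r x y \<in> bop H H" and K: "psd_kernel (opk H G)"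
    and scale: "\<And>r u. G r u (c *\<^sub>C x) = c *\<^sub>C G r u x"
    and f: "f \<in> hset (psd_kernel.RK (opk H G))"
  shows "f (i, c *\<^sub>C x, h) = cnj c * f (i, x, h)"
proof -
  interpret K: psd_kernel "opk H G" by fact
  note mem = bop_mem[OF G clip_mem[OF H]]
  have "opk H G p (i, c *\<^sub>C x, h) = c * opk H G p (i, x, h)" for p
  proof -
    have "clip H r (i, c *\<^sub>C x, h) = clip H r (i, x, h)" for r
      by (simp add: clip_def)
    then show ?thesis
      using H by (simp add: opk_def scale mem sum_distrib_left)
  qed
  then have "(\<lambda>p. opk H G p (i, c *\<^sub>C x, h)) = c *\<^sub>C (\<lambda>p. opk H G p (i, x, h))"
    by (simp add: fun_eq_iff scaleC_complex_def)
  then have "hip K.RK (\<lambda>p. opk H G p (i, c *\<^sub>C x, h)) f = cnj c * hip K.RK (\<lambda>p. opk H G p (i, x, h)) f"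
    using K.RK_hilbert f by simp
  then show ?thesis
    using f by (simp only: K.hip_kernel)
qed

lemma opk_eq_0:
  assumes H: "hilbert_space H" and G: "\<And>r x y. G r x y \<in> bop H H" and K: "psd_kernel (opk H G)"
    and f: "f \<in> hset (psd_kernel.RK (opk H G))" and h: "h \<notin> hset H"
  shows "f (i, x, h) = 0"
proof -
  interpret K: psd_kernel "opk H G" by fact
  have "opk H G p (i, x, h) = 0" for p
    using H h by (simp add: opk_def clip_def bop_zero[OF H G])
  then have "(\<lambda>p. opk H G p (i, x, h)) = 0"
    by (simp add: fun_eq_iff)
  then have "hip K.RK (\<lambda>p. opk H G p (i, x, h)) f = 0"
    using K.RK_hilbert f by simp
  then show ?thesis
    using f by (simp only: K.hip_kernel)
qed

lemma opk_tuple: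
  assumes "hilbert_space H" "\<And>r x y. G r x y \<in> bop H H" "h \<in> hset H" "l \<in> hset H"
  shows "opk H G (i, x, h) (j, y, l) = (if i = j \<and> i < 2 then hip H h (G i x y l) else 0)"
  using assms by (auto simp: opk_def clip_tuple numeral_2_eq_2 less_Suc_eq bop_zero[OF _ assms(2)] bop_mem[OF assms(2)])

definition mid_map :: "('y \<Rightarrow> 'x) \<Rightarrow> nat \<times> 'y \<times> 'h \<Rightarrow> nat \<times> 'x \<times> 'h" where
  "mid_map s = (\<lambda>(i, y, h). (i, s y, h))"

lemma mid_map_tuple [simp]: "mid_map s (i, y, h) = (i, s y, h)"
  by (simp add: mid_map_def)

lemma sel_ltrans_mid: "sel H r (ltrans (\<lambda>_. True) (mid_map s) c) = map (apfst s) (sel H r c)"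
  by (auto simp: sel_def ltrans_def mid_map_def clip_def)

text \<open>Substitution in the middle component leaves tags and vectors alone, so the kernel
  inequality can be checked for each \<open>G r\<close> separately.\<close>

lemma mid_comp_bop:
  assumes H: "hilbert_space H" and G: "\<And>r x y. G r x y \<in> bop H H" and G': "\<And>r x y. G' r x y \<in> bop H H"
    and K: "psd_kernel (opk H G)" and K': "psd_kernel (opk H G')" and C: "C \<ge> 0"
    and bound: "\<And>r v. snd ` set v \<subseteq> hset H \<Longrightarrow>
      Re (opform H (\<lambda>x y. G r (s x) (s y)) v) \<le> C\<^sup>2 * Re (opform H (G' r) v)"
  defines "L \<equiv> psd_kernel.RK (opk H G)" and "L' \<equiv> psd_kernel.RK (opk H G')"
  shows "wcomp L (\<lambda>_. True) (mid_map s) \<in> bop L L'"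
    and "f \<in> hset L \<Longrightarrow> hnorm L' (wcomp L (\<lambda>_. True) (mid_map s) f) \<le> C * hnorm L f"
proof -
  have q: "Re (lpair (ltrans (\<lambda>_. True) (mid_map s) c) (kcomb (opk H G) (ltrans (\<lambda>_. True) (mid_map s) c)))
      \<le> C\<^sup>2 * Re (lpair c (kcomb (opk H G') c))" for c
    unfolding lpair_opk[OF H G] lpair_opk[OF H G'] sel_ltrans_mid opform2_map_fst Re_sum sum_distrib_left
    using H by (intro sum_mono bound sel_mem)
  show "wcomp L (\<lambda>_. True) (mid_map s) \<in> bop L L'"
    "f \<in> hset L \<Longrightarrow> hnorm L' (wcomp L (\<lambda>_. True) (mid_map s) f) \<le> C * hnorm L f"
    unfolding L_def L'_def by (intro composition_bop[OF K K' C q])+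
qed

section \<open>The projection onto the first summand\<close>

definition first_proj :: "(nat \<times> 'x \<times> 'h \<Rightarrow> complex) hspace \<Rightarrow> (nat \<times> 'x \<times> 'h \<Rightarrow> complex) \<Rightarrow>
    nat \<times> 'x \<times> 'h \<Rightarrow> complex" where
  "first_proj L = wcomp L (\<lambda>p. fst p = 0) id"

lemma first_proj_apply: "f \<in> hset L \<Longrightarrow> first_proj L f = (\<lambda>p. if fst p = 0 then f p else 0)"
  by (auto simp: first_proj_def wcomp_apply)

lemma first_proj_bop:
  assumes H: "hilbert_space H" and G: "\<And>r x y. G r x y \<in> bop H H" and K: "psd_kernel (opk H G)"
    and psd: "\<And>r v. snd ` set v \<subseteq> hset H \<Longrightarrow> opform H (G r) v \<in> \<real>\<^sub>\<ge>\<^sub>0"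
  defines "L \<equiv> psd_kernel.RK (opk H G)"
  shows "first_proj L \<in> bop L L"
    and "f \<in> hset L \<Longrightarrow> g \<in> hset L \<Longrightarrow> hip L f (first_proj L g) = hip L (first_proj L f) g"
proof -
  interpret K: psd_kernel "opk H G" by fact
  have L: "hilbert_space L"
    unfolding L_def by (rule K.RK_hilbert)
  have q: "Re (lpair (ltrans (\<lambda>p. fst p = 0) id c) (kcomb (opk H G) (ltrans (\<lambda>p. fst p = 0) id c)))
      \<le> 1\<^sup>2 * Re (lpair c (kcomb (opk H G) c))" for c
  proof -
    let ?t = "ltrans (\<lambda>p. fst p = 0) id c"
    have s0: "sel H 0 ?t = sel H 0 c"
      by (auto simp: sel_def ltrans_def clip_def)
    \<comment> \<open>All vectors in the tag 1 part are 0: the mask kills the coefficients with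
      nonzero tag, and \<open>clip\<close> kills the vectors with tag 0.\<close>
    have "(\<Sum>(y, l)\<leftarrow>sel H 1 (ltrans (\<lambda>p. fst p = 0) id d). hip H h (G 1 x y l)) = 0"
      if "h \<in> hset H" for d h x
      using H that by (induction d) (auto simp: sel_def ltrans_def clip_def bop_zero[OF H G])
    then have "opform2 H (G 1) (sel H 1 d) (sel H 1 ?t) = 0" for d
      using H by (induction d) (auto simp: opform2_def sel_def)
    then have "opform2 H (G 1) (sel H 1 ?t) (sel H 1 ?t) = 0" .
    moreover have "0 \<le> Re (opform H (G 1) (sel H 1 c))"
      using psd[OF sel_mem[OF H]] by (simp add: complex_nonneg_Reals_iff)
    ultimately show ?thesis
      by (simp add: lpair_opk[OF H G] numeral_2_eq_2 s0)
  qed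
  show bop: "first_proj L \<in> bop L L"
    unfolding L_def first_proj_def by (rule composition_bop[OF K K _ q]) simp
  have "(if fst q = 0 then opk H G (id q) p else 0) = (if fst p = 0 then opk H G q (id p) else 0)" for p q
    using H by (auto simp: opk_def clip_def numeral_2_eq_2 bop_zero[OF H G] bop_mem[OF G])
  then have adj: "hadj L L (first_proj L) g = first_proj L g" if "g \<in> hset L" for g
    using hadj_wcomp[OF K K, of "\<lambda>p. fst p = 0" id "\<lambda>p. fst p = 0" id g] bop that
    unfolding L_def first_proj_def by (simp add: wcomp_apply)
  show "hip L f (first_proj L g) = hip L (first_proj L f) g" if "f \<in> hset L" "g \<in> hset L"
    using hip_hadj_right[OF L L bop that(2,1)] that by (simp add: adj)
qed

section \<open>The ambient dilation\<close>

context hilbert_module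
begin

lemma ip_add_left: "ip (x + y) z = ip x z + ip y z"
  using star_ip[of z "x + y"] by (simp add: ip_add_right star_add star_ip)

lemma ip_scaleC_left: "ip (c *\<^sub>C x) z = cnj c *\<^sub>C ip x z"
  using star_ip[of z "c *\<^sub>C x"] by (simp add: ip_scaleC_right star_scaleC star_ip)

lemma ip_act_left: "ip (act x a) y = star a * ip x y"
  using star_ip[of y "act x a"] by (simp add: ip_act_right star_mult star_ip)

end

text \<open>\<open>\<theta> 0\<close> and \<open>\<theta> 1\<close> stand for \<open>\<phi>1\<close>
  and \<open>\<phi>2 - \<phi>1\<close>. Complete positivity enters only through the two scalar
  forms, over the algebra and over the module.\<close>

locale dominated_data = hilbert_module act ip
  for act :: "'e::complex_banach \<Rightarrow> 'a::cstar_algebra_1 \<Rightarrow> 'e" and ip :: "'e \<Rightarrow> 'e \<Rightarrow> 'a" +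
  fixes H1 :: "'h1::complex_vector hspace" and H2 :: "'h2::complex_vector hspace"
    and \<theta> :: "nat \<Rightarrow> 'a \<Rightarrow> 'h1 \<Rightarrow> 'h1" and \<Phi> :: "'e \<Rightarrow> 'h1 \<Rightarrow> 'h2"
  assumes full: "full_module ip"
    and H1 [simp]: "hilbert_space H1" and H2 [simp]: "hilbert_space H2"
    and \<theta>_bop: "\<And>r a. \<theta> r a \<in> bop H1 H1"
    and \<theta>_add: "\<And>r a b. \<theta> r (a + b) = \<theta> r a + \<theta> r b"
    and \<theta>_scale: "\<And>r c a. \<theta> r (c *\<^sub>C a) = c *\<^sub>C \<theta> r a"
    and psd_alg: "\<And>r v. snd ` set v \<subseteq> hset H1 \<Longrightarrow> opform H1 (\<lambda>a b. \<theta> r (star a * b)) v \<in> \<real>\<^sub>\<ge>\<^sub>0"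
    and psd_mod: "\<And>r v. snd ` set v \<subseteq> hset H1 \<Longrightarrow> opform H1 (\<lambda>x y. \<theta> r (ip x y)) v \<in> \<real>\<^sub>\<ge>\<^sub>0"
    and \<Phi>_bop: "\<And>x. \<Phi> x \<in> bop H1 H2"
    and \<Phi>_bound: "\<And>v. snd ` set v \<subseteq> hset H1 \<Longrightarrow>
      (hnorm H2 (\<Sum>(x, h)\<leftarrow>v. \<Phi> x h))\<^sup>2 \<le> Re (opform H1 (\<lambda>x y. \<theta> 0 (ip x y)) v)"
begin

definition GA :: "nat \<Rightarrow> 'a \<Rightarrow> 'a \<Rightarrow> 'h1 \<Rightarrow> 'h1" where "GA r a b = \<theta> r (star a * b)"
definition GE :: "nat \<Rightarrow> 'e \<Rightarrow> 'e \<Rightarrow> 'h1 \<Rightarrow> 'h1" where "GE r x y = \<theta> r (ip x y)"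

lemma GA_bop: "GA r a b \<in> bop H1 H1" and GE_bop: "GE r x y \<in> bop H1 H1"
  by (simp_all add: GA_def GE_def \<theta>_bop)

lemma GA_psd: "snd ` set v \<subseteq> hset H1 \<Longrightarrow> opform H1 (GA r) v \<in> \<real>\<^sub>\<ge>\<^sub>0"
  and GE_psd: "snd ` set w \<subseteq> hset H1 \<Longrightarrow> opform H1 (GE r) w \<in> \<real>\<^sub>\<ge>\<^sub>0"
  using psd_alg[of v r] psd_mod[of w r] by (simp_all add: GA_def[abs_def] GE_def[abs_def])

abbreviation "kA \<equiv> opk H1 GA"
abbreviation "kE \<equiv> opk H1 GE"

lemma kA_psd: "psd_kernel kA" and kE_psd: "psd_kernel kE"
  by (intro opk_psd H1 GA_bop GE_bop GA_psd GE_psd; assumption)+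

sublocale KA: psd_kernel kA
  by (rule kA_psd)

sublocale KE: psd_kernel kE
  by (rule kE_psd)

abbreviation "L1 \<equiv> KA.RK"
abbreviation "L2 \<equiv> KE.RK"

lemma L_hilbert [simp]: "hilbert_space L1" "hilbert_space L2"
  by (rule KA.RK_hilbert KE.RK_hilbert)+

lemma L1_add: "f \<in> hset L1 \<Longrightarrow> f (i, a + b, h) = f (i, a, h) + f (i, b, h)"
  by (rule opk_add[OF H1 GA_bop kA_psd]) (simp_all add: GA_def \<theta>_add distrib_left)

lemma L1_scale: "f \<in> hset L1 \<Longrightarrow> f (i, c *\<^sub>C a, h) = cnj c * f (i, a, h)"
  by (rule opk_scale[OF H1 GA_bop kA_psd]) (simp_all add: GA_def \<theta>_scale mult_scaleC_right)

text \<open>Left multiplication sends the section at \<open>b\<close> to the section at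
  \<open>a * b\<close>. The value of a function at \<open>b\<close> is its pairing with the section
  there, so on functions the substitution is by \<open>star a\<close>.\<close>

definition \<rho> :: "'a \<Rightarrow> (nat \<times> 'a \<times> 'h1 \<Rightarrow> complex) \<Rightarrow> nat \<times> 'a \<times> 'h1 \<Rightarrow> complex" where
  "\<rho> a = wcomp L1 (\<lambda>_. True) (mid_map (\<lambda>b. star a * b))"

text \<open>This is the adjoint of \<open>\<Psi> x\<close>, and it is constructed first: its kernel
  bound reduces to a scalar bound on \<open>ip x x\<close> inside the algebra, whereas bounding
  \<Psi> directly would call for a matrix Cauchy-Schwarz inequality in the module.\<close>

definition act_op :: "'e \<Rightarrow> (nat \<times> 'e \<times> 'h1 \<Rightarrow> complex) \<Rightarrow> nat \<times> 'a \<times> 'h1 \<Rightarrow> complex" where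
  "act_op x = wcomp L2 (\<lambda>_. True) (mid_map (act x))"

definition \<Psi> :: "'e \<Rightarrow> (nat \<times> 'a \<times> 'h1 \<Rightarrow> complex) \<Rightarrow> nat \<times> 'e \<times> 'h1 \<Rightarrow> complex" where
  "\<Psi> x = hadj L2 L1 (act_op x)"

text \<open>A C*-inequality \<open>c \<le> C\<^sup>2\<close>, witnessed by a square root \<open>d\<close> of \<open>C\<^sup>2 - c\<close>, passes to the kernels.\<close>

lemma GA_sandwich_bound:
  assumes d: "star d * d = C\<^sup>2 *\<^sub>R 1 - c" and v: "snd ` set v \<subseteq> hset H1"
  shows "Re (opform H1 (\<lambda>a b. \<theta> r (star a * c * b)) v) \<le> C\<^sup>2 * Re (opform H1 (GA r) v)"
proof -
  have split: "\<theta> r (star a * c * b) + \<theta> r (star (d * a) * (d * b)) = of_real (C\<^sup>2) *\<^sub>C GA r a b" for a b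
  proof -
    have "star a * c * b + star (d * a) * (d * b) = star a * (c + star d * d) * b"
      by (simp add: star_mult algebra_simps)
    also have "\<dots> = of_real (C\<^sup>2) *\<^sub>C (star a * b)"
      by (simp add: d) (simp add: scaleR_scaleC)
    finally show ?thesis
      by (simp add: GA_def \<theta>_scale flip: \<theta>_add)
  qed
  have "opform H1 (\<lambda>a b. of_real (C\<^sup>2) *\<^sub>C GA r a b) v =
      opform H1 (\<lambda>a b. \<theta> r (star a * c * b)) v + opform H1 (\<lambda>a b. GA r (d * a) (d * b)) v"
    unfolding GA_def split[unfolded GA_def, symmetric]
    by (rule opform2_add) (use v in \<open>simp_all add: \<theta>_bop\<close>)
  moreover have "opform H1 (\<lambda>a b. of_real (C\<^sup>2) *\<^sub>C GA r a b) v = of_real (C\<^sup>2) * opform H1 (GA r) v"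
    by (rule opform2_scale) (use v in \<open>simp_all add: GA_bop\<close>)
  ultimately have "Re (of_real (C\<^sup>2) * opform H1 (GA r) v) =
      Re (opform H1 (\<lambda>a b. \<theta> r (star a * c * b)) v) + Re (opform H1 (\<lambda>a b. GA r (d * a) (d * b)) v)"
    by (metis plus_complex.sel(1))
  moreover have "0 \<le> Re (opform H1 (\<lambda>a b. GA r (d * a) (d * b)) v)"
    using GA_psd[of "map (apfst ((*) d)) v" r] v
    by (simp add: opform2_map_fst complex_nonneg_Reals_iff image_image)
  ultimately show ?thesis
    by (simp del: of_real_power)
qed

lemma \<rho>_bop: "\<rho> a \<in> bop L1 L1"
  and \<rho>_norm: "f \<in> hset L1 \<Longrightarrow> hnorm L1 (\<rho> a f) \<le> norm a * hnorm L1 f"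
proof -
  \<comment> \<open>The substitution by \<open>star a * b\<close> sandwiches
    \<open>a * star a\<close>, hence the witness is taken for \<open>star a\<close>.\<close>
  obtain d where d: "star d * d = (norm a)\<^sup>2 *\<^sub>R 1 - a * star a"
    using norm_sq_minus_eq_square[of "star a"] by (auto simp: star_star)
  have "Re (opform H1 (\<lambda>b b'. GA r (star a * b) (star a * b')) v) \<le> (norm a)\<^sup>2 * Re (opform H1 (GA r) v)"
    if "snd ` set v \<subseteq> hset H1" for r v
    using GA_sandwich_bound[OF d that, of r] by (simp add: GA_def[abs_def] star_mult star_star mult.assoc)
  note comp = mid_comp_bop[OF H1 GA_bop GA_bop kA_psd kA_psd norm_ge_zero this]
  show "\<rho> a \<in> bop L1 L1" "f \<in> hset L1 \<Longrightarrow> hnorm L1 (\<rho> a f) \<le> norm a * hnorm L1 f"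
    unfolding \<rho>_def by (rule comp; assumption)+
qed

lemma act_op_bop: "act_op x \<in> bop L2 L1"
proof -
  obtain b where b: "ip x x = star b * b"
    using ip_positive by blast
  obtain d where d: "star d * d = (norm b)\<^sup>2 *\<^sub>R 1 - ip x x"
    using norm_sq_minus_eq_square[of b] unfolding b by blast
  have "Re (opform H1 (\<lambda>a a'. GE r (act x a) (act x a')) v) \<le> (norm b)\<^sup>2 * Re (opform H1 (GA r) v)"
    if "snd ` set v \<subseteq> hset H1" for r v
    using GA_sandwich_bound[OF d that, of r] by (simp add: GE_def ip_act_left ip_act_right mult.assoc)
  from mid_comp_bop(1)[OF H1 GE_bop GA_bop kE_psd kA_psd norm_ge_zero this] show ?thesis
    unfolding act_op_def .
qed

lemma \<Psi>_bop: "\<Psi> x \<in> bop L1 L2"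
  unfolding \<Psi>_def by (rule hadj_bop[OF L_hilbert(2,1) act_op_bop])

lemma \<rho>_apply: "f \<in> hset L1 \<Longrightarrow> \<rho> a f (i, b, h) = f (i, star a * b, h)"
  and act_op_apply: "g \<in> hset L2 \<Longrightarrow> act_op x g (i, b, h) = g (i, act x b, h)"
  by (simp_all add: \<rho>_def act_op_def wcomp_apply)

lemma \<Psi>_apply: "f \<in> hset L1 \<Longrightarrow> \<Psi> x f (i, y, h) = f (i, ip x y, h)"
proof -
  assume f: "f \<in> hset L1"
  have adj: "(if True then kE (mid_map (act x) q) p else 0) = (if True then kA q (mid_map (ip x) p) else 0)"
    for p :: "nat \<times> 'e \<times> 'h1" and q :: "nat \<times> 'a \<times> 'h1"
    by (cases p; cases q) (simp add: opk_def clip_mid GE_def GA_def ip_act_left)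
  show ?thesis
    using hadj_wcomp[OF kE_psd kA_psd act_op_bop[unfolded act_op_def] adj f]
    by (simp add: \<Psi>_def act_op_def)
qed

lemma hadj_\<rho>: "f \<in> hset L1 \<Longrightarrow> hadj L1 L1 (\<rho> a) f (i, b, h) = f (i, a * b, h)"
proof -
  assume f: "f \<in> hset L1"
  have adj: "(if True then kA (mid_map (\<lambda>b. star a * b) q) p else 0) =
      (if True then kA q (mid_map (\<lambda>b. a * b) p) else 0)" for p q :: "nat \<times> 'a \<times> 'h1"
    by (cases p; cases q) (simp add: opk_def clip_mid GA_def star_mult star_star mult.assoc)
  show ?thesis
    using hadj_wcomp[OF kA_psd kA_psd \<rho>_bop[unfolded \<rho>_def] adj f] by (simp add: \<rho>_def)
qed

lemma ext_tuple: "(\<And>i x h. f (i, x, h) = g (i, x, h)) \<Longrightarrow> f = (g :: nat \<times> 'x \<times> 'h \<Rightarrow> complex)"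
  by auto

lemma \<rho>_rep: "unital_star_rep L1 \<rho>"
  unfolding unital_star_rep_def
proof (intro conjI allI)
  show "range \<rho> \<subseteq> bop L1 L1"
    using \<rho>_bop by blast
  have "\<rho> (a + b) = \<rho> a + \<rho> b" for a b
  proof
    show "\<rho> (a + b) f = (\<rho> a + \<rho> b) f" for f
      by (cases "f \<in> hset L1"; rule ext_tuple)
        (simp_all add: \<rho>_apply bop_outside[OF \<rho>_bop] star_add distrib_right L1_add)
  qed
  moreover have "\<rho> (c *\<^sub>C a) = c *\<^sub>C \<rho> a" for c a
  proof
    show "\<rho> (c *\<^sub>C a) f = (c *\<^sub>C \<rho> a) f" for f
      by (cases "f \<in> hset L1"; rule ext_tuple)
        (simp_all add: \<rho>_apply bop_outside[OF \<rho>_bop] star_scaleC mult_scaleC_left L1_scale scaleC_complex_def)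
  qed
  ultimately show "Vector_Spaces.linear scaleC scaleC \<rho>"
    by (simp add: clinear_iff)
  show "\<rho> (a * b) = \<rho> a \<circ> \<rho> b" for a b
  proof (rule bop_eqI[OF \<rho>_bop bop_comp[OF L_hilbert(1,1) \<rho>_bop \<rho>_bop]], rule ext_tuple)
    show "\<rho> (a * b) f (i, c, h) = (\<rho> a \<circ> \<rho> b) f (i, c, h)" if "f \<in> hset L1" for f i c h
      using that by (simp add: \<rho>_apply bop_mem[OF \<rho>_bop] star_mult mult.assoc)
  qed
  show "\<rho> (star a) = hadj L1 L1 (\<rho> a)" for a
  proof (rule bop_eqI[OF \<rho>_bop hadj_bop[OF L_hilbert(1,1) \<rho>_bop]], rule ext_tuple)
    show "\<rho> (star a) f (i, c, h) = hadj L1 L1 (\<rho> a) f (i, c, h)" if "f \<in> hset L1" for f i c h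
      using that by (simp add: \<rho>_apply hadj_\<rho> star_star)
  qed
  show "\<rho> 1 = id_op L1"
  proof (rule bop_eqI[OF \<rho>_bop id_op_bop], simp, rule ext_tuple)
    show "\<rho> 1 f (i, c, h) = id_op L1 f (i, c, h)" if "f \<in> hset L1" for f i c h
      using that by (simp add: \<rho>_apply)
  qed
qed

lemma hadj_\<Psi>: "hadj L1 L2 (\<Psi> x) = act_op x"
  unfolding \<Psi>_def by (rule hadj_hadj[OF L_hilbert(2,1) act_op_bop])

lemma \<Psi>_rep_map: "rep_map ip L1 L2 \<rho> \<Psi>"
  unfolding rep_map_def
proof (intro conjI allI)
  show "range \<Psi> \<subseteq> bop L1 L2"
    using \<Psi>_bop by blast
  have "\<Psi> (x + y) = \<Psi> x + \<Psi> y" for x y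
  proof
    show "\<Psi> (x + y) f = (\<Psi> x + \<Psi> y) f" for f
      by (cases "f \<in> hset L1"; rule ext_tuple)
        (simp_all add: \<Psi>_apply bop_outside[OF \<Psi>_bop] ip_add_left L1_add)
  qed
  moreover have "\<Psi> (c *\<^sub>C x) = c *\<^sub>C \<Psi> x" for c x
  proof
    show "\<Psi> (c *\<^sub>C x) f = (c *\<^sub>C \<Psi> x) f" for f
      by (cases "f \<in> hset L1"; rule ext_tuple)
        (simp_all add: \<Psi>_apply bop_outside[OF \<Psi>_bop] ip_scaleC_left L1_scale scaleC_complex_def)
  qed
  ultimately show "Vector_Spaces.linear scaleC scaleC \<Psi>"
    by (simp add: clinear_iff)
  show "hadj L1 L2 (\<Psi> x) \<circ> \<Psi> y = \<rho> (ip x y)" for x y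
    unfolding hadj_\<Psi>
  proof (rule bop_eqI[OF bop_comp[OF L_hilbert \<Psi>_bop act_op_bop] \<rho>_bop], rule ext_tuple)
    show "(act_op x \<circ> \<Psi> y) f (i, c, h) = \<rho> (ip x y) f (i, c, h)" if "f \<in> hset L1" for f i c h
      using that by (simp add: \<rho>_apply \<Psi>_apply act_op_apply bop_mem[OF \<Psi>_bop] star_ip ip_act_right)
  qed
qed

section \<open>The projections and the operators attached to the two given spaces\<close>

abbreviation "P1 \<equiv> first_proj L1"
abbreviation "P2 \<equiv> first_proj L2"

lemmas P1_bop = first_proj_bop[OF H1 GA_bop kA_psd GA_psd]
  and P2_bop = first_proj_bop[OF H1 GE_bop kE_psd GE_psd]

text \<open>The sections at the unit of both summands are added, so pairings split into a
  \<open>\<theta> 0\<close> part and a \<open>\<theta> 1\<close> part with sum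
  \<open>\<phi>2\<close>.\<close>

definition V :: "'h1 \<Rightarrow> nat \<times> 'a \<times> 'h1 \<Rightarrow> complex" where
  "V = on_hset H1 (\<lambda>h. (\<lambda>p. kA p (0, 1, h)) + (\<lambda>p. kA p (1, 1, h)))"

text \<open>Chosen so that the adjoint sends the section at \<open>(0, x, h)\<close> to
  \<open>\<Phi> x h\<close>; clipping with tag 0 confines the range to the first summand.\<close>

definition W :: "'h2 \<Rightarrow> nat \<times> 'e \<times> 'h1 \<Rightarrow> complex" where
  "W = on_hset H2 (\<lambda>g p. hip H2 (\<Phi> (fst (snd p)) (clip H1 0 p)) g)"

lemma V_eq: "h \<in> hset H1 \<Longrightarrow> V h = (\<lambda>p. kA p (0, 1, h)) + (\<lambda>p. kA p (1, 1, h))"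
  unfolding V_def on_hset_def by (rule if_P)

lemma V_mem: "h \<in> hset H1 \<Longrightarrow> V h \<in> hset L1"
  using hs_add[OF L_hilbert(1) KA.kernel_RK[of "(0, 1, h)"] KA.kernel_RK[of "(1, 1, h)"]]
  by (simp only: V_eq)

lemma hip_V: "h \<in> hset H1 \<Longrightarrow> f \<in> hset L1 \<Longrightarrow> hip L1 (V h) f = f (0, 1, h) + f (1, 1, h)"
  using hip_add_left[OF L_hilbert(1) _ KA.kernel_RK[of "(0, 1, h)"] KA.kernel_RK[of "(1, 1, h)"], of f]
    KA.hip_kernel[of f "(0, 1, h)"] KA.hip_kernel[of f "(1, 1, h)"]
  by (simp only: V_eq)

lemma V_apply: "h \<in> hset H1 \<Longrightarrow> l \<in> hset H1 \<Longrightarrow>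
    V h (i, a, l) = (if i < 2 then hip H1 l (\<theta> i (star a) h) else 0)"
  by (auto simp: V_def on_hset_def opk_tuple \<theta>_bop GA_def less_2_cases_iff)

lemma kA_linear: "h \<in> hset H1 \<Longrightarrow> l \<in> hset H1 \<Longrightarrow> kA p (i, a, h + l) = kA p (i, a, h) + kA p (i, a, l)"
  "h \<in> hset H1 \<Longrightarrow> kA p (i, a, c *\<^sub>C h) = c * kA p (i, a, h)"
  by (cases "i < 2"; simp add: opk_def clip_tuple numeral_2_eq_2 less_Suc_eq distrib_left
      bop_add[OF GA_bop] bop_scale[OF GA_bop] bop_zero[OF H1 GA_bop] bop_mem[OF GA_bop])+

lemma V_bop: "V \<in> bop H1 L1"
proof -
  have "\<forall>r. \<exists>B. B \<ge> 0 \<and> (\<forall>h\<in>hset H1. hnorm H1 (\<theta> r 1 h) \<le> B * hnorm H1 h)"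
  proof
    fix r
    obtain B where "B \<ge> 0" "\<And>h. h \<in> hset H1 \<Longrightarrow> hnorm H1 (\<theta> r 1 h) \<le> B * hnorm H1 h"
      using bop_bound[OF H1 \<theta>_bop[of r 1]] by blast
    then show "\<exists>B. B \<ge> 0 \<and> (\<forall>h\<in>hset H1. hnorm H1 (\<theta> r 1 h) \<le> B * hnorm H1 h)"
      by blast
  qed
  from choice[OF this] obtain B where
    B: "\<And>r. B r \<ge> 0" "\<And>r h. h \<in> hset H1 \<Longrightarrow> hnorm H1 (\<theta> r 1 h) \<le> B r * hnorm H1 h"
    by blast
  show ?thesis
  proof (rule bopI[where B = "sqrt (B 0 + B 1)"])
    show "V h = 0" if "h \<notin> hset H1" for h
      using that by (simp add: V_def on_hset_def)
    show "V (h + l) = V h + V l" if "h \<in> hset H1" "l \<in> hset H1" for h l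
      using that by (simp add: V_def on_hset_def fun_eq_iff kA_linear)
    show "V (c *\<^sub>C h) = c *\<^sub>C V h" if "h \<in> hset H1" for c h
      using that by (simp add: V_def on_hset_def fun_eq_iff kA_linear scaleC_complex_def distrib_left)
    fix h
    assume h: "h \<in> hset H1"
    have le: "Re (hip H1 h (\<theta> r 1 h)) \<le> B r * (hnorm H1 h)\<^sup>2" for r
    proof -
      have "Re (hip H1 h (\<theta> r 1 h)) \<le> hnorm H1 h * hnorm H1 (\<theta> r 1 h)"
        using hip_cauchy_schwarz[OF H1 h bop_mem[OF \<theta>_bop h]] complex_Re_le_cmod order_trans by blast
      also have "\<dots> \<le> hnorm H1 h * (B r * hnorm H1 h)"
        using h B(2)[OF h] by (intro mult_left_mono) simp_all
      finally show ?thesis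
        by (simp add: power2_eq_square mult_ac)
    qed
    have "(hnorm L1 (V h))\<^sup>2 = Re (hip L1 (V h) (V h))"
      using V_mem[OF h] by (simp add: hnorm_power2)
    also have "\<dots> = Re (hip H1 h (\<theta> 0 1 h)) + Re (hip H1 h (\<theta> 1 1 h))"
      using h V_mem[OF h] by (simp add: hip_V V_apply)
    also have "\<dots> \<le> (B 0 + B 1) * (hnorm H1 h)\<^sup>2"
      using le[of 0] le[of 1] by (simp add: distrib_right)
    also have "\<dots> = (sqrt (B 0 + B 1) * hnorm H1 h)\<^sup>2"
      using B(1)[of 0] B(1)[of 1] by (simp add: power_mult_distrib)
    finally show "hnorm L1 (V h) \<le> sqrt (B 0 + B 1) * hnorm H1 h"
      by (rule power2_le_imp_le) (use h B(1)[of 0] B(1)[of 1] in simp)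
  qed (rule V_mem)
qed

text \<open>A combination pairs with \<open>W g\<close> through the vector \<open>?s\<close>, whose
  norm the semi-map inequality bounds by the \<open>\<theta> 0\<close> form; the second summand only
  enlarges the seminorm.\<close>

lemma W_mem: "g \<in> hset H2 \<Longrightarrow> W g \<in> hset L2 \<and> hnorm L2 (W g) \<le> hnorm H2 g"
proof (rule KE.RK_I)
  assume g: "g \<in> hset H2"
  show "KE.bd (hnorm H2 g) (W g)"
    unfolding KE.bd_def
  proof
    fix c
    let ?s = "\<Sum>(x, h)\<leftarrow>sel H1 0 c. \<Phi> x h"
    have s: "?s \<in> hset H2 \<and> lpair c (W g) = hip H2 ?s g"
    proof (induction c)
      case (Cons a c)
      obtain z p where a: "a = (z, p)"
        by (cases a)
      with Cons g show ?case
        by (simp add: sel_def W_def on_hset_def bop_scale[OF \<Phi>_bop] bop_mem[OF \<Phi>_bop])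
    qed (use g in \<open>simp add: sel_def\<close>)
    have "(hnorm H2 ?s)\<^sup>2 \<le> Re (opform H1 (GE 0) (sel H1 0 c))"
      using \<Phi>_bound[OF sel_mem[OF H1]] by (simp add: GE_def[abs_def])
    also have "\<dots> \<le> Re (lpair c (kcomb kE c))"
      using GE_psd[OF sel_mem[OF H1, of 1 c], of 1]
      by (simp add: lpair_opk[OF H1 GE_bop] numeral_2_eq_2 complex_nonneg_Reals_iff)
    also have "\<dots> = (KE.qn c)\<^sup>2"
      by (simp add: KE.lpair_self)
    finally have "hnorm H2 ?s \<le> KE.qn c"
      by (rule power2_le_imp_le) simp
    then have "hnorm H2 ?s * hnorm H2 g \<le> KE.qn c * hnorm H2 g"
      using g by (intro mult_right_mono) simp_all
    with hip_cauchy_schwarz[OF H2 _ g, of ?s] s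
    show "cmod (lpair c (W g)) \<le> hnorm H2 g * KE.qn c"
      by (simp add: mult.commute)
  qed
qed simp

lemma W_bop: "W \<in> bop H2 L2"
proof (rule bopI[where B = 1])
  show "W g = 0" if "g \<notin> hset H2" for g
    using that by (simp add: W_def on_hset_def)
  show "W (g + g') = W g + W g'" if "g \<in> hset H2" "g' \<in> hset H2" for g g'
    using that by (simp add: W_def on_hset_def fun_eq_iff bop_mem[OF \<Phi>_bop])
  show "W (c *\<^sub>C g) = c *\<^sub>C W g" if "g \<in> hset H2" for c g
    using that by (simp add: W_def on_hset_def fun_eq_iff bop_mem[OF \<Phi>_bop] scaleC_complex_def)
qed (use W_mem in auto)

lemma hip_\<Psi>_V:
  assumes "h \<in> hset H1" "l \<in> hset L2"
  shows "hip L2 (\<Psi> x (V h)) l = l (0, x, h) + l (1, x, h)"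
  using assms hip_hadj_right[OF L_hilbert \<Psi>_bop assms(2) V_mem[OF assms(1)], of x, symmetric]
  by (simp add: hadj_\<Psi> hip_V bop_mem[OF act_op_bop] act_op_apply act_one)

lemma ambient: "ambient_dilation act ip H1 H2 L1 L2 (\<theta> 0) (\<lambda>a. \<theta> 0 a + \<theta> 1 a) \<Phi> \<rho> \<Psi> V W P1 P2"
proof
  show "full_module ip"
    by (rule full)
  show "\<Psi> (act x a) k = \<Psi> x (\<rho> a k)" if "k \<in> hset L1" for x a k
    by (rule ext_tuple) (use that in \<open>simp add: \<Psi>_apply \<rho>_apply bop_mem[OF \<rho>_bop] ip_act_left\<close>)
  show "P1 (P1 f) = P1 f" if "f \<in> hset L1" for f
    using bop_mem[OF P1_bop(1) that] by (auto simp: first_proj_apply that)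
  show "P2 (P2 f) = P2 f" if "f \<in> hset L2" for f
    using bop_mem[OF P2_bop(1) that] by (auto simp: first_proj_apply that)
  show "P2 (\<Psi> x k) = \<Psi> x (P1 k)" if k: "k \<in> hset L1" for x k
    by (rule ext_tuple)
      (use k bop_mem[OF P1_bop(1) k] in \<open>simp add: first_proj_apply[OF bop_mem[OF \<Psi>_bop k]]
        \<Psi>_apply first_proj_apply[OF k]\<close>)
  show "P1 (\<rho> a k) = \<rho> a (P1 k)" if k: "k \<in> hset L1" for a k
    by (rule ext_tuple)
      (use k bop_mem[OF P1_bop(1) k] in \<open>simp add: first_proj_apply[OF bop_mem[OF \<rho>_bop k]]
        \<rho>_apply first_proj_apply[OF k]\<close>)
  show "P2 (W g) = W g" if g: "g \<in> hset H2" for g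
    using g W_mem[OF g]
    by (auto simp: first_proj_apply W_def on_hset_def clip_def bop_zero[OF H1 \<Phi>_bop] fun_eq_iff)
  have \<theta>: "\<rho> a (V k) (r, 1, h) = (if r < 2 then hip H1 h (\<theta> r a k) else 0)"
    if "h \<in> hset H1" "k \<in> hset H1" for a h k r
    using that by (simp add: \<rho>_apply V_mem V_apply star_star)
  show "hip L1 (V h) (\<rho> a (V k)) = hip H1 h ((\<theta> 0 a + \<theta> 1 a) k)"
    if "h \<in> hset H1" "k \<in> hset H1" for a h k
    using that by (simp add: hip_V bop_mem[OF \<rho>_bop] V_mem \<theta> bop_mem[OF \<theta>_bop])
  show "hip L1 (V h) (P1 (\<rho> a (V k))) = hip H1 h (\<theta> 0 a k)"
    if hk: "h \<in> hset H1" "k \<in> hset H1" for a h k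
  proof -
    have mem: "\<rho> a (V k) \<in> hset L1"
      using hk by (simp add: bop_mem[OF \<rho>_bop] V_mem)
    show ?thesis
      using hk bop_mem[OF P1_bop(1) mem] by (simp add: hip_V first_proj_apply[OF mem] \<theta>)
  qed
  show "hip L2 (W g) (\<Psi> x (V h)) = hip H2 g (\<Phi> x h)" if g: "g \<in> hset H2" and h: "h \<in> hset H1" for x g h
  proof -
    have "hip L2 (\<Psi> x (V h)) (W g) = hip H2 (\<Phi> x h) g"
      using g h W_mem[OF g]
      by (simp add: hip_\<Psi>_V) (simp add: W_def on_hset_def clip_tuple bop_zero[OF H1 \<Phi>_bop])
    then show ?thesis
      using hip_cnj[OF L_hilbert(2) bop_mem[OF \<Psi>_bop V_mem[OF h]] conjunct1[OF W_mem[OF g]], of x]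
        hip_cnj[OF H2 bop_mem[OF \<Phi>_bop h] g, of x] by simp
  qed
  \<comment> \<open>The sum is treated as the difference of \<open>\<theta> 0 a\<close> and
    \<open>\<theta> 1 (- a)\<close>.\<close>
  show "\<theta> 0 a + \<theta> 1 a \<in> bop H1 H1" for a
    using bop_minus[OF H1 H1 \<theta>_bop[of 0 a] \<theta>_bop[of 1 "- a"]] \<theta>_scale[of 1 "- 1" a]
    by (simp add: scaleC_minus1)
  show "f = 0" if f: "f \<in> hset L1" and P: "P1 f = f"
    and orth: "\<And>a h. h \<in> hset H1 \<Longrightarrow> hip L1 (\<rho> a (V h)) f = 0" for f
  proof (rule ext_tuple)
    fix i a h
    have zero: "f (j, b, l) = 0" if "j \<noteq> 0" for j b l
      using fun_cong[OF P, of "(j, b, l)"] that by (simp add: first_proj_apply[OF f])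
    \<comment> \<open>Pairing with an orbit vector evaluates \<open>f\<close> at \<open>a\<close> in
      both summands, and the second value vanishes because \<open>P1 f = f\<close>.\<close>
    have "f (0, a, h) = 0" if h: "h \<in> hset H1"
    proof -
      have "hip L1 (\<rho> a (V h)) f = hip L1 (V h) (hadj L1 L1 (\<rho> a) f)"
        by (rule hip_hadj_right[OF L_hilbert(1,1) \<rho>_bop f V_mem[OF h], symmetric])
      also have "\<dots> = f (0, a, h) + f (1, a, h)"
        using h f hadj_mem[OF L_hilbert(1,1) \<rho>_bop f] by (simp add: hip_V hadj_\<rho>)
      finally show ?thesis
        using orth[OF h] zero by simp
    qed
    then have "f (0, a, h) = 0"
      using opk_eq_0[OF H1 GA_bop kA_psd f] by blast
    then show "f (i, a, h) = 0 (i, a, h)"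
      using zero[of i] by (cases "i = 0") simp_all
  qed
qed (simp_all add: \<rho>_rep \<rho>_norm \<Psi>_rep_map V_bop W_bop P1_bop P2_bop \<theta>_bop \<Phi>_bop)

end

section \<open>Kernels from complete positivity\<close>

lemma opform_nth:
  "opform H g v = (\<Sum>i<length v. \<Sum>j<length v. hip H (snd (v ! i)) (g (fst (v ! i)) (fst (v ! j)) (snd (v ! j))))"
  unfolding opform2_def case_prod_unfold
  by (simp add: sum_list_sum_nth atLeast0LessThan)

definition list_vec :: "('x \<times> 'h::zero) list \<Rightarrow> nat \<Rightarrow> 'h" where
  "list_vec v i = (if i < length v then snd (v ! i) else 0)"

lemma snd_nth_mem: "snd ` set v \<subseteq> A \<Longrightarrow> i < length v \<Longrightarrow> snd (v ! i) \<in> A"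
  by (meson image_subset_iff nth_mem)

lemma list_vec_mem: "snd ` set v \<subseteq> hset H \<Longrightarrow> list_vec v \<in> hset (hpow (length v) H)"
  by (auto simp: hpow_def list_vec_def snd_nth_mem)

lemma hip_hpow: "hip (hpow n H) h k = (\<Sum>i<n. hip H (h i) (k i))"
  by (simp add: hpow_def)

lemma hset_hpow: "h \<in> hset (hpow n H) \<longleftrightarrow> (\<forall>i<n. h i \<in> hset H) \<and> (\<forall>i\<ge>n. h i = 0)"
  by (simp add: hpow_def)

lemma mat_op_apply:
  "h \<in> hset (hpow n H) \<Longrightarrow> mat_op n H F h i = (if i < n then \<Sum>j<n. F i j (h j) else 0)"
  by (simp add: mat_op_def on_hset_def)

lemma hip_mat_op:
  assumes H: "hilbert_space H" and h: "h \<in> hset (hpow n H)"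
    and F: "\<And>i j. i < n \<Longrightarrow> j < n \<Longrightarrow> F i j (h j) \<in> hset H"
  shows "hip (hpow n H) h (mat_op n H F h) = (\<Sum>i<n. \<Sum>j<n. hip H (h i) (F i j (h j)))"
  unfolding hip_hpow
proof (rule sum.cong)
  fix i
  assume "i \<in> {..<n}"
  then have i: "i < n"
    by simp
  have "hip H (h i) (\<Sum>j<n. F i j (h j)) = (\<Sum>j<n. hip H (h i) (F i j (h j)))"
    by (rule hip_sum_right[OF H]) (use h i F in \<open>auto simp: hset_hpow\<close>)
  then show "hip H (h i) (mat_op n H F h i) = (\<Sum>j<n. hip H (h i) (F i j (h j)))"
    using i by (simp add: mat_op_apply[OF h])
qed simp

lemma opform_mat_op:
  assumes H: "hilbert_space H" and v: "snd ` set v \<subseteq> hset H" and g: "\<And>x y. g x y \<in> bop H H"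
  shows "hip (hpow (length v) H) (list_vec v)
      (mat_op (length v) H (\<lambda>i j. g (fst (v ! i)) (fst (v ! j))) (list_vec v)) = opform H g v"
  unfolding opform_nth
  by (subst hip_mat_op[OF H list_vec_mem[OF v]])
    (auto simp: list_vec_def bop_mem[OF g] snd_nth_mem[OF v] intro!: sum.cong)

lemma mat_op_cong:
  "(\<And>i j. i < n \<Longrightarrow> j < n \<Longrightarrow> F i j = F' i j) \<Longrightarrow> mat_op n H F = mat_op n H F'"
  unfolding mat_op_def on_hset_def by (intro ext) (auto intro!: sum.cong)

lemma cp_map_bop: "cp_map H \<phi> \<Longrightarrow> \<phi> a \<in> bop H H"
  and cp_map_linear: "cp_map H \<phi> \<Longrightarrow> Vector_Spaces.linear scaleC scaleC \<phi>"
  unfolding cp_map_def by blast+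

lemma cp_map_opform:
  assumes H: "hilbert_space H" and \<phi>: "cp_map H \<phi>" and v: "snd ` set v \<subseteq> hset H"
  shows "opform H (\<lambda>a b. \<phi> (star a * b)) v \<in> \<real>\<^sub>\<ge>\<^sub>0"
proof -
  let ?n = "length v"
  have "pos_mat ?n (\<lambda>i j. star (fst (v ! i)) * fst (v ! j))"
    unfolding pos_mat_def
  \<comment> \<open>The matrix is the Gram matrix of a single row; since a square factor is
    required, the row is padded with zero rows.\<close>
  proof (intro exI[of _ "\<lambda>k i. if k = 0 then fst (v ! i) else 0"] allI impI)
    fix i j
    assume "i < ?n" "j < ?n"
    moreover have "(\<Sum>k<?n. star (if k = 0 then fst (v ! i) else 0) * (if k = 0 then fst (v ! j) else 0)) =
        (\<Sum>k<?n. if k = 0 then star (fst (v ! i)) * fst (v ! j) else 0)"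
      by (intro sum.cong) auto
    ultimately show "star (fst (v ! i)) * fst (v ! j) =
        (\<Sum>k<?n. star (if k = 0 then fst (v ! i) else 0) * (if k = 0 then fst (v ! j) else 0))"
      by (auto simp: sum.delta)
  qed
  then have "positive_op (hpow ?n H) (mat_op ?n H (\<lambda>i j. \<phi> (star (fst (v ! i)) * fst (v ! j))))"
    using \<phi> unfolding cp_map_def by blast
  from positive_op_nonneg[OF this list_vec_mem[OF v]] show ?thesis
    using opform_mat_op[OF H v, of "\<lambda>a b. \<phi> (star a * b)"] cp_map_bop[OF \<phi>] by simp
qed

text \<open>The description in \<open>hadj\<close> is pinned down coordinate by coordinate, testing
  with vectors concentrated in coordinate \<open>j\<close>. The powers are thus handled using the
  Hilbert space laws of \<open>H\<close> itself.\<close>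

lemma hadj_hpow_unique:
  assumes H: "hilbert_space H" and x: "x \<in> hset (hpow n H)" and y: "y \<in> hset K"
    and adj: "\<And>z. z \<in> hset (hpow n H) \<Longrightarrow> hip (hpow n H) z x = hip K (f z) y"
  shows "hadj (hpow n H) K f y = x"
  unfolding hadj_def on_hset_def if_P[OF y]
proof (rule the_equality)
  fix x'
  assume x': "x' \<in> hset (hpow n H) \<and> (\<forall>z\<in>hset (hpow n H). hip (hpow n H) z x' = hip K (f z) y)"
  show "x' = x"
  proof
    fix j
    show "x' j = x j"
    proof (cases "j < n")
      case True
      define d where "d = x' j - x j"
      have mem: "x j \<in> hset H" "x' j \<in> hset H" and d: "d \<in> hset H"
        using True x x' H by (simp_all add: hset_hpow d_def)
      let ?z = "\<lambda>i. if i = j then d else 0"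
      have z: "?z \<in> hset (hpow n H)"
        using True d H by (auto simp: hset_hpow)
      have single: "hip (hpow n H) ?z w = hip H d (w j)" if w: "w \<in> hset (hpow n H)" for w
      proof -
        have "hip (hpow n H) ?z w = (\<Sum>i<n. if i = j then hip H d (w j) else 0)"
          unfolding hip_hpow using w H by (intro sum.cong) (auto simp: hset_hpow)
        then show ?thesis
          using True by simp
      qed
      have "hip H d (x' j) = hip H d (x j)"
        using single[OF x] single[of x'] x' adj[OF z] z by simp
      then have "hip H d d = 0"
        using H mem d by (subst (2) d_def) simp
      then show ?thesis
        using hip_self_zero[OF H d] by (simp add: d_def)
    qed (use x x' in \<open>simp add: hset_hpow\<close>)
  qed
qed (use x adj in blast)

section \<open>Positive matrices over module and linking algebra\<close>

lemma scalar_op_0: "scalar_op 0 = 0"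
  by (simp add: scalar_op_def zero_blinfun_def)

lemma scalar_op_1: "scalar_op 1 = id_blinfun"
  by (simp add: scalar_op_def id_blinfun_def)

lemma op_system_0: "(0, x, y, a) \<in> op_system"
  unfolding op_system_def mem_Collect_eq by (rule exI[of _ 0]) (simp add: scalar_op_0)

lemma op_system_id: "(id_blinfun, x, y, a) \<in> op_system"
  unfolding op_system_def mem_Collect_eq by (rule exI[of _ 1]) (simp add: scalar_op_1)

context hilbert_module
begin

lemma ip_zero_right [simp]: "ip x 0 = 0"
  using ip_scaleC_right[of x 0 0] by simp

lemma ip_zero_left [simp]: "ip 0 x = 0"
  using ip_scaleC_left[of 0 0 x] by simp

lemma act_zero_left [simp]: "act 0 a = 0"
  using act_scaleC_left[of 0 0 a] by simp

lemma act_zero_right [simp]: "act x 0 = 0"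
  using act_scaleC_right[of x 0 0] by simp

lemma mod_mat_ip_row:
  assumes "i < n"
  shows "mod_mat_ip ip n (\<lambda>k j. if k = 0 then x j else 0) (\<lambda>k j. if k = 0 then x j else 0) i j = ip (x i) (x j)"
proof -
  have "mod_mat_ip ip n (\<lambda>k j. if k = 0 then x j else 0) (\<lambda>k j. if k = 0 then x j else 0) i j =
      (\<Sum>k<n. if k = 0 then ip (x i) (x j) else 0)"
    unfolding mod_mat_ip_def by (intro sum.cong) auto
  then show ?thesis
    using assms by (simp add: sum.delta)
qed

text \<open>The matrix inequality is applied to the matrix with the module elements of
  \<open>v\<close> in its first row and 0 elsewhere: its image of the vector has the single nonzero
  entry \<open>\<Sum>(x, h)\<leftarrow>v. \<Phi> x h\<close>. The empty list has no first row and is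
  treated separately.\<close>

lemma semi_map_opform:
  assumes H1: "hilbert_space H1" and H2: "hilbert_space H2" and \<phi>: "\<And>a. \<phi> a \<in> bop H1 H1"
    and \<Phi>: "completely_semi_map ip H1 H2 \<phi> \<Phi>" and v: "snd ` set v \<subseteq> hset H1"
  shows "opform H1 (\<lambda>x y. \<phi> (ip x y)) v - of_real ((hnorm H2 (\<Sum>(x, h)\<leftarrow>v. \<Phi> x h))\<^sup>2) \<in> \<real>\<^sub>\<ge>\<^sub>0"
proof (cases "v = []")
  case False
  let ?n = "length v" and ?h = "list_vec v"
  have n: "0 < ?n"
    using False by simp
  have \<Phi>_bop: "\<Phi> x \<in> bop H1 H2" for x
    using \<Phi> unfolding completely_semi_map_def by blast
  have \<Phi>0: "\<Phi> 0 = 0"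
    using \<Phi> cvec.scale_zero_left unfolding completely_semi_map_def clinear_iff by (metis scaleC_zero_left)
  let ?x = "\<lambda>k j. if k = 0 then fst (v ! j) else 0"
  let ?F = "mat_op ?n H1 (\<lambda>i j. \<Phi> (?x i j))"
  let ?G = "mat_op ?n H1 (\<lambda>i j. \<phi> (mod_mat_ip ip ?n ?x ?x i j))"
  define s where "s z = (\<Sum>j<?n. \<Phi> (fst (v ! j)) (z j))" for z
  have F: "?F z i = (if i = 0 then s z else 0)" if z: "z \<in> hset (hpow ?n H1)" for z i
    using n by (auto simp: mat_op_apply[OF z] s_def \<Phi>0)
  have s_mem: "s z \<in> hset H2" if "z \<in> hset (hpow ?n H1)" for z
    unfolding s_def using that by (intro hs_sum[OF H2] bop_mem[OF \<Phi>_bop]) (simp add: hset_hpow)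
  note h = list_vec_mem[OF v]
  have Fh: "?F ?h \<in> hset (hpow ?n H2)"
    using n s_mem[OF h] H2 by (simp add: hset_hpow F[OF h])
  have hip_F: "hip (hpow ?n H2) (?F z) (?F ?h) = hip H2 (s z) (s ?h)" if z: "z \<in> hset (hpow ?n H1)" for z
  proof -
    have "hip (hpow ?n H2) (?F z) (?F ?h) = (\<Sum>i<?n. if i = 0 then hip H2 (s z) (s ?h) else 0)"
      unfolding hip_hpow using H2 by (intro sum.cong) (auto simp: F[OF z] F[OF h])
    then show ?thesis
      using n by (simp add: sum.delta)
  qed
  \<comment> \<open>The value of the matrix adjoint at \<open>?F ?h\<close>, written down entrywise:
    only the first row contributes.\<close>
  define w where "w j = (if j < ?n then hadj H1 H2 (\<Phi> (fst (v ! j))) (s ?h) else 0)" for j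
  have w: "w \<in> hset (hpow ?n H1)"
    using hadj_mem[OF H1 H2 \<Phi>_bop s_mem[OF h]] by (simp add: hset_hpow w_def)
  have hip_w: "hip (hpow ?n H1) z w = hip H2 (s z) (s ?h)" if z: "z \<in> hset (hpow ?n H1)" for z
  proof -
    have "hip H2 (s z) (s ?h) = (\<Sum>j<?n. hip H2 (\<Phi> (fst (v ! j)) (z j)) (s ?h))"
      unfolding s_def[of z]
      by (rule hip_sum_left[OF H2 s_mem[OF h]]) (use z in \<open>simp add: bop_mem[OF \<Phi>_bop] hset_hpow\<close>)
    also have "\<dots> = hip (hpow ?n H1) z w"
      unfolding hip_hpow using z
      by (intro sum.cong) (simp_all add: w_def hip_hadj_right[OF H1 H2 \<Phi>_bop s_mem[OF h]] hset_hpow)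
    finally show ?thesis ..
  qed
  have adj: "hadj (hpow ?n H1) (hpow ?n H2) ?F (?F ?h) = w"
    by (rule hadj_hpow_unique[OF H1 w Fh]) (simp add: hip_w hip_F)
  have "positive_op (hpow ?n H1) (?G - (hadj (hpow ?n H1) (hpow ?n H2) ?F \<circ> ?F))"
    using \<Phi> unfolding completely_semi_map_def Let_def op_le_def by blast
  from positive_op_nonneg[OF this h]
  have "hip (hpow ?n H1) ?h (?G ?h - w) \<in> \<real>\<^sub>\<ge>\<^sub>0"
    using adj by simp
  also have "?G = mat_op ?n H1 (\<lambda>i j. \<phi> (ip (fst (v ! i)) (fst (v ! j))))"
    by (rule mat_op_cong) (simp add: mod_mat_ip_row)
  also have "hip (hpow ?n H1) ?h (mat_op ?n H1 (\<lambda>i j. \<phi> (ip (fst (v ! i)) (fst (v ! j)))) ?h - w) =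
      hip (hpow ?n H1) ?h (mat_op ?n H1 (\<lambda>i j. \<phi> (ip (fst (v ! i)) (fst (v ! j)))) ?h) -
      hip (hpow ?n H1) ?h w"
  proof -
    have "mat_op ?n H1 (\<lambda>i j. \<phi> (ip (fst (v ! i)) (fst (v ! j)))) ?h i \<in> hset H1" for i
      using h H1 by (auto simp: mat_op_apply[OF h] hset_hpow intro!: hs_sum bop_mem[OF \<phi>])
    then show ?thesis
      unfolding hip_hpow sum_subtractf[symmetric] using H1 h w
      by (intro sum.cong) (simp_all add: hset_hpow)
  qed
  also have "hip (hpow ?n H1) ?h (mat_op ?n H1 (\<lambda>i j. \<phi> (ip (fst (v ! i)) (fst (v ! j)))) ?h) =
      opform H1 (\<lambda>x y. \<phi> (ip x y)) v"
    by (rule opform_mat_op[OF H1 v \<phi>])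
  also have "hip (hpow ?n H1) ?h w = of_real ((hnorm H2 (s ?h))\<^sup>2)"
    using hip_w[OF h] hip_self[OF H2 s_mem[OF h]] by simp
  also have "s ?h = (\<Sum>(x, h)\<leftarrow>v. \<Phi> x h)"
    unfolding s_def case_prod_unfold
    by (simp add: sum_list_sum_nth atLeast0LessThan list_vec_def)
  finally show ?thesis .
qed (simp add: H2)

lemma rank_one_zero [simp]: "rank_one act ip 0 y = 0" "rank_one act ip x 0 = 0"
  by (simp_all add: rank_one_def zero_blinfun_def)

lemma mod_adj_eqI:
  assumes "\<And>x y. ip (blinfun_apply u x) y = ip x (blinfun_apply w y)"
  shows "mod_adj ip u = w"
  unfolding mod_adj_def
proof (rule the_equality)
  fix w'
  assume w': "\<forall>x y. ip (blinfun_apply u x) y = ip x (blinfun_apply w' y)"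
  show "w' = w"
  proof (rule blinfun_eqI)
    fix y
    define d where "d = blinfun_apply w' y - blinfun_apply w y"
    have "ip d (blinfun_apply w' y) = ip d (blinfun_apply w y)"
      using w' assms by metis
    moreover have "blinfun_apply w' y = d + blinfun_apply w y"
      by (simp add: d_def)
    ultimately have "ip d d = 0"
      by (metis add_cancel_left_left ip_add_right)
    then show "blinfun_apply w' y = blinfun_apply w y"
      using ip_definite[of d] by (simp add: d_def)
  qed
qed (use assms in blast)

lemma mod_adj_zero [simp]: "mod_adj ip 0 = 0"
  and mod_adj_id [simp]: "mod_adj ip id_blinfun = id_blinfun"
  by (rule mod_adj_eqI; simp)+

text \<open>Gram matrices of a single row, padded by zero rows. Every positivity test drawn from
  domination has this shape, with entries chosen to lie in the operator system.\<close>

lemma linking_pos_mat_row: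
  assumes Z: "\<And>i. Z i \<in> linking_algebra act ip"
    and X: "\<And>i j. X i j = linking_mult act ip (linking_star ip (Z i)) (Z j)"
    and zero: "0 \<in> linking_algebra act ip"
  shows "linking_pos_mat act ip n X"
  unfolding linking_pos_mat_def
proof (intro exI[of _ "\<lambda>k i. if k = 0 then Z i else 0"] conjI allI impI)
  fix i j
  assume "i < n"
  have "linking_mult act ip (linking_star ip 0) 0 = 0"
    by (simp add: zero_prod_def)
  then have "(\<Sum>k<n. linking_mult act ip (linking_star ip (if k = 0 then Z i else 0)) (if k = 0 then Z j else 0)) =
      (\<Sum>k<n. if k = 0 then X i j else 0)"
    by (intro sum.cong) (auto simp: X)
  then show "X i j = (\<Sum>k<n. linking_mult act ip (linking_star ip (if k = 0 then Z i else 0))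
      (if k = 0 then Z j else 0))"
    using \<open>i < n\<close> by (simp add: sum.delta)
qed (use Z zero in simp)

lemma zero_compact: "0 \<in> compact_ops act ip"
  unfolding compact_ops_def using closure_subset span_zero by blast

lemma linking_algebra_scalar: "c \<in> {0, 1} \<Longrightarrow> (scalar_op c, x, y, a) \<in> linking_algebra act ip"
  unfolding linking_algebra_def compact_ops1_def using zero_compact by force

lemma linking_algebra_0: "(0, x, y, a) \<in> linking_algebra act ip"
  and linking_algebra_id: "(id_blinfun, x, y, a) \<in> linking_algebra act ip"
  using linking_algebra_scalar[of 0 x y a] linking_algebra_scalar[of 1 x y a]
  by (simp_all add: scalar_op_0 scalar_op_1)

lemma zero_linking: "0 \<in> linking_algebra act ip"
  using linking_algebra_0[of 0 0 0] by (simp add: zero_prod_def)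

lemma alg_pos_mat: "linking_pos_mat act ip n (\<lambda>i j. (0, 0, 0, star (a i) * a j))"
  by (rule linking_pos_mat_row[where Z = "\<lambda>i. (0, 0, 0, a i)"])
    (simp_all add: linking_algebra_0 zero_linking)

lemma mod_pos_mat: "linking_pos_mat act ip n (\<lambda>i j. (0, 0, 0, ip (x i) (x j)))"
  by (rule linking_pos_mat_row[where Z = "\<lambda>i. (0, x i, 0, 0)"])
    (simp_all add: linking_algebra_0 zero_linking)

text \<open>The entry is the square of the element with rows \<open>(I, x)\<close> and
  \<open>(0, 0)\<close>.\<close>

lemma id_pos_mat: "linking_pos_mat act ip n (\<lambda>i j. (id_blinfun, x, x, ip x x))"
proof -
  have "id_blinfun o\<^sub>L id_blinfun = (id_blinfun :: 'e \<Rightarrow>\<^sub>L 'e)"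
    by (rule blinfun_eqI) simp
  then show ?thesis
    by (intro linking_pos_mat_row[where Z = "\<lambda>i. (id_blinfun, x, 0, 0)"])
      (simp_all add: linking_algebra_id zero_linking)
qed

end

section \<open>Consequences of domination\<close>

locale dominated_pairs = hilbert_module act ip
  for act :: "'e::complex_banach \<Rightarrow> 'a::cstar_algebra_1 \<Rightarrow> 'e" and ip :: "'e \<Rightarrow> 'e \<Rightarrow> 'a" +
  fixes H1 :: "'h1::complex_vector hspace" and H2 :: "'h2::complex_vector hspace"
    and \<phi>1 \<phi>2 :: "'a \<Rightarrow> 'h1 \<Rightarrow> 'h1" and \<Phi>1 \<Phi>2 :: "'e \<Rightarrow> 'h1 \<Rightarrow> 'h2"
  assumes H1 [simp]: "hilbert_space H1" and H2 [simp]: "hilbert_space H2"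
    and cpe1: "(\<phi>1, \<Phi>1) \<in> CPE ip H1 H2" and cpe2: "(\<phi>2, \<Phi>2) \<in> CPE ip H1 H2"
    and dom: "dominated act ip H1 H2 (\<phi>1, \<Phi>1) (\<phi>2, \<Phi>2)"
begin

lemma cp1: "cp_map H1 \<phi>1" and cp2: "cp_map H1 \<phi>2"
  and semi1: "completely_semi_map ip H1 H2 \<phi>1 \<Phi>1" and semi2: "completely_semi_map ip H1 H2 \<phi>2 \<Phi>2"
  using cpe1 cpe2 by (simp_all add: CPE_def)

lemmas \<phi>1_bop = cp_map_bop[OF cp1] and \<phi>2_bop = cp_map_bop[OF cp2]

lemma \<Phi>1_bop: "\<Phi>1 x \<in> bop H1 H2" and \<Phi>2_bop: "\<Phi>2 x \<in> bop H1 H2"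
  using semi1 semi2 unfolding completely_semi_map_def by blast+

definition \<Theta> :: "('e, 'a) linking \<Rightarrow> 'h2 \<times> 'h1 \<Rightarrow> 'h2 \<times> 'h1" where
  "\<Theta> X = system_map H1 H2 (\<phi>2, \<Phi>2) X - system_map H1 H2 (\<phi>1, \<Phi>1) X"

lemma \<Theta>_apply:
  assumes "g \<in> hset H2" "h \<in> hset H1"
  shows "\<Theta> (u, x, y, a) (g, h) = (\<Phi>2 x h - \<Phi>1 x h,
    hadj H1 H2 (\<Phi>2 y) g - hadj H1 H2 (\<Phi>1 y) g + (\<phi>2 a h - \<phi>1 a h))"
  using assms by (simp add: \<Theta>_def block_op_def on_hset_def)

lemma \<Theta>_positive:
  assumes "\<And>i j. X i j \<in> op_system" "linking_pos_mat act ip n X"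
  shows "positive_op (hpow n (hsum H2 H1)) (mat_op n (hsum H2 H1) (\<lambda>i j. \<Theta> (X i j)))"
  using dom assms unfolding dominated_def system_cp_def \<Theta>_def by blast

lemma \<Phi>_eq: "\<Phi>1 = \<Phi>2"
proof
  fix x
  show "\<Phi>1 x = \<Phi>2 x"
  proof (rule bop_eqI[OF \<Phi>1_bop \<Phi>2_bop])
    fix h
    assume h: "h \<in> hset H1"
    define D where "D = \<Phi>2 x h - \<Phi>1 x h"
    define r where "r = Re (hip H1 h (\<phi>2 (ip x x) h - \<phi>1 (ip x x) h))"
    have D: "D \<in> hset H2"
      using h by (simp add: D_def bop_mem[OF \<Phi>1_bop] bop_mem[OF \<Phi>2_bop])
    have "positive_op (hpow 1 (hsum H2 H1)) (mat_op 1 (hsum H2 H1) (\<lambda>i j. \<Theta> (id_blinfun, x, x, ip x x)))"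
      by (rule \<Theta>_positive[OF op_system_id id_pos_mat])
    note pos = positive_op_Re[OF this]
    have "t * (2 * (hnorm H2 D)\<^sup>2) \<le> r" if t: "t > 0" for t :: real
    proof -
      \<comment> \<open>The upper corner of the difference is 0, so with this \<open>g\<close> the
        form is \<open>r\<close> minus \<open>2 * t\<close> times the squared norm of
        \<open>D\<close>; it stays nonnegative for all large \<open>t\<close> only if
        \<open>D = 0\<close>.\<close>
      define g where "g = (- of_real t) *\<^sub>C D"
      have g: "g \<in> hset H2"
        using D by (simp add: g_def)
      define p where "p i = (if i = 0 then (g, h) else 0)" for i :: nat
      have p: "p \<in> hset (hpow 1 (hsum H2 H1))"
        using g h by (auto simp: hset_hpow p_def)
      have "0 \<le> Re (hip (hsum H2 H1) (g, h) (\<Theta> (id_blinfun, x, x, ip x x) (g, h)))"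
        using pos[OF p] by (simp add: hip_hpow mat_op_apply[OF p[unfolded One_nat_def]] p_def lessThan_Suc)
      also have "\<dots> = Re (hip H2 g D) +
          Re (hip H1 h (hadj H1 H2 (\<Phi>2 x) g - hadj H1 H2 (\<Phi>1 x) g)) + r"
        using g h by (simp add: \<Theta>_apply D_def r_def hadj_mem[OF H1 H2 \<Phi>1_bop] hadj_mem[OF H1 H2 \<Phi>2_bop]
            bop_mem[OF \<phi>1_bop] bop_mem[OF \<phi>2_bop])
      also have "hip H1 h (hadj H1 H2 (\<Phi>2 x) g - hadj H1 H2 (\<Phi>1 x) g) = hip H2 D g"
        using g h by (simp add: D_def hadj_mem[OF H1 H2 \<Phi>1_bop] hadj_mem[OF H1 H2 \<Phi>2_bop]
            hip_hadj_right[OF H1 H2 \<Phi>1_bop] hip_hadj_right[OF H1 H2 \<Phi>2_bop]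
            bop_mem[OF \<Phi>1_bop] bop_mem[OF \<Phi>2_bop])
      finally show ?thesis
        using D by (simp add: g_def hip_self)
    qed note * = this
    have "hnorm H2 D = 0"
    proof (rule ccontr)
      assume "hnorm H2 D \<noteq> 0"
      then have pos: "2 * (hnorm H2 D)\<^sup>2 > 0"
        by simp
      have "(\<bar>r\<bar> + 1) / (2 * (hnorm H2 D)\<^sup>2) * (2 * (hnorm H2 D)\<^sup>2) \<le> r"
        using pos by (intro *) (simp add: divide_pos_pos)
      with pos show False
        by simp
    qed
    then show "\<Phi>1 x h = \<Phi>2 x h"
      using D by (simp add: D_def)
  qed
qed

text \<open>Vectors with vanishing component in \<open>H2\<close> see only the lower right corner.
  Keeping \<open>c\<close> abstract covers both \<open>star a * b\<close> and
  \<open>ip x y\<close>.\<close>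

lemma diff_opform:
  assumes v: "snd ` set v \<subseteq> hset H1"
    and pos: "\<And>n x. linking_pos_mat act ip n (\<lambda>i j. (0, 0, 0, c (x i) (x j)))"
  shows "opform H1 (\<lambda>x y. \<phi>2 (c x y) - \<phi>1 (c x y)) v \<in> \<real>\<^sub>\<ge>\<^sub>0"
proof -
  let ?n = "length v" and ?S = "hsum H2 H1"
  define p where "p i = (0 :: 'h2, list_vec v i)" for i
  have p: "p \<in> hset (hpow ?n ?S)"
    using list_vec_mem[OF v] by (auto simp: hset_hpow p_def zero_prod_def)
  let ?X = "\<lambda>i j. (0 :: 'e \<Rightarrow>\<^sub>L 'e, 0 :: 'e, 0 :: 'e, c (fst (v ! i)) (fst (v ! j)))"
  have \<Theta>: "\<Theta> (?X i j) (p k) = (\<Phi>2 0 (list_vec v k) - \<Phi>1 0 (list_vec v k),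
      \<phi>2 (c (fst (v ! i)) (fst (v ! j))) (list_vec v k) - \<phi>1 (c (fst (v ! i)) (fst (v ! j))) (list_vec v k))"
    if "k < ?n" for i j k
    using that list_vec_mem[OF v] bop_zero[OF H2 hadj_bop[OF H1 H2 \<Phi>1_bop]]
      bop_zero[OF H2 hadj_bop[OF H1 H2 \<Phi>2_bop]]
    by (simp add: p_def \<Theta>_apply hset_hpow)
  have "hip (hpow ?n ?S) p (mat_op ?n ?S (\<lambda>i j. \<Theta> (?X i j)) p) \<in> \<real>\<^sub>\<ge>\<^sub>0"
    by (rule positive_op_nonneg[OF \<Theta>_positive[OF op_system_0 pos] p])
  also have "hip (hpow ?n ?S) p (mat_op ?n ?S (\<lambda>i j. \<Theta> (?X i j)) p) =
      hip (hpow ?n H1) (list_vec v) (mat_op ?n H1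
        (\<lambda>i j. \<phi>2 (c (fst (v ! i)) (fst (v ! j))) - \<phi>1 (c (fst (v ! i)) (fst (v ! j)))) (list_vec v))"
    unfolding hip_hpow
  proof (rule sum.cong)
    fix i
    assume "i \<in> {..<?n}"
    then have i: "i < ?n"
      by simp
    have fst_mem: "(\<Sum>j<?n. fst (\<Theta> (?X i j) (p j))) \<in> hset H2"
      using list_vec_mem[OF v]
      by (intro hs_sum[OF H2]) (simp add: \<Theta> hset_hpow bop_mem[OF \<Phi>1_bop] bop_mem[OF \<Phi>2_bop])
    show "hip ?S (p i) (mat_op ?n ?S (\<lambda>i j. \<Theta> (?X i j)) p i) = hip H1 (list_vec v i)
        (mat_op ?n H1 (\<lambda>i j. \<phi>2 (c (fst (v ! i)) (fst (v ! j))) - \<phi>1 (c (fst (v ! i)) (fst (v ! j)))) (list_vec v) i)"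
      using i hip_zero_left[OF H2 fst_mem]
      by (simp add: mat_op_apply[OF p] mat_op_apply[OF list_vec_mem[OF v]] fst_sum snd_sum p_def[of i] \<Theta>)
  qed simp
  also have "\<dots> = opform H1 (\<lambda>x y. \<phi>2 (c x y) - \<phi>1 (c x y)) v"
    by (rule opform_mat_op[OF H1 v]) (rule bop_minus[OF H1 H1 \<phi>2_bop \<phi>1_bop])
  finally show ?thesis .
qed

definition \<theta> :: "nat \<Rightarrow> 'a \<Rightarrow> 'h1 \<Rightarrow> 'h1" where
  "\<theta> r a = (if r = 0 then \<phi>1 a else \<phi>2 a - \<phi>1 a)"

lemma data: "full_module ip \<Longrightarrow> dominated_data act ip H1 H2 \<theta> \<Phi>1"
proof
  have lin: "\<phi>1 (a + b) = \<phi>1 a + \<phi>1 b" "\<phi>1 (z *\<^sub>C a) = z *\<^sub>C \<phi>1 a"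
    "\<phi>2 (a + b) = \<phi>2 a + \<phi>2 b" "\<phi>2 (z *\<^sub>C a) = z *\<^sub>C \<phi>2 a" for a b z
    using cp_map_linear[OF cp1] cp_map_linear[OF cp2] by (simp_all only: clinear_iff)
  show "\<theta> r a \<in> bop H1 H1" for r a
    using bop_minus[OF H1 H1 \<phi>2_bop \<phi>1_bop] \<phi>1_bop by (simp add: \<theta>_def)
  show "\<theta> r (a + b) = \<theta> r a + \<theta> r b" for r a b
    by (simp add: \<theta>_def lin)
  show "\<theta> r (z *\<^sub>C a) = z *\<^sub>C \<theta> r a" for r a z
    by (simp add: \<theta>_def lin cvec.scale_right_diff_distrib)
  show "opform H1 (\<lambda>a b. \<theta> r (star a * b)) v \<in> \<real>\<^sub>\<ge>\<^sub>0" if v: "snd ` set v \<subseteq> hset H1" for r v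
    using cp_map_opform[OF H1 cp1 v] diff_opform[where c = "\<lambda>a b. star a * b", OF v alg_pos_mat] by (cases "r = 0") (simp_all add: \<theta>_def)
  note semi = semi_map_opform[OF H1 H2 \<phi>1_bop semi1]
  show "(hnorm H2 (\<Sum>(x, h)\<leftarrow>v. \<Phi>1 x h))\<^sup>2 \<le> Re (opform H1 (\<lambda>x y. \<theta> 0 (ip x y)) v)"
    if v: "snd ` set v \<subseteq> hset H1" for v
    using semi[OF v] by (simp add: \<theta>_def complex_nonneg_Reals_iff)
  show "opform H1 (\<lambda>x y. \<theta> r (ip x y)) v \<in> \<real>\<^sub>\<ge>\<^sub>0" if v: "snd ` set v \<subseteq> hset H1" for r v
  proof (cases "r = 0")
    case True
    \<comment> \<open>For \<open>\<phi>1\<close> itself, positivity over the module is read off the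
      semi-map inequality, where the form dominates a squared norm.\<close>
    have "opform H1 (\<lambda>x y. \<phi>1 (ip x y)) v \<in> \<real>\<^sub>\<ge>\<^sub>0"
      using semi[OF v] order_trans[OF zero_le_power2[of "hnorm H2 (\<Sum>(x, h)\<leftarrow>v. \<Phi>1 x h)"]]
      by (simp add: complex_nonneg_Reals_iff)
    then show ?thesis
      by (simp add: \<theta>_def True)
  next
    case False
    then show ?thesis
      using diff_opform[where c = ip, OF v mod_pos_mat] by (simp add: \<theta>_def)
  qed
qed (simp_all add: \<Phi>1_bop)

end

theorem theorem5p5:
  fixes act :: "'e::complex_banach \<Rightarrow> 'a::cstar_algebra_1 \<Rightarrow> 'e"
    and ip :: "'e \<Rightarrow> 'e \<Rightarrow> 'a"
    and H1 :: "'h1::complex_vector hspace"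
    and H2 :: "'h2::complex_vector hspace"
    and \<phi>1 \<phi>2 :: "'a \<Rightarrow> 'h1 \<Rightarrow> 'h1"
    and \<Phi>1 \<Phi>2 :: "'e \<Rightarrow> 'h1 \<Rightarrow> 'h2"
  assumes "hilbert_module act ip" and "full_module ip"
    and "hilbert_space H1" and "hilbert_space H2"
    and "(\<phi>1, \<Phi>1) \<in> CPE ip H1 H2" and "(\<phi>2, \<Phi>2) \<in> CPE ip H1 H2"
    and "dominated act ip H1 H2 (\<phi>1, \<Phi>1) (\<phi>2, \<Phi>2)"
  shows "\<exists>(K1 :: ('a, 'h1) dil_space1 hspace) (K2 :: ('e, 'h1) dil_space2 hspace) \<rho> \<Psi> W' W.
    dilation_pair ip H1 H2 (\<phi>2, \<Phi>2) (\<rho>, K1, W') (\<Psi>, K2, W) \<and>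
    nondegenerate K1 K2 \<Psi> \<and>
    (\<exists>!TS. case TS of (T, S) \<Rightarrow>
      T \<in> bop K2 K2 \<and> S \<in> bop K1 K1 \<and>
      diag_op K2 K1 T S \<in> commutant K1 K2 \<Psi> \<and>
      positive_op (hsum K2 K1) (diag_op K2 K1 T S) \<and>
      contraction_op (hsum K2 K1) (diag_op K2 K1 T S) \<and>
      (\<forall>a. \<phi>1 a = hadj H1 K1 W' \<circ> S \<circ> \<rho> a \<circ> W') \<and>
      (\<forall>e. \<Phi>1 e = hadj H2 K2 W \<circ> op_sqrt K2 T \<circ> \<Psi> e \<circ> op_sqrt K1 S \<circ> W'))"
proof -
  interpret hilbert_module act ip
    by fact
  interpret dominated_pairs act ip H1 H2 \<phi>1 \<phi>2 \<Phi>1 \<Phi>2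
    by unfold_locales fact+
  interpret D: dominated_data act ip H1 H2 \<theta> \<Phi>1
    by (rule data) fact
  have "\<theta> 0 = \<phi>1" "(\<lambda>a. \<theta> 0 a + \<theta> 1 a) = \<phi>2"
    by (simp_all add: \<theta>_def fun_eq_iff)
  with D.ambient have "ambient_dilation act ip H1 H2 D.L1 D.L2 \<phi>1 \<phi>2 \<Phi>1 D.\<rho> D.\<Psi> D.V D.W D.P1 D.P2"
    by simp
  \<comment> \<open>The ambient data are built from \<open>\<Phi>1\<close>; the equality of the two
    module maps lets the same dilation serve the second pair.\<close>
  from ambient_dilation.dilation_with_unique_derivative[OF this] show ?thesis
    unfolding \<Phi>_eq .
qed

end
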